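(* Let $\lambda\in(0,1)$ and let $\{Z_n\}_{n=0}^\infty$ be a $\lambda$-natural random walk on an augmented tree $(X,E,\Phi)$ of a compact space of homogeneous type $(K,\rho,\mu)$. Then the ever-visiting probability satisfies $$F(x,y)\asymp\lambda^{|x|-(x|y)}\,\mu(\Phi(y))\,p_\mu(x,y)^{-1},\qquad\forall\,x,y\in X.$$ Consequently the Martin kernel satisfies $$K(x,\eta)\asymp\lambda^{|x|-(x|\eta)}\,p_\mu(x,\eta)^{-1},\qquad\forall\,x\in X,\ \eta\in X\cup K,$$ where $K$ is identified with the Martin boundary and the hyperbolic boundary.
   Context: **Notation.** $f\asymp g$ means that $C^{-1}g\le f\le Cg$ for a constant $C>0$ independent of the variables. **Spaces.** A quasi-metric $\rho$ on a set $K$ satisfies the axioms of a metric except that the triangle inequality is weakened to $\rho(\xi,\eta)\le C_\rho(\rho(\xi,\zeta)+\rho(\zeta,\eta))$ for some $C_\rho\ge1$. Put $B(\xi,r)=\{\eta:\rho(\xi,\eta)<r\}$; a set $\Omega$ is open if each $\xi\in\Omega$ has some $B(\xi,\varepsilon)\subset\Omega$, $\varepsilon>0$. A compact space of homogeneous type $(K,\rho,\mu)$ is a set $K$ with a quasi-metric $\rho$ for which $K$ is compact and all balls are open, and a non-negative regular Borel measure $\mu$ that is doubling: for some $C>0$, $0<\mu(B(\xi,2r))\le C\mu(B(\xi,r))<\infty$ for all $\xi\in K$, $r>0$. Standing normalization: $\sup_{\xi,\eta\in K}\rho(\xi,\eta)=1$ and $\mu(K)=1$. **Rooted graphs.** For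 a countably infinite connected graph $(X,E)$ with root $\vartheta$ and graph distance $d$, put $|x|=d(\vartheta,x)$, $\mathcal J_n=\{x:|x|=n\}$; $y\prec x$ means that $x$ lies on some geodesic from $\vartheta$ to $y$; $\mathcal J_m(x)=\{y\prec x:|y|=|x|+m\}$. A rooted tree is such a graph where all edges join consecutive levels and each $x\ne\vartheta$ has a unique parent $x^-$ (so $x\in\mathcal J_1(x^-)$). **Augmented tree.** $(X,E_v,\Phi)$ is an index tree of $(K,\rho,\mu)$ if $(X,E_v)$ is a rooted tree and $\Phi$ maps $X$ to nonempty compact subsets of $K$ with: (i) $\Phi(\vartheta)=K$ and $\Phi(x)=\bigcup_{y\in\mathcal J_1(x)}\Phi(y)$ for all $x$; (ii) there are $b,c>0$ and $r_0\in(0,1)$ (the contraction ratio) such that each $x\in X$ admits $\xi_x\in K$ with $B(\xi_x,br_0^{|x|})\subset\Phi(x)\subset B(\xi_x,cr_0^{|x|})$; (iii) $\mu(\Phi(x)\cap\Phi(y))=0$ for distinct $x,y$ with $|x|=|y|$. For a fixed $\gamma>0$, let $E_h=\bigcup_{m\ge1}\{(x,y)\in\mathcal J_m\times\mathcal J_m:x\ne y,\ \mathrm{dist}(\Phi(x),\Phi(y))\le\gamma r_0^m\}$ and $E=E_v\cup E_h$; then $(X,E,\Phi)$ is an augmented tree. Edges in $E_v$ are vertical, those in $E_h$ horizontal. **Hyperbolic boundary.** The Gromov product is $(x|y)=\frac12(|x|+|y|-d(x,y))$. The augmented tree is Gromov hyperbolic. For $a>0$ let $\varrho_a(x,y)=e^{-a(x|y)}$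 ($x\ne y$), $\varrho_a(x,x)=0$; $\widehat X_H$ is the $\varrho_a$-completion of $X$ and $\partial_HX=\widehat X_H\setminus X$. $\partial_HX$ is identified with $K$ through the homeomorphism $\hat\kappa:\partial_HX\to K$, where $\hat\kappa(\xi)$ is the unique point of $\bigcap_n\Phi(x_n)$ for any geodesic ray $[\vartheta,x_1,x_2,\dots]$ converging to $\xi$. For $x\in X$, $\eta\in\partial_HX$, $(x|\eta)=\sup\lim_n(x|y_n)$, the supremum over geodesic rays $[\vartheta,y_1,\dots]$ converging to $\eta$. **Canonical geodesics and $p_\mu$.** Only geodesics consisting of a vertical part, a horizontal part (possibly a single vertex) and a vertical part are considered: $\pi(x,u),\pi(u,v),\pi(v,y)$ with $x\prec u$, $y\prec v$, $|u|=|v|$. Such a geodesic is canonical if its horizontal part lies in the level $\mathcal J_n$ with $n$ smallest possible. If an endpoint lies in $\partial_HX=K$, the corresponding vertical part is a geodesic ray converging to it. For $\xi\ne\eta\in X\cup K$, $p_\mu(\xi,\eta)=\sup\{\mu(\Phi(z)):z\in X\text{ lies on some canonical geodesic between }\xi\text{ and }\eta\}$; for $x\in X$, $p_\mu(x,x)=\mu(\Phi(x))$. **Random walks.** A conductance is $c\ge0$ on $X\times X$ with $c(x,y)=c(y,x)$ and $c(x,y)>0$ iff $(x,y)\in E$; $m(x)=\sum_yc(x,y)$; the reversible random walk has $P(x,y)=c(x,y)/m(x)$. It is $\lambda$-natural ($\lambda\in(0,1)$) if $c(x,x^-)=\lambda^{-|x|}\mu(\Phi(x))$ for all $x\ne\vartheta$,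 and $c(x,y)\asymp c(x,x^-)$ for all $(x,y)\in E_h$. Such a walk is transient. Let $G(x,y)=\sum_nP^n(x,y)$, $F(x,y)=\mathbb P_x(\exists\,n\ge0:Z_n=y)$ (ever-visiting probability), and $K(x,y)=G(x,y)/G(\vartheta,y)=F(x,y)/F(\vartheta,y)$ (Martin kernel). $\widehat X$ is the compactification of $X$ to which all $K(x,\cdot)$ extend continuously, and $\mathcal M=\widehat X\setminus X$ is the Martin boundary, identified with $\partial_HX$ (via the extension of the identity of $X$) and hence with $K$; $K(x,\eta)$ for $\eta\in K$ denotes the extended kernel. *)

theory Defs
  imports "HOL-Probability.Probability"
begin

section \<open>Comparability\<close>

definition comparable_on :: "'a set \<Rightarrow> ('a \<Rightarrow> real) \<Rightarrow> ('a \<Rightarrow> real) \<Rightarrow> bool" where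
  "comparable_on S f g \<longleftrightarrow> (\<exists>C>0. \<forall>v\<in>S. inverse C * g v \<le> f v \<and> f v \<le> C * g v)"


section \<open>Compact spaces of homogeneous type\<close>

text \<open>The set \<open>K\<close> is the type \<open>'k\<close>; its topology is the one induced by the quasi-metric.\<close>

definition quasi_metric :: "('k \<Rightarrow> 'k \<Rightarrow> real) \<Rightarrow> bool" where
  "quasi_metric \<rho> \<longleftrightarrow>
     (\<forall>\<xi> \<eta>. 0 \<le> \<rho> \<xi> \<eta>) \<and> (\<forall>\<xi> \<eta>. \<rho> \<xi> \<eta> = 0 \<longleftrightarrow> \<xi> = \<eta>) \<and> (\<forall>\<xi> \<eta>. \<rho> \<xi> \<eta> = \<rho> \<eta> \<xi>) \<and>
     (\<exists>C\<ge>1. \<forall>\<xi> \<eta> \<zeta>. \<rho> \<xi> \<eta> \<le> C * (\<rho> \<xi> \<zeta> + \<rho> \<zeta> \<eta>))"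

definition qball :: "('k \<Rightarrow> 'k \<Rightarrow> real) \<Rightarrow> 'k \<Rightarrow> real \<Rightarrow> 'k set" where
  "qball \<rho> \<xi> r = {\<eta>. \<rho> \<xi> \<eta> < r}"

definition qtopology :: "('k \<Rightarrow> 'k \<Rightarrow> real) \<Rightarrow> 'k topology" where
  "qtopology \<rho> = topology (\<lambda>U. \<forall>\<xi>\<in>U. \<exists>\<epsilon>>0. qball \<rho> \<xi> \<epsilon> \<subseteq> U)"

lemma openin_qtopology: "openin (qtopology \<rho>) U \<longleftrightarrow> (\<forall>\<xi>\<in>U. \<exists>\<epsilon>>0. qball \<rho> \<xi> \<epsilon> \<subseteq> U)"
proof -
  have "istopology (\<lambda>U. \<forall>\<xi>\<in>U. \<exists>\<epsilon>>0. qball \<rho> \<xi> \<epsilon> \<subseteq> U)"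
    unfolding istopology_def
  proof (intro conjI allI impI ballI)
    fix S T \<xi>
    assume S: "\<forall>\<xi>\<in>S. \<exists>\<epsilon>>0. qball \<rho> \<xi> \<epsilon> \<subseteq> S"
      and T: "\<forall>\<xi>\<in>T. \<exists>\<epsilon>>0. qball \<rho> \<xi> \<epsilon> \<subseteq> T" and x: "\<xi> \<in> S \<inter> T"
    obtain e1 where "e1 > 0" "qball \<rho> \<xi> e1 \<subseteq> S" using S x by blast
    moreover obtain e2 where "e2 > 0" "qball \<rho> \<xi> e2 \<subseteq> T" using T x by blast
    ultimately show "\<exists>\<epsilon>>0. qball \<rho> \<xi> \<epsilon> \<subseteq> S \<inter> T"
      by (intro exI[of _ "min e1 e2"]) (auto simp: qball_def)
  next
    fix \<K> \<xi>
    assume "\<forall>S\<in>\<K>. \<forall>\<xi>\<in>S. \<exists>\<epsilon>>0. qball \<rho> \<xi> \<epsilon> \<subseteq> S" and "\<xi> \<in> \<Union>\<K>"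
    then show "\<exists>\<epsilon>>0. qball \<rho> \<xi> \<epsilon> \<subseteq> \<Union>\<K>"
      by (meson UnionE Union_upper order_trans)
  qed
  then show ?thesis
    by (simp add: qtopology_def topology_inverse')
qed

lemma topspace_qtopology: "topspace (qtopology \<rho>) = UNIV"
  unfolding topspace_def openin_qtopology by (auto intro!: exI[of _ UNIV] exI[of _ 1])

definition regular_borel_measure :: "'k topology \<Rightarrow> 'k measure \<Rightarrow> bool" where
  "regular_borel_measure T \<mu> \<longleftrightarrow>
     sets \<mu> = sigma_sets (topspace T) {U. openin T U} \<and>
     (\<forall>A\<in>sets \<mu>. emeasure \<mu> A = (INF U\<in>{U. openin T U \<and> A \<subseteq> U}. emeasure \<mu> U)) \<and>
     (\<forall>A\<in>sets \<mu>. emeasure \<mu> A = (SUP S\<in>{S. compactin T S \<and> S \<subseteq> A}. emeasure \<mu> S))"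

definition doubling_measure :: "('k \<Rightarrow> 'k \<Rightarrow> real) \<Rightarrow> 'k measure \<Rightarrow> bool" where
  "doubling_measure \<rho> \<mu> \<longleftrightarrow>
     (\<exists>C>0. \<forall>\<xi>. \<forall>r>0. 0 < emeasure \<mu> (qball \<rho> \<xi> (2 * r)) \<and>
        emeasure \<mu> (qball \<rho> \<xi> (2 * r)) \<le> ennreal C * emeasure \<mu> (qball \<rho> \<xi> r) \<and>
        emeasure \<mu> (qball \<rho> \<xi> r) < \<infinity>)"

definition compact_homogeneous_space :: "('k \<Rightarrow> 'k \<Rightarrow> real) \<Rightarrow> 'k measure \<Rightarrow> bool" where
  "compact_homogeneous_space \<rho> \<mu> \<longleftrightarrow>
     quasi_metric \<rho> \<and> compact_space (qtopology \<rho>) \<and>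
     (\<forall>\<xi> r. openin (qtopology \<rho>) (qball \<rho> \<xi> r)) \<and>
     regular_borel_measure (qtopology \<rho>) \<mu> \<and> doubling_measure \<rho> \<mu>"

definition normalized_space :: "('k \<Rightarrow> 'k \<Rightarrow> real) \<Rightarrow> 'k measure \<Rightarrow> bool" where
  "normalized_space \<rho> \<mu> \<longleftrightarrow>
     bdd_above (range (\<lambda>(\<xi>, \<eta>). \<rho> \<xi> \<eta>)) \<and> (SUP (\<xi>, \<eta>). \<rho> \<xi> \<eta>) = 1 \<and> emeasure \<mu> UNIV = 1"

definition set_qdist :: "('k \<Rightarrow> 'k \<Rightarrow> real) \<Rightarrow> 'k set \<Rightarrow> 'k set \<Rightarrow> real" where
  "set_qdist \<rho> A B = (INF (\<xi>, \<eta>)\<in>A \<times> B. \<rho> \<xi> \<eta>)"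


section \<open>Rooted graphs\<close>

text \<open>The vertex set \<open>X\<close> is the type \<open>'x\<close>; an edge set is a symmetric irreflexive relation.\<close>

definition rooted_graph :: "('x \<times> 'x) set \<Rightarrow> bool" where
  "rooted_graph E \<longleftrightarrow>
     countable (UNIV :: 'x set) \<and> infinite (UNIV :: 'x set) \<and>
     sym E \<and> irrefl E \<and> (\<forall>x y. (x, y) \<in> E\<^sup>*)"

definition gdist :: "('x \<times> 'x) set \<Rightarrow> 'x \<Rightarrow> 'x \<Rightarrow> nat" where
  "gdist E x y = (LEAST n. (x, y) \<in> E ^^ n)"

abbreviation lev :: "('x \<times> 'x) set \<Rightarrow> 'x \<Rightarrow> 'x \<Rightarrow> nat" where
  "lev E \<theta> x \<equiv> gdist E \<theta> x"

text \<open>A geodesic of length \<open>N\<close> is given by the values of \<open>g\<close> at the indices up to \<open>N\<close>;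
  it is a geodesic ray if \<open>N = \<infinity>\<close>.\<close>

definition geodesic :: "('x \<times> 'x) set \<Rightarrow> enat \<Rightarrow> (nat \<Rightarrow> 'x) \<Rightarrow> bool" where
  "geodesic E N g \<longleftrightarrow>
     (\<forall>i j. i \<le> j \<longrightarrow> enat j \<le> N \<longrightarrow> gdist E (g i) (g j) = j - i)"

definition root_ray :: "('x \<times> 'x) set \<Rightarrow> 'x \<Rightarrow> (nat \<Rightarrow> 'x) \<Rightarrow> bool" where
  "root_ray E \<theta> g \<longleftrightarrow> geodesic E \<infinity> g \<and> g 0 = \<theta>"

text \<open>\<open>prec E \<theta> y x\<close> is \<open>y \<prec> x\<close>: the vertex \<open>x\<close> lies on some geodesic from the root to \<open>y\<close>.\<close>

definition prec :: "('x \<times> 'x) set \<Rightarrow> 'x \<Rightarrow> 'x \<Rightarrow> 'x \<Rightarrow> bool" where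
  "prec E \<theta> y x \<longleftrightarrow>
     (\<exists>n g. geodesic E (enat n) g \<and> g 0 = \<theta> \<and> g n = y \<and> (\<exists>k\<le>n. g k = x))"

definition descendants :: "('x \<times> 'x) set \<Rightarrow> 'x \<Rightarrow> nat \<Rightarrow> 'x \<Rightarrow> 'x set" where
  "descendants E \<theta> m x = {y. prec E \<theta> y x \<and> lev E \<theta> y = lev E \<theta> x + m}"

definition rooted_tree :: "('x \<times> 'x) set \<Rightarrow> 'x \<Rightarrow> bool" where
  "rooted_tree Ev \<theta> \<longleftrightarrow>
     rooted_graph Ev \<and>
     (\<forall>(x, y)\<in>Ev. lev Ev \<theta> x = lev Ev \<theta> y + 1 \<or> lev Ev \<theta> y = lev Ev \<theta> x + 1) \<and>
     (\<forall>x. x \<noteq> \<theta> \<longrightarrow> (\<exists>!y. x \<in> descendants Ev \<theta> 1 y))"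

definition parent :: "('x \<times> 'x) set \<Rightarrow> 'x \<Rightarrow> 'x \<Rightarrow> 'x" where
  "parent Ev \<theta> x = (THE y. x \<in> descendants Ev \<theta> 1 y)"


section \<open>Index trees and augmented trees\<close>

definition index_tree ::
  "('k \<Rightarrow> 'k \<Rightarrow> real) \<Rightarrow> 'k measure \<Rightarrow> ('x \<times> 'x) set \<Rightarrow> 'x \<Rightarrow> ('x \<Rightarrow> 'k set) \<Rightarrow> real \<Rightarrow> bool" where
  "index_tree \<rho> \<mu> Ev \<theta> \<Phi> r0 \<longleftrightarrow>
     rooted_tree Ev \<theta> \<and>
     (\<forall>x. \<Phi> x \<noteq> {} \<and> compactin (qtopology \<rho>) (\<Phi> x)) \<and>
     \<Phi> \<theta> = UNIV \<and> (\<forall>x. \<Phi> x = (\<Union>y\<in>descendants Ev \<theta> 1 x. \<Phi> y)) \<and>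
     0 < r0 \<and> r0 < 1 \<and>
     (\<exists>b>0. \<exists>c>0. \<forall>x. \<exists>\<xi>. qball \<rho> \<xi> (b * r0 ^ lev Ev \<theta> x) \<subseteq> \<Phi> x \<and>
        \<Phi> x \<subseteq> qball \<rho> \<xi> (c * r0 ^ lev Ev \<theta> x)) \<and>
     (\<forall>x y. x \<noteq> y \<and> lev Ev \<theta> x = lev Ev \<theta> y \<longrightarrow> emeasure \<mu> (\<Phi> x \<inter> \<Phi> y) = 0)"

definition horizontal_edges ::
  "('k \<Rightarrow> 'k \<Rightarrow> real) \<Rightarrow> ('x \<times> 'x) set \<Rightarrow> 'x \<Rightarrow> ('x \<Rightarrow> 'k set) \<Rightarrow> real \<Rightarrow> real \<Rightarrow> ('x \<times> 'x) set" where
  "horizontal_edges \<rho> Ev \<theta> \<Phi> r0 \<gamma> =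
     (\<Union>m\<in>{1..}. {(x, y). lev Ev \<theta> x = m \<and> lev Ev \<theta> y = m \<and> x \<noteq> y \<and>
        set_qdist \<rho> (\<Phi> x) (\<Phi> y) \<le> \<gamma> * r0 ^ m})"


section \<open>The hyperbolic boundary\<close>

definition gromov :: "('x \<times> 'x) set \<Rightarrow> 'x \<Rightarrow> 'x \<Rightarrow> 'x \<Rightarrow> real" where
  "gromov E \<theta> x y = (real (lev E \<theta> x) + real (lev E \<theta> y) - real (gdist E x y)) / 2"

definition visual :: "('x \<times> 'x) set \<Rightarrow> 'x \<Rightarrow> real \<Rightarrow> 'x \<Rightarrow> 'x \<Rightarrow> real" where
  "visual E \<theta> a x y = (if x = y then 0 else exp (- a * gromov E \<theta> x y))"

definition visual_Cauchy :: "('x \<times> 'x) set \<Rightarrow> 'x \<Rightarrow> real \<Rightarrow> (nat \<Rightarrow> 'x) \<Rightarrow> bool" where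
  "visual_Cauchy E \<theta> a s \<longleftrightarrow> (\<forall>\<epsilon>>0. \<exists>N. \<forall>m\<ge>N. \<forall>n\<ge>N. visual E \<theta> a (s m) (s n) < \<epsilon>)"

definition visual_class :: "('x \<times> 'x) set \<Rightarrow> 'x \<Rightarrow> real \<Rightarrow> (nat \<Rightarrow> 'x) \<Rightarrow> (nat \<Rightarrow> 'x) set" where
  "visual_class E \<theta> a s =
     {t. visual_Cauchy E \<theta> a t \<and> (\<lambda>n. visual E \<theta> a (s n) (t n)) \<longlonglongrightarrow> 0}"

text \<open>Points of the completion are equivalence classes of Cauchy sequences; those not in \<open>X\<close>
  are the classes of Cauchy sequences without a limit in \<open>X\<close>. Hence a sequence \<open>s\<close> in \<open>X\<close>
  converges to the boundary point \<open>p\<close> iff \<open>s \<in> p\<close>.\<close>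

definition hyperbolic_boundary :: "('x \<times> 'x) set \<Rightarrow> 'x \<Rightarrow> real \<Rightarrow> (nat \<Rightarrow> 'x) set set" where
  "hyperbolic_boundary E \<theta> a =
     {visual_class E \<theta> a s | s. visual_Cauchy E \<theta> a s \<and>
        \<not> (\<exists>x. (\<lambda>n. visual E \<theta> a (s n) x) \<longlonglongrightarrow> 0)}"

definition kappa ::
  "('x \<times> 'x) set \<Rightarrow> 'x \<Rightarrow> ('x \<Rightarrow> 'k set) \<Rightarrow> (nat \<Rightarrow> 'x) set \<Rightarrow> 'k" where
  "kappa E \<theta> \<Phi> p = (THE \<eta>. \<forall>g. root_ray E \<theta> g \<and> g \<in> p \<longrightarrow> (\<Inter>n. \<Phi> (g n)) = {\<eta>})"

text \<open>The boundary point identified with \<open>\<eta> \<in> K\<close>.\<close>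

definition boundary_point ::
  "('x \<times> 'x) set \<Rightarrow> 'x \<Rightarrow> ('x \<Rightarrow> 'k set) \<Rightarrow> real \<Rightarrow> 'k \<Rightarrow> (nat \<Rightarrow> 'x) set" where
  "boundary_point E \<theta> \<Phi> a \<eta> = inv_into (hyperbolic_boundary E \<theta> a) (kappa E \<theta> \<Phi>) \<eta>"

text \<open>Below, the disjoint union \<open>X \<union> K\<close> is the sum type \<open>'x + 'k\<close>.\<close>

fun gromov_ext ::
  "('x \<times> 'x) set \<Rightarrow> 'x \<Rightarrow> ('x \<Rightarrow> 'k set) \<Rightarrow> real \<Rightarrow> 'x \<Rightarrow> 'x + 'k \<Rightarrow> real" where
  "gromov_ext E \<theta> \<Phi> a x (Inl y) = gromov E \<theta> x y"
| "gromov_ext E \<theta> \<Phi> a x (Inr \<eta>) =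
     (SUP g\<in>{g. root_ray E \<theta> g \<and> g \<in> boundary_point E \<theta> \<Phi> a \<eta>}.
        lim (\<lambda>n. gromov E \<theta> x (g n)))"


section \<open>Canonical geodesics\<close>

definition joins ::
  "('x \<times> 'x) set \<Rightarrow> 'x \<Rightarrow> ('x \<Rightarrow> 'k set) \<Rightarrow> real \<Rightarrow> 'x \<Rightarrow> 'x + 'k \<Rightarrow> enat \<Rightarrow> (nat \<Rightarrow> 'x) \<Rightarrow> bool" where
  "joins E \<theta> \<Phi> a x e N g \<longleftrightarrow> geodesic E N g \<and> g 0 = x \<and>
     (case e of Inl y \<Rightarrow> \<exists>n. N = enat n \<and> g n = y
              | Inr \<eta> \<Rightarrow> N = \<infinity> \<and> g \<in> boundary_point E \<theta> \<Phi> a \<eta>)"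

text \<open>With \<open>u = g i\<close> and \<open>v = g j\<close>: a vertical part from \<open>x = g 0\<close> to \<open>u\<close> with \<open>x \<prec> u\<close>,
  a horizontal part from \<open>u\<close> to \<open>v\<close> in the level \<open>n\<close>, and a vertical part all of whose
  vertices \<open>z\<close> satisfy \<open>z \<prec> v\<close>. Since \<open>g\<close> is a geodesic, \<open>x \<prec> u\<close> forces the path from
  \<open>x\<close> to \<open>u\<close> to use only vertical edges, and similarly after \<open>v\<close>.\<close>

definition vhv_geodesic ::
  "('x \<times> 'x) set \<Rightarrow> 'x \<Rightarrow> ('x \<Rightarrow> 'k set) \<Rightarrow> real \<Rightarrow> 'x \<Rightarrow> 'x + 'k \<Rightarrow> nat \<Rightarrow> enat \<Rightarrow> (nat \<Rightarrow> 'x) \<Rightarrow> bool"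
  where
  "vhv_geodesic E \<theta> \<Phi> a x e n N g \<longleftrightarrow>
     joins E \<theta> \<Phi> a x e N g \<and>
     (\<exists>i j. i \<le> j \<and> enat j \<le> N \<and>
        prec E \<theta> (g 0) (g i) \<and>
        (\<forall>k\<in>{i..j}. lev E \<theta> (g k) = n) \<and>
        (\<forall>k\<ge>j. enat k \<le> N \<longrightarrow> prec E \<theta> (g k) (g j)))"

definition canonical_geodesic ::
  "('x \<times> 'x) set \<Rightarrow> 'x \<Rightarrow> ('x \<Rightarrow> 'k set) \<Rightarrow> real \<Rightarrow> 'x \<Rightarrow> 'x + 'k \<Rightarrow> enat \<Rightarrow> (nat \<Rightarrow> 'x) \<Rightarrow> bool" where
  "canonical_geodesic E \<theta> \<Phi> a x e N g \<longleftrightarrow>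
     (\<exists>n. vhv_geodesic E \<theta> \<Phi> a x e n N g \<and>
        (\<forall>n' N' g'. vhv_geodesic E \<theta> \<Phi> a x e n' N' g' \<longrightarrow> n \<le> n'))"

definition p_mu ::
  "('x \<times> 'x) set \<Rightarrow> 'x \<Rightarrow> ('x \<Rightarrow> 'k set) \<Rightarrow> 'k measure \<Rightarrow> real \<Rightarrow> 'x \<Rightarrow> 'x + 'k \<Rightarrow> real" where
  "p_mu E \<theta> \<Phi> \<mu> a x e =
     (if e = Inl x then measure \<mu> (\<Phi> x)
      else (SUP z\<in>{g k | N g k. canonical_geodesic E \<theta> \<Phi> a x e N g \<and> enat k \<le> N}.
              measure \<mu> (\<Phi> z)))"


section \<open>Natural random walks\<close>

definition conductance :: "('x \<times> 'x) set \<Rightarrow> ('x \<Rightarrow> 'x \<Rightarrow> real) \<Rightarrow> bool" where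
  "conductance E c \<longleftrightarrow>
     (\<forall>x y. 0 \<le> c x y \<and> c x y = c y x \<and> (0 < c x y \<longleftrightarrow> (x, y) \<in> E))"

definition transition :: "('x \<Rightarrow> 'x \<Rightarrow> real) \<Rightarrow> 'x \<Rightarrow> 'x \<Rightarrow> real" where
  "transition c x y = c x y / (\<Sum>\<^sub>\<infinity>z. c x z)"

definition natural_conductance ::
  "'k measure \<Rightarrow> ('x \<times> 'x) set \<Rightarrow> ('x \<times> 'x) set \<Rightarrow> 'x \<Rightarrow> ('x \<Rightarrow> 'k set) \<Rightarrow> real \<Rightarrow>
   ('x \<Rightarrow> 'x \<Rightarrow> real) \<Rightarrow> bool" where
  "natural_conductance \<mu> Ev Eh \<theta> \<Phi> l c \<longleftrightarrow>
     conductance (Ev \<union> Eh) c \<and>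
     (\<forall>x. x \<noteq> \<theta> \<longrightarrow> c x (parent Ev \<theta> x) = l powr (- real (lev Ev \<theta> x)) * measure \<mu> (\<Phi> x)) \<and>
     comparable_on Eh (\<lambda>(x, y). c x y) (\<lambda>(x, y). c x (parent Ev \<theta> x))"

text \<open>\<open>M\<close> is a law under which \<open>Z\<close> is the Markov chain with transition probabilities \<open>P\<close>
  started at \<open>x\<close>.\<close>

definition markov_chain_from ::
  "('x \<Rightarrow> 'x \<Rightarrow> real) \<Rightarrow> 'x \<Rightarrow> 'w measure \<Rightarrow> (nat \<Rightarrow> 'w \<Rightarrow> 'x) \<Rightarrow> bool" where
  "markov_chain_from P x M Z \<longleftrightarrow>
     prob_space M \<and> (\<forall>n. Z n \<in> measurable M (count_space UNIV)) \<and>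
     (\<forall>n s. measure M {w \<in> space M. \<forall>i\<le>n. Z i w = s i} =
        of_bool (s 0 = x) * (\<Prod>i<n. P (s i) (s (Suc i))))"

definition visiting_prob ::
  "('x \<Rightarrow> 'w measure) \<Rightarrow> (nat \<Rightarrow> 'w \<Rightarrow> 'x) \<Rightarrow> 'x \<Rightarrow> 'x \<Rightarrow> real" where
  "visiting_prob Pr Z x y = measure (Pr x) {w \<in> space (Pr x). \<exists>n. Z n w = y}"

fun nstep :: "('x \<Rightarrow> 'x \<Rightarrow> real) \<Rightarrow> nat \<Rightarrow> 'x \<Rightarrow> 'x \<Rightarrow> real" where
  "nstep P 0 x y = of_bool (x = y)"
| "nstep P (Suc n) x y = (\<Sum>\<^sub>\<infinity>z. P x z * nstep P n z y)"

definition green :: "('x \<Rightarrow> 'x \<Rightarrow> real) \<Rightarrow> 'x \<Rightarrow> 'x \<Rightarrow> real" where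
  "green P x y = (\<Sum>n. nstep P n x y)"

definition martin_kernel :: "('x \<Rightarrow> 'x \<Rightarrow> real) \<Rightarrow> 'x \<Rightarrow> 'x \<Rightarrow> 'x \<Rightarrow> real" where
  "martin_kernel P \<theta> x y = green P x y / green P \<theta> y"

text \<open>A point of the Martin boundary is represented by its kernel, i.e. the pointwise limit of
  \<open>K(\<cdot>, s n)\<close> along a sequence leaving every finite set; a sequence in \<open>X\<close> converges to that
  point iff it leaves every finite set and the kernels converge pointwise.\<close>

definition martin_converges ::
  "('x \<Rightarrow> 'x \<Rightarrow> real) \<Rightarrow> 'x \<Rightarrow> (nat \<Rightarrow> 'x) \<Rightarrow> ('x \<Rightarrow> real) \<Rightarrow> bool" where
  "martin_converges P \<theta> s k \<longleftrightarrow>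
     (\<forall>A. finite A \<longrightarrow> (\<forall>\<^sub>F n in sequentially. s n \<notin> A)) \<and>
     (\<forall>x. (\<lambda>n. martin_kernel P \<theta> x (s n)) \<longlonglongrightarrow> k x)"

definition martin_boundary :: "('x \<Rightarrow> 'x \<Rightarrow> real) \<Rightarrow> 'x \<Rightarrow> ('x \<Rightarrow> real) set" where
  "martin_boundary P \<theta> = {k. \<exists>s. martin_converges P \<theta> s k}"

text \<open>The Martin boundary point identified with the hyperbolic boundary point \<open>p\<close>: its image
  under the continuous extension of the identity of \<open>X\<close>.\<close>

definition martin_point ::
  "('x \<Rightarrow> 'x \<Rightarrow> real) \<Rightarrow> 'x \<Rightarrow> (nat \<Rightarrow> 'x) set \<Rightarrow> ('x \<Rightarrow> real)" where
  "martin_point P \<theta> p =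
     (THE k. k \<in> martin_boundary P \<theta> \<and> (\<forall>s\<in>p. martin_converges P \<theta> s k))"

fun martin_ext ::
  "('x \<times> 'x) set \<Rightarrow> 'x \<Rightarrow> ('x \<Rightarrow> 'k set) \<Rightarrow> real \<Rightarrow> ('x \<Rightarrow> 'x \<Rightarrow> real) \<Rightarrow> 'x \<Rightarrow> 'x + 'k \<Rightarrow> real" where
  "martin_ext E \<theta> \<Phi> a P x (Inl y) = martin_kernel P \<theta> x y"
| "martin_ext E \<theta> \<Phi> a P x (Inr \<eta>) = martin_point P \<theta> (boundary_point E \<theta> \<Phi> a \<eta>) x"

end

theory Submission
  imports Defs
begin

text \<open>
  Conditioned to drift to the root (Doob transform by \<open>h x = l ^ |x|\<close>), a natural walk has the
  transition operator \<open>Q\<close>; its level is a nearest neighbour walk with drift towards the root and its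
  horizontal moves at level \<open>n\<close> have size \<open>s ^ n\<close> in a path metric \<open>D\<close> on \<open>X\<close>. Here \<open>s < 1\<close> is close
  enough to \<open>1\<close> for \<open>s ^ J x y\<close> to be a quasi-metric with constant \<open>2\<close>, where \<open>J x y\<close>, the deepest
  level at which the ancestors of \<open>x\<close> and \<open>y\<close> coincide or are neighbours, is the Gromov product up
  to a bounded error; the chain lemma gives \<open>D x y \<ge> const * s ^ J x y\<close>.
  Since the drift dominates the horizontal increments, \<open>exp (- \<eta> (D x q + A s ^ |x|) / s ^ i)\<close> and
  \<open>D x q - A s ^ |x|\<close> are superharmonic, the first one at levels beyond \<open>i\<close>. The first function, together with
  reversibility, bounds the Green function killed above level \<open>i\<close>, and summing over \<open>i\<close> gives the
  upper estimate of \<open>G\<close>; the second one shows that the walk started below \<open>w\<close> passes near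
  \<open>w\<close> with probability bounded below, that is, a Harnack inequality and the lower estimate.
  The Harnack inequality also makes the oscillation of \<open>y \<mapsto> G y x / h y\<close> decay along a geodesic ray,
  which by reversibility is the convergence of the Martin kernels at each boundary point.
\<close>


section \<open>Graph distance and augmented trees\<close>

text \<open>The power \<open>l ^ |x|\<close> is the right transform because off the root the
  children of \<open>x\<close> together carry \<open>1 / l\<close> times the conductance of its
  parent edge: the power is harmonic there, and after the transform a step up is
  \<open>1 / l\<close> times as likely as a step down. Horizontal conductances are known only up to
  a constant, so hardly anything else is explicitly harmonic; superharmonic functions built from a
  metric survive because their inequalities tolerate such an error. An exponential at scale
  \<open>s ^ i\<close> controls the killed Green function only for a target on level
  \<open>i\<close> itself. A general target \<open>y\<close> is therefore approached level by level,
  and on each level reversibility exchanges source and target. The exchange costs a ratio of cell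
  measures; it grows at most polynomially in the distance at scale \<open>s ^ i\<close>, and half of
  the exponent pays for it.\<close>

locale connected_graph =
  fixes E :: "('x \<times> 'x) set"
  assumes sym_E: "sym E" and connected_E: "\<And>x y. (x, y) \<in> E\<^sup>*"
begin

lemma gdist_le: "(x, y) \<in> E ^^ n \<Longrightarrow> gdist E x y \<le> n"
  unfolding gdist_def by (rule Least_le)

lemma gdist_walk: "(x, y) \<in> E ^^ gdist E x y"
proof -
  obtain n where "(x, y) \<in> E ^^ n" using connected_E[of x y] by (auto simp: rtrancl_is_UN_relpow)
  then show ?thesis unfolding gdist_def by (rule LeastI)
qed

lemma relpow_sym: "(x, y) \<in> E ^^ n \<Longrightarrow> (y, x) \<in> E ^^ n"
proof (induction n arbitrary: x y)
  case (Suc n)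
  then obtain z where "(x, z) \<in> E ^^ n" "(z, y) \<in> E" by auto
  with Suc.IH sym_E show ?case by (meson relpow_Suc_I2 symD)
qed auto

lemma gdist_sym: "gdist E x y = gdist E y x"
  by (meson antisym gdist_le gdist_walk relpow_sym)

lemma gdist_triangle: "gdist E x z \<le> gdist E x y + gdist E y z"
  by (meson gdist_le gdist_walk relpow_trans)

lemma gdist_self [simp]: "gdist E x x = 0"
  using gdist_le[of x x 0] by simp

lemma gdist_edge_le: "(x, y) \<in> E \<Longrightarrow> gdist E x y \<le> 1"
  by (rule gdist_le) simp

lemma gdist_eq_0D: "gdist E x y = 0 \<Longrightarrow> x = y"
  using gdist_walk[of x y] by simp

lemma gdist_eq_1D: "gdist E x y = 1 \<Longrightarrow> (x, y) \<in> E"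
  using gdist_walk[of x y] by simp

lemma path_relpow:
  assumes "i \<le> j" "\<And>k. i \<le> k \<Longrightarrow> k < j \<Longrightarrow> (g k, g (Suc k)) \<in> R"
  shows "(g i, g j) \<in> R ^^ (j - i)"
  using assms
proof (induction "j - i" arbitrary: j)
  case (Suc n)
  then obtain j' where j': "j = Suc j'" "i \<le> j'" by (cases j) auto
  with Suc have "(g i, g j') \<in> R ^^ (j' - i)" by simp
  moreover have "(g j', g j) \<in> R" using Suc.prems j' by simp
  ultimately have "(g i, g j) \<in> R ^^ Suc (j' - i)" by (rule relpow_Suc_I)
  then show ?case using j' by (simp add: Suc_diff_le del: relpow.simps)
qed simp

text \<open>A path of edges never gets farther than its number of steps, so full distance at some
  later index leaves no slack anywhere before it. Asking for arbitrarily late such indices treats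
  finite paths and rays at once.\<close>

lemma geodesicI:
  assumes edge: "\<And>i. enat (Suc i) \<le> N \<Longrightarrow> (g i, g (Suc i)) \<in> E"
    and far: "\<And>n. enat n \<le> N \<Longrightarrow> \<exists>n'\<ge>n. enat n' \<le> N \<and> n' \<le> gdist E (g 0) (g n')"
  shows "geodesic E N g"
  unfolding geodesic_def
proof (intro allI impI)
  fix i j assume ij: "i \<le> j" "enat j \<le> N"
  obtain n where n: "n \<ge> j" "enat n \<le> N" "n \<le> gdist E (g 0) (g n)" using far ij by blast
  have step: "gdist E (g a) (g b) \<le> b - a" if "a \<le> b" "b \<le> n" for a b
  proof (rule gdist_le, rule path_relpow[OF that(1)])
    fix k assume "a \<le> k" "k < b"
    then have "enat (Suc k) \<le> enat n" using that by simp
    then show "(g k, g (Suc k)) \<in> E" using n(2) edge order_trans by blast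
  qed
  have "gdist E (g 0) (g n) \<le> gdist E (g 0) (g i) + (gdist E (g i) (g j) + gdist E (g j) (g n))"
    using gdist_triangle by (meson add_left_mono order_trans)
  moreover have "gdist E (g 0) (g i) \<le> i" "gdist E (g j) (g n) \<le> n - j" "gdist E (g i) (g j) \<le> j - i"
    using step[of 0 i] step[of j n] step[of i j] ij n by auto
  ultimately show "gdist E (g i) (g j) = j - i" using n ij by linarith
qed

lemma geodesic_edge: "geodesic E N g \<Longrightarrow> enat (Suc i) \<le> N \<Longrightarrow> (g i, g (Suc i)) \<in> E"
  by (rule gdist_eq_1D) (simp add: geodesic_def)

end

definition parent_edges :: "'x \<Rightarrow> ('x \<Rightarrow> 'x) \<Rightarrow> ('x \<times> 'x) set" where
  "parent_edges \<theta> par = {(x, y). (x \<noteq> \<theta> \<and> y = par x) \<or> (y \<noteq> \<theta> \<and> x = par y)}"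

text \<open>The combinatorial residue of the augmented tree. By \<open>two_step\<close>, going up
  \<open>m\<close> levels shortens two horizontal steps to at most one; this is the source of all
  hyperbolicity. Fixing \<open>\<theta>\<close> under \<open>par\<close> makes iterated parents
  total.\<close>

locale aug_tree =
  fixes \<theta> :: 'x and par :: "'x \<Rightarrow> 'x" and L :: "'x \<Rightarrow> nat" and H :: "('x \<times> 'x) set" and m :: nat
  assumes L_root [simp]: "L \<theta> = 0" and par_root [simp]: "par \<theta> = \<theta>"
    and L_Suc: "x \<noteq> \<theta> \<Longrightarrow> L x = Suc (L (par x))"
    and H_lev: "(x, y) \<in> H \<Longrightarrow> L x = L y"
    and H_irrefl: "(x, x) \<notin> H"
    and H_sym: "(x, y) \<in> H \<Longrightarrow> (y, x) \<in> H"
    and H_par: "(x, y) \<in> H \<Longrightarrow> par x = par y \<or> (par x, par y) \<in> H"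
    and two_step: "x = y \<or> (x, y) \<in> H \<Longrightarrow> y = z \<or> (y, z) \<in> H \<Longrightarrow>
       (par ^^ m) x = (par ^^ m) z \<or> ((par ^^ m) x, (par ^^ m) z) \<in> H"
begin

definition E :: "('x \<times> 'x) set" where "E = parent_edges \<theta> par \<union> H"

definition adj :: "'x \<Rightarrow> 'x \<Rightarrow> bool" where "adj x y \<longleftrightarrow> x = y \<or> (x, y) \<in> H"

definition up :: "nat \<Rightarrow> 'x \<Rightarrow> 'x" where "up t x = (par ^^ t) x"

definition anc :: "nat \<Rightarrow> 'x \<Rightarrow> 'x" where "anc k x = up (L x - k) x"

definition near :: "nat \<Rightarrow> 'x \<Rightarrow> 'x \<Rightarrow> bool" where
  "near k x y \<longleftrightarrow> k \<le> L x \<and> k \<le> L y \<and> adj (anc k x) (anc k y)"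

lemma L_par: "L (par x) = L x - 1"
  by (cases "x = \<theta>") (auto simp: L_Suc)

lemma L_eq_0: "L x = 0 \<longleftrightarrow> x = \<theta>"
  using L_Suc by force

lemma up_0 [simp]: "up 0 x = x" by (simp add: up_def)

lemma up_Suc: "up (Suc t) x = par (up t x)" by (simp add: up_def)

lemma up_up: "up s (up t x) = up (s + t) x" by (simp add: up_def funpow_add)

lemma L_up [simp]: "L (up t x) = L x - t"
  by (induction t) (auto simp: up_Suc L_par)

lemma L_anc: "k \<le> L x \<Longrightarrow> L (anc k x) = k" by (simp add: anc_def)

lemma anc_self [simp]: "anc (L x) x = x" by (simp add: anc_def)

lemma anc_anc: "j \<le> k \<Longrightarrow> k \<le> L x \<Longrightarrow> anc j (anc k x) = anc j x"
  by (simp add: anc_def up_up)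

lemma anc_0 [simp]: "anc 0 x = \<theta>"
  using L_eq_0[of "anc 0 x"] by (simp add: L_anc)

lemma anc_par: "k < L x \<Longrightarrow> anc k (par x) = anc k x"
  using up_up[of "L x - Suc k" 1 x] by (simp add: anc_def L_par up_Suc flip: Suc_diff_Suc[of k "L x"])

lemma par_anc: "Suc k \<le> L x \<Longrightarrow> par (anc (Suc k) x) = anc k x"
  by (simp add: anc_def flip: up_Suc Suc_diff_Suc[of k "L x"])

lemma adj_refl [simp]: "adj x x" by (simp add: adj_def)
lemma adj_sym: "adj x y \<Longrightarrow> adj y x" by (auto simp: adj_def H_sym)
lemma adj_lev: "adj x y \<Longrightarrow> L x = L y" by (auto simp: adj_def H_lev)
lemma adj_par: "adj x y \<Longrightarrow> adj (par x) (par y)" by (auto simp: adj_def dest: H_par)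
lemma adj_up: "adj x y \<Longrightarrow> adj (up t x) (up t y)"
  by (induction t) (auto simp: up_Suc adj_par)
lemma adj_anc: "adj x y \<Longrightarrow> adj (anc k x) (anc k y)"
  using adj_up by (simp add: anc_def adj_lev)
lemma adj_two: "adj x y \<Longrightarrow> adj y z \<Longrightarrow> adj (up m x) (up m z)"
  using two_step unfolding adj_def up_def by blast

lemma near_sym: "near k x y \<Longrightarrow> near k y x" by (auto simp: near_def adj_sym)
lemma near_0 [simp]: "near 0 x y" by (simp add: near_def)
lemma near_self: "k \<le> L x \<Longrightarrow> near k x x" by (simp add: near_def)
lemma near_mono: "near k x y \<Longrightarrow> j \<le> k \<Longrightarrow> near j x y"
  using adj_anc[of "anc k x" "anc k y" j] by (auto simp: near_def anc_anc)
lemma near_adj: "adj x y \<Longrightarrow> k \<le> L x \<Longrightarrow> near k x y"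
  by (simp add: near_def adj_anc adj_lev)

lemma near_trans:
  assumes "near k x y" "near k y z" shows "near (k - m) x z"
proof -
  have "adj (up m (anc k x)) (up m (anc k z))" using assms adj_two by (auto simp: near_def)
  moreover have "up m (anc k w) = anc (k - m) w" if "k \<le> L w" for w
  proof (cases "m \<le> k")
    case True
    then have "m + (L w - k) = L w - (k - m)" using that by simp
    then show ?thesis by (simp add: anc_def up_up)
  next
    \<comment> \<open>Fewer than \<open>m\<close> levels remain: \<open>par\<close> stalls at the
      root, in agreement with \<open>anc 0\<close> after truncated subtraction.\<close>
    case False
    then have "L (up m (anc k w)) = 0" using that by (simp add: L_anc)
    then have "up m (anc k w) = \<theta>" using L_eq_0 by blast
    with False show ?thesis by simp
  qed
  ultimately show ?thesis using assms by (auto simp: near_def)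
qed

lemma near_anc: "j \<le> k \<Longrightarrow> k \<le> L x \<Longrightarrow> near j (anc k x) y \<longleftrightarrow> near j x y"
  by (auto simp: near_def L_anc anc_anc)

lemma near_anc': "j \<le> k \<Longrightarrow> k \<le> L y \<Longrightarrow> near j x (anc k y) \<longleftrightarrow> near j x y"
  by (auto simp: near_def L_anc anc_anc)

lemma E_cases:
  assumes "(x, y) \<in> E"
  obtains (par) "x \<noteq> \<theta>" "y = par x" | (child) "y \<noteq> \<theta>" "x = par y" | (horizontal) "(x, y) \<in> H"
  using assms by (auto simp: E_def parent_edges_def)

lemma E_lev: "(x, y) \<in> E \<Longrightarrow> L x \<le> Suc (L y)"
  by (erule E_cases) (auto simp: L_par dest: H_lev)

lemma near_edge:
  assumes "(x, y) \<in> E" "k \<le> L x" "k \<le> L y" shows "near k x y"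
  using assms(1)
proof (cases rule: E_cases)
  case par
  then have "k < L x" using assms L_Suc[of x] by simp
  then show ?thesis using par assms by (simp add: near_def anc_par)
next
  case child
  then have "k < L y" using assms L_Suc[of y] by simp
  then show ?thesis using child assms by (simp add: near_def anc_par)
next
  case horizontal
  then show ?thesis using assms by (intro near_adj) (simp add: adj_def)
qed

lemma E_sym: "(x, y) \<in> E \<Longrightarrow> (y, x) \<in> E"
  by (auto simp: E_def parent_edges_def H_sym)

section \<open>Geodesics between two vertices: up, across, down\<close>

lemma up_walk: "\<exists>s\<le>t. (x, up t x) \<in> E ^^ s"
proof (induction t)
  case (Suc t)
  then obtain s where s: "s \<le> t" "(x, up t x) \<in> E ^^ s" by blast
  show ?case
  proof (cases "up t x = \<theta>")
    case True
    then show ?thesis using s by (intro exI[of _ s]) (auto simp: up_Suc)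
  next
    case False
    then have "(up t x, up (Suc t) x) \<in> E" by (auto simp: up_Suc E_def parent_edges_def)
    then show ?thesis using s by (intro exI[of _ "Suc s"]) (auto intro: relpow_Suc_I)
  qed
qed auto

lemma anc_walk: "k \<le> L x \<Longrightarrow> (x, anc k x) \<in> E ^^ (L x - k)"
proof (induction "L x - k" arbitrary: k)
  case (Suc n)
  then have "(x, anc (Suc k) x) \<in> E ^^ (L x - Suc k)" by auto
  moreover have "L (anc (Suc k) x) = Suc k" using Suc by (intro L_anc) auto
  then have "anc (Suc k) x \<noteq> \<theta>" using L_root by (metis nat.distinct(1))
  then have "(anc (Suc k) x, anc k x) \<in> E"
    using par_anc[of k x] Suc by (auto simp: E_def parent_edges_def)
  ultimately have "(x, anc k x) \<in> E ^^ Suc (L x - Suc k)" by (rule relpow_Suc_I)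
  moreover have "Suc (L x - Suc k) = L x - k" using Suc by auto
  ultimately show ?case by metis
qed auto

lemma connected_aux: "(x, \<theta>) \<in> E\<^sup>*"
  using anc_walk[of 0 x] by (simp add: relpow_imp_rtrancl)

sublocale connected_graph E
proof
  show "sym E" using E_sym by (auto intro: symI)
  then show "(x, y) \<in> E\<^sup>*" for x y
    using connected_aux by (meson rtrancl_trans sym_rtrancl symD)
qed

lemma H_relpow_E: "(x, y) \<in> H ^^ h \<Longrightarrow> (x, y) \<in> E ^^ h"
proof (induction h arbitrary: y)
  case (Suc h) then show ?case by (auto simp: E_def)
qed auto

lemma gdist_le_horizontal:
  assumes "k \<le> L x" "k \<le> L y" "(anc k x, anc k y) \<in> H ^^ h"
  shows "gdist E x y + 2 * k \<le> L x + L y + h"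
proof -
  have "(x, y) \<in> E ^^ (((L x - k) + h) + (L y - k))"
    using anc_walk[OF assms(1)] H_relpow_E[OF assms(3)] relpow_sym[OF anc_walk[OF assms(2)]]
    by (meson relpow_trans)
  then show ?thesis using gdist_le assms by fastforce
qed

lemma H_relpow_lev: "(x, y) \<in> H ^^ h \<Longrightarrow> L x = L y"
  by (induction h arbitrary: y) (auto dest: H_lev)

lemma H_relpow_up: "(x, y) \<in> H ^^ h \<Longrightarrow> \<exists>h'\<le>h. (up t x, up t y) \<in> H ^^ h'"
proof (induction h arbitrary: y)
  case (Suc h)
  then obtain z where z: "(x, z) \<in> H ^^ h" "(z, y) \<in> H" by auto
  obtain h' where h': "h' \<le> h" "(up t x, up t z) \<in> H ^^ h'" using Suc z by blast
  have "adj (up t z) (up t y)" using z by (intro adj_up) (simp add: adj_def)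
  then consider "up t z = up t y" | "(up t z, up t y) \<in> H" by (auto simp: adj_def)
  then show ?case
  proof cases
    case 1 then show ?thesis using h' by (intro exI[of _ h']) auto
  next
    case 2 then show ?thesis using h' by (meson Suc_le_mono relpow_Suc_I)
  qed
qed auto

text \<open>Appending an edge to an up-across-down path restores this shape without exceeding the
  step count, because a horizontal path does not get longer when it is lifted to the
  parents.\<close>

lemma walk_canonical:
  assumes "(x, y) \<in> E ^^ n"
  shows "\<exists>k h. k \<le> L x \<and> k \<le> L y \<and> (anc k x, anc k y) \<in> H ^^ h \<and> L x + L y + h \<le> n + 2 * k"
  using assms
proof (induction n arbitrary: y)
  case 0
  then show ?case by (intro exI[of _ "L x"] exI[of _ 0]) auto
next
  case (Suc n)
  then obtain z where z: "(x, z) \<in> E ^^ n" "(z, y) \<in> E" by auto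
  obtain k h where k: "k \<le> L x" "k \<le> L z" "(anc k x, anc k z) \<in> H ^^ h"
    "L x + L z + h \<le> n + 2 * k" using Suc z by blast
  from z(2) show ?case
  proof (cases rule: E_cases)
    case par
    show ?thesis
    proof (cases "k = L z")
      \<comment> \<open>The descending part is empty, so the new vertex lies above the horizontal
        path, and the whole path is lifted by one level.\<close>
      case True
      then have k1: "k \<ge> 1" using par L_Suc[of z] by auto
      obtain h' where h': "h' \<le> h" "(up 1 (anc k x), up 1 (anc k z)) \<in> H ^^ h'"
        using H_relpow_up[OF k(3)] by blast
      have "up 1 (anc k w) = anc (k - 1) w" if "k \<le> L w" for w
        using par_anc[of "k - 1" w] that k1 by (simp add: up_def)
      then have "(anc (k - 1) x, anc (k - 1) z) \<in> H ^^ h'" using h' k by simp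
      moreover have "anc (k - 1) z = anc (k - 1) y"
        using par k k1 True by (simp add: anc_par)
      ultimately show ?thesis using k h' True par k1
        by (intro exI[of _ "k - 1"] exI[of _ h']) (auto simp: L_par)
    next
      case False
      with par k show ?thesis
        by (intro exI[of _ k] exI[of _ h]) (auto simp: L_par anc_par)
    qed
  next
    case child
    then have "k < L y" using L_Suc[of y] k by auto
    with child k show ?thesis
      by (intro exI[of _ k] exI[of _ h]) (auto simp: L_par anc_par)
  next
    case horizontal
    then have "adj (anc k z) (anc k y)" by (intro adj_anc) (simp add: adj_def)
    then consider "anc k z = anc k y" | "(anc k z, anc k y) \<in> H" by (auto simp: adj_def)
    then show ?thesis
    proof cases
      case 1
      then show ?thesis using k H_lev[OF horizontal]
        by (intro exI[of _ k] exI[of _ h]) auto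
    next
      case 2
      then show ?thesis using k H_lev[OF horizontal]
        by (intro exI[of _ k] exI[of _ "Suc h"]) auto
    qed
  qed
qed

lemma lev_eq: "gdist E \<theta> x = L x"
proof -
  obtain k h where "k \<le> L \<theta>" "L \<theta> + L x + h \<le> gdist E \<theta> x + 2 * k"
    using walk_canonical[OF gdist_walk[of \<theta> x]] by blast
  moreover have "gdist E x \<theta> \<le> L x" using gdist_le[OF anc_walk[of 0 x]] by simp
  ultimately show ?thesis using gdist_sym[of x \<theta>] by simp
qed

text \<open>Halving a horizontal path at the cost of \<open>m\<close> levels bounds the length of horizontal
  geodesics.\<close>

lemma H_relpow_half: "(x, y) \<in> H ^^ h \<Longrightarrow> \<exists>h'. 2 * h' \<le> Suc h \<and> (up m x, up m y) \<in> H ^^ h'"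
proof (induction h arbitrary: y rule: less_induct)
  case (less h)
  consider "h = 0" | "h = 1" | n where "h = Suc (Suc n)" by (metis One_nat_def not0_implies_Suc)
  then show ?case
  proof cases
    case 1
    then show ?thesis using less.prems by (intro exI[of _ 0]) auto
  next
    case 2
    then show ?thesis using H_relpow_up[OF less.prems, of m] by force
  next
    case 3
    then obtain z w where z: "(x, z) \<in> H ^^ n" "(z, w) \<in> H" "(w, y) \<in> H"
      using less.prems by auto
    then obtain h' where h': "2 * h' \<le> Suc n" "(up m x, up m z) \<in> H ^^ h'" using less.IH[of n z] 3 by auto
    have "adj (up m z) (up m y)" using z by (intro adj_two[of z w y]) (auto simp: adj_def)
    then consider "up m z = up m y" | "(up m z, up m y) \<in> H" by (auto simp: adj_def)
    then show ?thesis
    proof cases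
      case 1 then show ?thesis using h' \<open>h = Suc (Suc n)\<close> by (intro exI[of _ h']) auto
    next
      case 2 then show ?thesis using h' \<open>h = Suc (Suc n)\<close>
        by (intro exI[of _ "Suc h'"]) (auto intro: relpow_Suc_I)
    qed
  qed
qed

text \<open>A detour \<open>m\<close> levels up halves the path and costs \<open>2 * m\<close>
  vertical steps, so a geodesic satisfies \<open>h \<le> 2 * m + (h + 1) / 2\<close>.\<close>

lemma horizontal_geodesic_le:
  assumes "(x, y) \<in> H ^^ h" "gdist E x y = h" shows "h \<le> 4 * m + 1"
proof -
  obtain h' where h': "2 * h' \<le> Suc h" "(up m x, up m y) \<in> H ^^ h'"
    using H_relpow_half[OF assms(1)] by blast
  have up: "gdist E w (up m w) \<le> m" for w
    using up_walk[of m w] gdist_le by (meson le_trans)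
  have "gdist E x y \<le> gdist E x (up m x) + (gdist E (up m x) (up m y) + gdist E (up m y) y)"
    by (meson add_left_mono gdist_triangle order_trans)
  moreover have "gdist E (up m x) (up m y) \<le> h'" using h' H_relpow_E gdist_le by blast
  ultimately have "h \<le> m + (h' + m)" using up[of x] up[of y] assms gdist_sym[of "up m y" y] by linarith
  then show ?thesis using h' by linarith
qed

lemma H_relpow_near: "(x, y) \<in> H ^^ h \<Longrightarrow> near (L x - m * h) x y"
proof (induction h arbitrary: y)
  case (Suc h)
  then obtain z where z: "(x, z) \<in> H ^^ h" "(z, y) \<in> H" by auto
  have "near (L x - m * h) z y" using z H_relpow_lev
    by (intro near_adj) (auto simp: adj_def)
  from near_trans[OF Suc.IH[OF z(1)] this] show ?case by (simp add: add.commute)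
qed (auto simp: near_self)

section \<open>A combinatorial Gromov product\<close>

definition J :: "'x \<Rightarrow> 'x \<Rightarrow> nat" where "J x y = (GREATEST j. near j x y)"

lemma near_J: "near (J x y) x y"
  unfolding J_def by (rule GreatestI_nat[of _ 0 "L x"]) (auto simp: near_def)

lemma near_le_J: "near j x y \<Longrightarrow> j \<le> J x y"
  unfolding J_def by (rule Greatest_le_nat[of _ _ "L x"]) (auto simp: near_def)

lemma near_iff_J: "near j x y \<longleftrightarrow> j \<le> J x y"
  using near_J near_le_J near_mono by blast

lemma J_sym: "J x y = J y x"
  by (meson antisym near_J near_le_J near_sym)

lemma J_le: "J x y \<le> L x" "J x y \<le> L y"
  using near_J[of x y] by (auto simp: near_def)

lemma J_trans: "min (J x y) (J y z) - m \<le> J x z"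
  by (intro near_le_J near_trans[of _ x y z]) (auto simp: near_iff_J)

lemma gdist_J: "gdist E x y + 2 * J x y \<le> L x + L y + 1"
proof -
  have n: "near (J x y) x y" by (rule near_J)
  then consider "(anc (J x y) x, anc (J x y) y) \<in> H ^^ 0" | "(anc (J x y) x, anc (J x y) y) \<in> H ^^ 1"
    by (auto simp: near_def adj_def)
  then show ?thesis
    using gdist_le_horizontal[of "J x y" x y] J_le[of x y] by cases (metis add_0_right le_add1 order_trans, metis)
qed

definition hyp_const :: nat where "hyp_const = m * (4 * m + 1)"

text \<open>The last hypothesis says that the up-across-down path is a geodesic. Its horizontal part
  is then short, and making the ends of that part near loses at most \<open>m\<close> levels per
  horizontal step, which explains \<open>hyp_const\<close>.\<close>

lemma J_ge:
  assumes "k \<le> L x" "k \<le> L y" "(anc k x, anc k y) \<in> H ^^ h" "L x + L y + h \<le> gdist E x y + 2 * k"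
  shows "h \<le> 4 * m + 1" "k \<le> J x y + hyp_const" "J x y \<le> k"
proof -
  have d: "gdist E (anc k x) (anc k y) \<le> h" using assms H_relpow_E gdist_le by blast
  have "gdist E x y \<le> gdist E x (anc k x) + (gdist E (anc k x) (anc k y) + gdist E (anc k y) y)"
    by (meson add_left_mono gdist_triangle order_trans)
  also have "\<dots> \<le> (L x - k) + (gdist E (anc k x) (anc k y) + (L y - k))"
    using gdist_le[OF anc_walk[OF assms(1)]] gdist_le[OF anc_walk[OF assms(2)]]
      gdist_sym[of "anc k y" y] by (intro add_mono) auto
  finally have "gdist E (anc k x) (anc k y) = h" using assms d by linarith
  then show h: "h \<le> 4 * m + 1" using horizontal_geodesic_le assms by blast
  have "near (k - m * h) (anc k x) (anc k y)" using H_relpow_near[OF assms(3)] assms by (simp add: L_anc)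
  then have "near (k - m * h) x y" using assms by (auto simp: near_anc near_anc')
  then have "k - m * h \<le> J x y" by (rule near_le_J)
  moreover have "m * h \<le> hyp_const" using h unfolding hyp_const_def by (rule mult_le_mono2)
  ultimately show "k \<le> J x y + hyp_const" by linarith
  show "J x y \<le> k" using gdist_J[of x y] assms(4) by linarith
qed

lemma gromov_J:
  "gromov E \<theta> x y \<ge> J x y - 1 / 2" "gromov E \<theta> x y \<le> J x y + real hyp_const"
proof -
  show "gromov E \<theta> x y \<ge> J x y - 1 / 2"
    using gdist_J[of x y] by (auto simp: gromov_def lev_eq field_simps)
  obtain k h where k: "k \<le> L x" "k \<le> L y" "(anc k x, anc k y) \<in> H ^^ h" "L x + L y + h \<le> gdist E x y + 2 * k"
    using walk_canonical[OF gdist_walk[of x y]] by blast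
  have "k \<le> J x y + hyp_const" using J_ge[OF k] by simp
  moreover have "gromov E \<theta> x y \<le> k" using k(4) by (auto simp: gromov_def lev_eq field_simps)
  ultimately show "gromov E \<theta> x y \<le> J x y + real hyp_const" by linarith
qed

end

section \<open>A weighted path metric\<close>

context aug_tree
begin

text \<open>The exponent is such that \<open>2 * m\<close> levels cost at most a factor
  \<open>1 / 2\<close>, as the chain lemma requires; the \<open>+ 1\<close> keeps
  \<open>s < 1\<close> when \<open>m = 0\<close>.\<close>

definition s :: real where "s = (1 / 2) powr (1 / (2 * real m + 1))"

lemma s_pos: "0 < s" by (simp add: s_def)
lemma s_lt_1: "s < 1"
  using powr_less_mono2[of "1 / (2 * real m + 1)" "1 / 2" 1] by (simp add: s_def add_pos_nonneg)
lemma s_power_ge: "1 / 2 \<le> s ^ (2 * m)"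
proof -
  have "(1 / 2 :: real) powr 1 \<le> (1 / 2) powr (real (2 * m) * (1 / (2 * real m + 1)))"
    by (intro powr_mono') (auto simp: field_simps)
  also have "\<dots> = s ^ (2 * m)"
    by (simp add: s_def powr_power mult.commute)
  finally show ?thesis by simp
qed

definition walk :: "'x \<Rightarrow> 'x list \<Rightarrow> 'x \<Rightarrow> bool" where
  "walk x xs y \<longleftrightarrow> xs \<noteq> [] \<and> hd xs = x \<and> last xs = y \<and> successively (\<lambda>a b. (a, b) \<in> E) xs"

definition wt :: "'x list \<Rightarrow> real" where "wt xs = (\<Sum>v\<leftarrow>xs. s ^ L v)"

text \<open>Since every vertex of a walk is counted, \<open>D x x = s ^ L x\<close> rather than \<open>0\<close>.\<close>

definition D :: "'x \<Rightarrow> 'x \<Rightarrow> real" where "D x y = (INF xs\<in>{xs. walk x xs y}. wt xs)"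

lemma wt_nonneg: "0 \<le> wt xs"
  unfolding wt_def by (intro sum_list_nonneg) (auto simp: s_pos less_imp_le)

lemma wt_append: "wt (xs @ ys) = wt xs + wt ys" by (simp add: wt_def)
lemma wt_Cons: "wt (x # xs) = s ^ L x + wt xs" by (simp add: wt_def)

lemma wt_ge: "v \<in> set xs \<Longrightarrow> s ^ L v \<le> wt xs"
proof (induction xs)
  case (Cons x xs)
  then show ?case using wt_nonneg[of xs] s_pos by (auto simp: wt_Cons add_increasing)
qed simp

lemma walk_exists: "\<exists>xs. walk x xs y"
  using connected_E[of x y]
proof (induction rule: converse_rtrancl_induct)
  case base
  have "walk y [y] y" by (simp add: walk_def)
  then show ?case ..
next
  case (step x z)
  then obtain xs where "walk z xs y" by blast
  with step have "walk x (x # xs) y" by (cases xs) (auto simp: walk_def)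
  then show ?case ..
qed

lemma walk_rev: "walk x xs y \<Longrightarrow> walk y (rev xs) x"
  unfolding walk_def
  by (auto simp: hd_rev last_rev intro: successively_mono E_sym)

lemma D_bdd: "bdd_below (wt ` {xs. walk x xs y})"
  by (intro bdd_belowI[of _ 0]) (auto simp: wt_nonneg)

lemma D_le: "walk x xs y \<Longrightarrow> D x y \<le> wt xs"
  unfolding D_def by (intro cINF_lower D_bdd) auto

lemma D_ge: "(\<And>xs. walk x xs y \<Longrightarrow> r \<le> wt xs) \<Longrightarrow> r \<le> D x y"
  unfolding D_def using walk_exists by (intro cINF_greatest) auto

lemma D_nonneg: "0 \<le> D x y" by (intro D_ge wt_nonneg)

lemma D_sym: "D x y = D y x"
proof -
  have "D x y \<le> D y x" for x y
    by (intro D_ge order_trans[OF D_le[OF walk_rev]]) (auto simp: wt_def simp flip: rev_map)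
  then show ?thesis by (meson antisym)
qed

lemma D_self_le: "D x x \<le> s ^ L x"
  using D_le[of x "[x]" x] by (simp add: walk_def wt_def)

lemma D_edge:
  assumes "(z, x) \<in> E" shows "D z q \<le> D x q + s ^ L z"
proof -
  have "D z q - s ^ L z \<le> D x q"
  proof (rule D_ge)
    fix xs assume "walk x xs q"
    then have "walk z (z # xs) q" using assms by (cases xs) (auto simp: walk_def)
    from D_le[OF this] show "D z q - s ^ L z \<le> wt xs" by (simp add: wt_Cons)
  qed
  then show ?thesis by simp
qed

lemma s_power_mono: "i \<le> j \<Longrightarrow> s ^ j \<le> s ^ i"
  using s_pos s_lt_1 by (intro power_decreasing) auto

lemma D_Lipschitz:
  assumes "(x, z) \<in> E" shows "\<bar>D z q - D x q\<bar> \<le> s ^ L x / s"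
proof -
  have "s ^ L x \<le> s ^ L x / s" using s_pos s_lt_1 by (simp add: field_simps)
  moreover have "s ^ L z \<le> s ^ L x / s"
    using s_power_mono[of "L x" "Suc (L z)"] E_lev[OF assms] s_pos by (simp add: field_simps)
  ultimately show ?thesis
    using D_edge[OF assms, of q] D_edge[OF E_sym[OF assms], of q] by linarith
qed

lemma D_le_anc:
  assumes "k \<le> L x" shows "D x q \<le> D (anc k x) q + s ^ Suc k / (1 - s)"
proof -
  \<comment> \<open>The exact partial sum of the geometric series is what the induction on the level
    preserves.\<close>
  have "D x q \<le> D (anc k x) q + (s ^ Suc k - s ^ Suc (L x)) / (1 - s)"
    using assms
  proof (induction "L x" arbitrary: x)
    case 0
    then have "anc k x = x" by (metis anc_self le_zero_eq)
    then show ?case using 0 by simp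
  next
    case (Suc n)
    show ?case
    proof (cases "k = L x")
      case False
      then have k: "k \<le> L (par x)" "anc k (par x) = anc k x"
        using Suc by (auto simp: L_par anc_par)
      have "x \<noteq> \<theta>" using Suc by auto
      then have "(x, par x) \<in> E" by (auto simp: E_def parent_edges_def)
      from D_edge[OF this, of q] have 1: "D x q \<le> D (par x) q + s ^ L x" .
      have 2: "D (par x) q \<le> D (anc k x) q + (s ^ Suc k - s ^ Suc n) / (1 - s)"
        using Suc.hyps(1)[of "par x"] k Suc.hyps(2) by (simp add: L_par)
      have "(s ^ Suc k - s ^ Suc n) / (1 - s) + s ^ L x
          = (s ^ Suc k - s ^ Suc n + s ^ Suc n * (1 - s)) / (1 - s)"
        using s_lt_1 Suc.hyps(2)[symmetric] by (simp add: add_divide_distrib)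
      also have "\<dots> = (s ^ Suc k - s ^ Suc (L x)) / (1 - s)"
        using Suc.hyps(2)[symmetric] by (simp add: algebra_simps)
      finally show ?thesis using 1 2 by linarith
    qed simp
  qed
  also have "\<dots> \<le> D (anc k x) q + s ^ Suc k / (1 - s)"
    using s_pos s_lt_1 by (intro add_left_mono divide_right_mono) auto
  finally show ?thesis .
qed

lemma D_le_near:
  assumes "near k x y" shows "D x y \<le> 2 * s ^ k / (1 - s)"
proof -
  have k: "k \<le> L x" "k \<le> L y" and a: "adj (anc k x) (anc k y)" using assms by (auto simp: near_def)
  have "D (anc k x) (anc k y) \<le> 2 * s ^ k"
  proof (cases "anc k x = anc k y")
    case True
    then show ?thesis using D_self_le[of "anc k x"] s_pos k
      by (smt (verit) L_anc zero_less_power)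
  next
    case False
    then have "(anc k x, anc k y) \<in> E" using a by (auto simp: adj_def E_def)
    from D_edge[OF this, of "anc k y"] D_self_le[of "anc k y"] show ?thesis
      using k by (simp add: L_anc)
  qed
  then have "D x y \<le> 2 * s ^ k + s ^ Suc k / (1 - s) + s ^ Suc k / (1 - s)"
    using D_le_anc[OF k(1), of y] D_le_anc[OF k(2), of "anc k x"] D_sym by (smt (verit))
  also have "\<dots> = (2 * s ^ k * (1 - s) + s * s ^ k + s * s ^ k) / (1 - s)"
    using s_lt_1 by (simp add: add_divide_distrib)
  also have "\<dots> = 2 * s ^ k / (1 - s)" by (simp add: algebra_simps)
  finally show ?thesis .
qed

text \<open>The chain lemma for the quasi-metric \<open>s ^ J x y\<close>: cut the walk at the vertex where half of
  its weight is reached.\<close>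

lemma wt_near: "walk x xs y \<Longrightarrow> wt xs \<le> s ^ k \<Longrightarrow> near (k - 2 * m) x y"
proof (induction "length xs" arbitrary: xs x y k rule: less_induct)
  case less
  have pos: "0 < wt xs"
    using less.prems wt_ge[of x xs] s_pos by (auto simp: walk_def intro: less_le_trans[of _ "s ^ L x"])
  \<comment> \<open>A single vertex above level \<open>k\<close> would already outweigh the
    walk.\<close>
  have lev: "k \<le> L v" if "v \<in> set xs" for v
  proof (rule ccontr)
    assume "\<not> k \<le> L v"
    then have "s ^ k < s ^ L v" using s_pos s_lt_1 by (intro power_strict_decreasing) auto
    then show False using wt_ge[OF that] less.prems by linarith
  qed
  define n where "n = (LEAST n. wt xs / 2 < wt (take n xs))"
  have n: "wt xs / 2 < wt (take n xs)"
    unfolding n_def by (rule LeastI[of _ "length xs"]) (use pos in simp)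
  have n_le: "n \<le> length xs" unfolding n_def by (rule Least_le) (use pos in simp)
  have "n \<noteq> 0" using n pos by (metis take_0 wt_def list.map(1) sum_list.Nil half_gt_zero not_less_iff_gr_or_eq)
  then obtain i where i: "n = Suc i" by (cases n) auto
  have half: "wt (take i xs) \<le> wt xs / 2"
    using not_less_Least[of i "\<lambda>n. wt xs / 2 < wt (take n xs)"] i n_def by (simp add: not_less)
  define v where "v = xs ! i"
  have i_less: "i < length xs" using i n_le by simp
  have split: "xs = take i xs @ v # drop (Suc i) xs" using i_less by (simp add: v_def id_take_nth_drop)
  have "wt xs = wt (take n xs) + wt (drop n xs)" by (metis append_take_drop_id wt_append)
  then have half': "wt (drop (Suc i) xs) \<le> wt xs / 2" using n i by simp
  \<comment> \<open>Here the choice of \<open>s\<close> enters: half of the weight is a budget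
    \<open>2 * m\<close> levels deeper. It prepays two losses of \<open>m\<close> levels, one for
    attaching the cut vertex to a side and one for joining the two sides.\<close>
  have small: "wt xs / 2 \<le> s ^ (k + 2 * m)"
  proof -
    have "wt xs / 2 \<le> s ^ k * (1 / 2)" using less.prems by simp
    also have "\<dots> \<le> s ^ k * s ^ (2 * m)" using s_power_ge s_pos by (intro mult_left_mono) auto
    finally show ?thesis by (simp add: power_add)
  qed
  have v_lev: "k \<le> L v" using lev i_less by (simp add: v_def)
  have suc: "successively (\<lambda>a b. (a, b) \<in> E) (take i xs @ v # drop (Suc i) xs)"
    and hd: "hd (take i xs @ v # drop (Suc i) xs) = x"
    and lst: "last (take i xs @ v # drop (Suc i) xs) = y"
    using less.prems split by (auto simp: walk_def)
  have left: "near (k - m) x v"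
  proof (cases "take i xs = []")
    case True
    then have "x = v" using hd unfolding True by simp
    then show ?thesis using v_lev by (simp add: near_self)
  next
    case False
    define w where "w = last (take i xs)"
    have "walk x (take i xs) w"
      using False suc hd by (auto simp: walk_def w_def successively_append_iff)
    moreover have "length (take i xs) < length xs" using i_less by simp
    moreover have "wt (take i xs) \<le> s ^ (k + 2 * m)" using half small by linarith
    ultimately have "near (k + 2 * m - 2 * m) x w" using less.hyps by blast
    moreover have "(w, v) \<in> E" using False suc by (auto simp: w_def successively_append_iff)
    moreover have "w \<in> set xs" using False by (metis w_def in_set_takeD last_in_set)
    ultimately show ?thesis using near_edge[of w v k] lev v_lev near_trans[of k x w v] by simp
  qed
  have right: "near (k - m) v y"
  proof (cases "drop (Suc i) xs = []")
    case True
    then have "y = v" using lst by simp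
    then show ?thesis using v_lev by (simp add: near_self)
  next
    case False
    define w where "w = hd (drop (Suc i) xs)"
    have "walk w (drop (Suc i) xs) y"
      using False suc lst by (auto simp: walk_def w_def successively_append_iff successively_Cons)
    moreover have "length (drop (Suc i) xs) < length xs" using i_less by simp
    moreover have "wt (drop (Suc i) xs) \<le> s ^ (k + 2 * m)" using half' small by linarith
    ultimately have "near (k + 2 * m - 2 * m) w y" using less.hyps by blast
    moreover have "(v, w) \<in> E" using False suc by (auto simp: w_def successively_append_iff successively_Cons)
    moreover have "w \<in> set xs" using False by (metis w_def in_set_dropD list.set_sel(1))
    ultimately show ?thesis using near_edge[of v w k] lev v_lev near_trans[of k v w y] by simp
  qed
  show ?case using near_trans[OF left right] by (simp add: diff_diff_left mult_2)
qed

lemma near_of_D_less: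
  assumes "D x y < s ^ (k + 2 * m)" shows "near k x y"
proof -
  have "\<exists>xs. walk x xs y \<and> wt xs < s ^ (k + 2 * m)"
    using assms D_ge[of x y "s ^ (k + 2 * m)"] by force
  then show ?thesis using wt_near[of x _ y "k + 2 * m"] by force
qed

lemma D_ge_not_near: "\<not> near k x y \<Longrightarrow> s ^ (k + 2 * m) \<le> D x y"
  using near_of_D_less by force

end

text \<open>\<open>M\<close> stands for the measure of the cells. The single constant
  \<open>\<Lambda>\<close> collects doubling, the bounded horizontal degree and the comparability of
  horizontal with vertical conductances.\<close>

locale natural_walk = aug_tree +
  fixes M :: "'a \<Rightarrow> real" and c :: "'a \<Rightarrow> 'a \<Rightarrow> real" and l \<Lambda> :: real
  assumes l_pos: "0 < l" and l_lt_1: "l < 1" and Lam_ge: "1 \<le> \<Lambda>"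
    and M_pos: "0 < M x"
    and M_par: "M (par x) \<le> \<Lambda> * M x"
    and M_H: "(x, y) \<in> H \<Longrightarrow> M x \<le> \<Lambda> * M y"
    and fin_children: "finite {y. y \<noteq> \<theta> \<and> par y = x}"
    and M_sum: "M x = (\<Sum>y | y \<noteq> \<theta> \<and> par y = x. M y)"
    and fin_H: "finite {y. (x, y) \<in> H}" and card_H: "card {y. (x, y) \<in> H} \<le> \<Lambda>"
    and c_sym: "c x y = c y x"
    and c_par: "x \<noteq> \<theta> \<Longrightarrow> c x (par x) = M x / l ^ L x"
    and c_H: "(x, y) \<in> H \<Longrightarrow> M x / (\<Lambda> * l ^ L x) \<le> c x y"
      "(x, y) \<in> H \<Longrightarrow> c x y \<le> \<Lambda> * M x / l ^ L x"
    and c_off: "(x, y) \<notin> E \<Longrightarrow> c x y = 0"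
begin

section \<open>The walk, its Doob transform and the reversing measure\<close>

definition nbs :: "'a \<Rightarrow> 'a set" where "nbs x = {z. (x, z) \<in> E}"

definition children :: "'a \<Rightarrow> 'a set" where "children x = {y. y \<noteq> \<theta> \<and> par y = x}"

definition tot :: "'a \<Rightarrow> real" where "tot x = (\<Sum>z\<in>nbs x. c x z)"

definition P :: "'a \<Rightarrow> 'a \<Rightarrow> real" where "P x z = c x z / tot x"

text \<open>Its rows sum to \<open>1\<close> off the root and to \<open>l\<close> at the root, where
  the missing mass \<open>1 - l\<close> acts as killing.\<close>

definition Q :: "'a \<Rightarrow> 'a \<Rightarrow> real" where "Q x z = P x z * l ^ L z / l ^ L x"

text \<open>Off the root this is the probability under \<open>P\<close> of the step to the parent,
  while the children together get \<open>\<kappa> x / l\<close>. The transform exchanges these two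
  values, which is the drift towards the root.\<close>

definition \<kappa> :: "'a \<Rightarrow> real" where "\<kappa> x = M x / (l ^ L x * tot x)"

lemma nbs_eq: "nbs x = children x \<union> {z. (x, z) \<in> H} \<union> (if x = \<theta> then {} else {par x})"
  by (auto simp: nbs_def E_def parent_edges_def children_def)

lemma L_child: "y \<in> children x \<Longrightarrow> L y = Suc (L x)"
  using L_Suc[of y] by (auto simp: children_def)

lemma finite_children: "finite (children x)" using fin_children by (simp add: children_def)

lemma finite_nbs: "finite (nbs x)"
  by (auto simp: nbs_eq finite_children fin_H)

lemma sum_nbs:
  fixes f :: "'a \<Rightarrow> real"
  shows "sum f (nbs x) = sum f (children x) + sum f {z. (x, z) \<in> H} + (if x = \<theta> then 0 else f (par x))"
proof -
  have "children x \<inter> {z. (x, z) \<in> H} = {}" using L_child H_lev by fastforce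
  moreover have "par x \<notin> children x \<union> {z. (x, z) \<in> H}" if "x \<noteq> \<theta>"
    using that L_child[of "par x" x] H_lev[of x "par x"] L_Suc[of x] by auto
  ultimately show ?thesis
    by (auto simp: nbs_eq sum.union_disjoint finite_children fin_H)
qed

lemma l_power_pos [simp]: "0 < l ^ n" using l_pos by simp

lemma M_children: "M x = sum M (children x)" using M_sum[of x] by (simp add: children_def)

lemma c_child: "y \<in> children x \<Longrightarrow> c x y = M y / l ^ Suc (L x)"
  using c_par[of y] c_sym[of y x] L_child[of y x] by (auto simp: children_def)

lemma sum_c_children: "sum (c x) (children x) = M x / l ^ Suc (L x)"
proof -
  have "sum (c x) (children x) = (\<Sum>y\<in>children x. M y / l ^ Suc (L x))"
    by (intro sum.cong) (auto simp: c_child)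
  also have "\<dots> = M x / l ^ Suc (L x)" by (simp add: M_children[of x] flip: sum_divide_distrib)
  finally show ?thesis .
qed

lemma c_nonneg: "(x, z) \<in> E \<Longrightarrow> 0 \<le> c x z"
proof (erule E_cases)
  assume "(x, z) \<in> H"
  have "0 \<le> M x / (\<Lambda> * l ^ L x)" using M_pos[of x] Lam_ge l_pos by (intro divide_nonneg_nonneg) auto
  then show ?thesis using c_H(1)[OF \<open>(x, z) \<in> H\<close>] by linarith
next
  assume "x \<noteq> \<theta>" "z = par x" then show ?thesis using M_pos[of x] l_pos by (simp add: c_par)
next
  assume "z \<noteq> \<theta>" "x = par z" then show ?thesis using M_pos[of z] l_pos c_par[of z] c_sym[of x z] by simp
qed

lemma tot_ge: "M x / l ^ Suc (L x) \<le> tot x"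
proof -
  have "0 \<le> sum (c x) {z. (x, z) \<in> H}" by (intro sum_nonneg c_nonneg) (auto simp: E_def)
  moreover have "0 \<le> (if x = \<theta> then 0 else c x (par x))" using M_pos[of x] l_pos by (auto simp: c_par)
  ultimately show ?thesis unfolding tot_def sum_nbs sum_c_children by linarith
qed

lemma tot_pos: "0 < tot x"
  using tot_ge[of x] M_pos[of x] by (smt (verit) divide_pos_pos l_power_pos)

definition \<Lambda>1 :: real where "\<Lambda>1 = 1 / l + \<Lambda> * \<Lambda> + 1"

lemma Lam1_pos: "0 < \<Lambda>1" using l_pos Lam_ge by (simp add: \<Lambda>1_def add_pos_nonneg)

lemma tot_le: "tot x \<le> \<Lambda>1 * M x / l ^ L x"
proof -
  have "sum (c x) {z. (x, z) \<in> H} \<le> real (card {z. (x, z) \<in> H}) * (\<Lambda> * M x / l ^ L x)"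
    using c_H(2) by (intro sum_bounded_above) auto
  also have "\<dots> \<le> \<Lambda> * (\<Lambda> * M x / l ^ L x)"
    using card_H M_pos[of x] Lam_ge l_pos by (intro mult_right_mono) auto
  finally have "sum (c x) {z. (x, z) \<in> H} \<le> \<Lambda> * (\<Lambda> * M x / l ^ L x)" .
  moreover have "(if x = \<theta> then 0 else c x (par x)) \<le> M x / l ^ L x"
    using M_pos[of x] by (auto simp: c_par)
  ultimately have "tot x \<le> M x / l ^ Suc (L x) + \<Lambda> * (\<Lambda> * M x / l ^ L x) + M x / l ^ L x"
    unfolding tot_def sum_nbs sum_c_children by linarith
  also have "\<dots> = \<Lambda>1 * M x / l ^ L x" using l_pos by (simp add: \<Lambda>1_def field_simps)
  finally show ?thesis .
qed

lemma kappa_ge: "1 / \<Lambda>1 \<le> \<kappa> x"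
  using tot_le[of x] tot_pos[of x] M_pos[of x] Lam1_pos by (simp add: \<kappa>_def field_simps)

lemma kappa_pos: "0 < \<kappa> x" using M_pos[of x] tot_pos[of x] l_pos by (simp add: \<kappa>_def)

lemma kappa_root: "\<kappa> \<theta> = l"
proof -
  have "{z. (\<theta>, z) \<in> H} = {}" using H_lev H_irrefl L_eq_0 by (metis (mono_tags, lifting) L_root empty_Collect_eq)
  then have "tot \<theta> = M \<theta> / l" unfolding tot_def sum_nbs sum_c_children by simp
  then show ?thesis using M_pos[of \<theta>] by (simp add: \<kappa>_def)
qed

lemma P_nonneg: "z \<in> nbs x \<Longrightarrow> 0 \<le> P x z"
  using c_nonneg[of x z] tot_pos[of x] by (simp add: P_def nbs_def)

lemma Q_nonneg: "z \<in> nbs x \<Longrightarrow> 0 \<le> Q x z"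
  using P_nonneg[of z x] l_pos by (simp add: Q_def)

lemma sum_P: "sum (P x) (nbs x) = 1"
  using tot_pos[of x] by (simp add: P_def flip: sum_divide_distrib tot_def)

lemma P_up: "x \<noteq> \<theta> \<Longrightarrow> P x (par x) = \<kappa> x" by (simp add: P_def c_par \<kappa>_def)

lemma sum_P_down: "sum (P x) (children x) = \<kappa> x / l"
  by (simp add: P_def \<kappa>_def sum_c_children flip: sum_divide_distrib)

lemma Q_up: "x \<noteq> \<theta> \<Longrightarrow> Q x (par x) = \<kappa> x / l"
  using l_pos L_Suc[of x] by (simp add: Q_def P_up)

lemma Q_child: "y \<in> children x \<Longrightarrow> Q x y = l * P x y"
  using l_pos L_child[of y x] by (simp add: Q_def)

lemma Q_H: "(x, y) \<in> H \<Longrightarrow> Q x y = P x y"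
  using H_lev[of x y] l_pos by (simp add: Q_def)

text \<open>Only \<open>\<kappa> x\<close> remembers the vertex: the level performs a lazy nearest
  neighbour walk whose steps up and down have probabilities in the ratio
  \<open>1 / l\<close>.\<close>

lemma Q_level:
  assumes "x \<noteq> \<theta>"
  shows "(\<Sum>z\<in>nbs x. Q x z * \<phi> (L z)) =
    \<kappa> x / l * \<phi> (L x - 1) + \<kappa> x * \<phi> (Suc (L x)) + (1 - \<kappa> x - \<kappa> x / l) * \<phi> (L x)"
proof -
  have "(\<Sum>z\<in>children x. Q x z * \<phi> (L z)) = (\<Sum>z\<in>children x. P x z) * (l * \<phi> (Suc (L x)))"
    unfolding sum_distrib_right by (intro sum.cong) (auto simp: Q_child L_child)
  also have "\<dots> = \<kappa> x * \<phi> (Suc (L x))" using l_pos by (simp add: sum_P_down)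
  finally have 1: "(\<Sum>z\<in>children x. Q x z * \<phi> (L z)) = \<kappa> x * \<phi> (Suc (L x))" .
  have "(\<Sum>z | (x, z) \<in> H. Q x z * \<phi> (L z)) = (\<Sum>z | (x, z) \<in> H. P x z) * \<phi> (L x)"
    unfolding sum_distrib_right using H_lev by (intro sum.cong) (auto simp: Q_H)
  also have "(\<Sum>z | (x, z) \<in> H. P x z) = 1 - \<kappa> x - \<kappa> x / l"
    using sum_P[of x] assms by (simp add: sum_nbs sum_P_down P_up)
  finally show ?thesis using assms 1 by (simp add: sum_nbs Q_up L_par)
qed

lemma Q_level_root: "(\<Sum>z\<in>nbs \<theta>. Q \<theta> z * \<phi> (L z)) = l * \<phi> 1"
proof -
  have H0: "{z. (\<theta>, z) \<in> H} = {}" using H_lev H_irrefl L_eq_0 by (metis (mono_tags, lifting) L_root empty_Collect_eq)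
  have "(\<Sum>z\<in>children \<theta>. Q \<theta> z * \<phi> (L z)) = (\<Sum>z\<in>children \<theta>. P \<theta> z) * (l * \<phi> 1)"
    unfolding sum_distrib_right by (intro sum.cong) (auto simp: Q_child L_child)
  also have "\<dots> = l * \<phi> 1" using l_pos by (simp add: sum_P_down kappa_root)
  finally show ?thesis using H0 by (simp add: sum_nbs)
qed

lemma sum_Q: "x \<noteq> \<theta> \<Longrightarrow> sum (Q x) (nbs x) = 1"
  using Q_level[of x "\<lambda>_. 1"] by simp

lemma sum_Q_root: "sum (Q \<theta>) (nbs \<theta>) = l"
  using Q_level_root[of "\<lambda>_. 1"] by simp

lemma sum_Q_le: "sum (Q x) (nbs x) \<le> 1"
  using sum_Q[of x] sum_Q_root l_lt_1 by (cases "x = \<theta>") auto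

text \<open>Uniform ellipticity: a lower bound for \<open>Q\<close> on every edge, with
  \<open>1 / \<Lambda>1\<close> from \<open>\<kappa>\<close> and \<open>1 / \<Lambda>\<close> from
  the worst kind of edge.\<close>

definition \<delta> :: real where "\<delta> = 1 / (\<Lambda>1 * \<Lambda>)"

lemma delta_pos: "0 < \<delta>" using Lam1_pos Lam_ge by (simp add: \<delta>_def)

lemma delta_le_kappa: "\<delta> \<le> \<kappa> x / \<Lambda>"
  using kappa_ge[of x] Lam_ge unfolding \<delta>_def divide_divide_eq_left[symmetric]
  by (intro divide_right_mono) auto

lemma Q_ge: assumes "(x, z) \<in> E" shows "\<delta> \<le> Q x z"
  using assms
proof (cases rule: E_cases)
  case par
  have "\<kappa> x / \<Lambda> \<le> \<kappa> x / l" using kappa_pos[of x] l_pos l_lt_1 Lam_ge by (intro divide_left_mono) auto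
  then show ?thesis using par delta_le_kappa[of x] by (simp add: Q_up)
next
  case child
  then have z: "z \<in> children x" by (simp add: children_def)
  have "\<kappa> x / \<Lambda> = (M x / \<Lambda>) / (l ^ L x * tot x)" by (simp add: \<kappa>_def)
  also have "\<dots> \<le> M z / (l ^ L x * tot x)"
    using M_par[of z] child Lam_ge tot_pos[of x] l_pos by (intro divide_right_mono) (auto simp: field_simps)
  also have "\<dots> = Q x z" using z l_pos by (simp add: Q_child P_def c_child)
  finally show ?thesis using delta_le_kappa[of x] by simp
next
  case horizontal
  have "\<kappa> x / \<Lambda> = M x / (\<Lambda> * l ^ L x) / tot x" by (simp add: \<kappa>_def field_simps)
  also have "\<dots> \<le> c x z / tot x" using horizontal c_H(1) tot_pos[of x] by (intro divide_right_mono) auto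
  finally show ?thesis using delta_le_kappa[of x] horizontal by (simp add: Q_H P_def)
qed

text \<open>The reversing measure of \<open>Q\<close>: that of \<open>P\<close> times the square of
  \<open>l ^ L x\<close>. Up to constants it is \<open>l ^ L x * M x\<close>.\<close>

definition mh :: "'a \<Rightarrow> real" where "mh x = tot x * l ^ (2 * L x)"

lemma mh_pos: "0 < mh x" using tot_pos[of x] l_pos by (simp add: mh_def)

lemma mh_le: "mh x \<le> \<Lambda>1 * (l ^ L x * M x)"
proof -
  have "mh x \<le> \<Lambda>1 * M x / l ^ L x * l ^ (2 * L x)"
    unfolding mh_def using tot_le[of x] l_pos by (intro mult_right_mono) auto
  also have "\<dots> = \<Lambda>1 * (l ^ L x * M x)" using l_pos by (simp add: mult_2 power_add)
  finally show ?thesis .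
qed

lemma mh_ge: "l ^ L x * M x \<le> mh x"
proof -
  have "l ^ L x * M x \<le> l ^ L x * M x / l"
    using l_pos l_lt_1 M_pos[of x] by (simp add: field_simps)
  also have "\<dots> = M x / l ^ Suc (L x) * l ^ (2 * L x)"
    using l_pos by (simp add: mult_2 power_add)
  also have "\<dots> \<le> mh x" unfolding mh_def using tot_ge[of x] l_pos by (intro mult_right_mono) auto
  finally show ?thesis .
qed

lemma mh_Q_sym: "mh x * Q x z = mh z * Q z x"
proof -
  have "mh x * Q x z = c x z * l ^ (L x + L z)" for x z
    using tot_pos[of x] l_pos by (simp add: mh_def Q_def P_def mult_2 power_add)
  then show ?thesis by (metis add.commute c_sym)
qed

end

section \<open>Harmonic functions and the killed Green function\<close>

lemma power_div_fact_le_exp: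
  fixes x :: real assumes "0 \<le> x" shows "x ^ n / fact n \<le> exp x"
proof -
  have "(\<Sum>k\<in>{n}. x ^ k /\<^sub>R fact k) \<le> (\<Sum>k. x ^ k /\<^sub>R fact k)"
    by (rule sum_le_suminf) (use assms summable_exp_generic[of x] in auto)
  then show ?thesis by (simp add: exp_def divide_inverse mult.commute)
qed

lemma exp_le_quadratic:
  fixes x :: real assumes "\<bar>x\<bar> \<le> 1" shows "exp x \<le> 1 + x + x\<^sup>2"
proof (cases "0 \<le> x")
  case True
  then show ?thesis using exp_bound[of x] assms by simp
next
  case False
  define t where "t = - x"
  have t: "0 < t" "t \<le> 1" using False assms by (auto simp: t_def)
  have "1 \<le> (1 - t + t\<^sup>2) * (1 + t + t\<^sup>2 / 2)"
  proof -
    have "(1 - t + t\<^sup>2) * (1 + t + t\<^sup>2 / 2) = 1 + (t ^ 2 + t ^ 3 + t ^ 4) / 2"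
      by (simp add: field_simps power2_eq_square power3_eq_cube power4_eq_xxxx)
    then show ?thesis using t by simp
  qed
  also have "\<dots> \<le> (1 - t + t\<^sup>2) * exp t"
    using t exp_lower_Taylor_quadratic[of t] by (intro mult_left_mono) auto
  finally have "exp (- t) \<le> 1 - t + t\<^sup>2" by (simp add: exp_minus field_simps)
  then show ?thesis by (simp add: t_def)
qed

text \<open>Used with \<open>\<sigma> = 1 / s\<close>: whatever multiplies by a fixed factor per
  level is beaten by the exponential of something that grows geometrically. If
  \<open>\<sigma> ^ p\<close> exceeds \<open>B\<close>, the \<open>p\<close>-th term of the
  exponential series already suffices.\<close>

lemma power_le_exp_power:
  fixes B \<epsilon> \<sigma> :: real
  assumes "0 < B" "0 < \<epsilon>" "1 < \<sigma>"
  shows "\<exists>C>0. \<forall>t. B ^ t \<le> C * exp (\<epsilon> * \<sigma> ^ t)"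
proof -
  obtain p where p: "B < \<sigma> ^ p" using real_arch_pow[OF assms(3)] by blast
  show ?thesis
  proof (intro exI[of _ "fact p / \<epsilon> ^ p"] conjI allI)
    fix t
    have "B ^ t \<le> (\<sigma> ^ p) ^ t" using p assms by (intro power_mono) auto
    also have "\<dots> = fact p / \<epsilon> ^ p * ((\<epsilon> * \<sigma> ^ t) ^ p / fact p)"
      using assms by (simp add: power_mult_distrib mult.commute flip: power_mult)
    also have "\<dots> \<le> fact p / \<epsilon> ^ p * exp (\<epsilon> * \<sigma> ^ t)"
      using assms by (intro mult_left_mono power_div_fact_le_exp) auto
    finally show "B ^ t \<le> fact p / \<epsilon> ^ p * exp (\<epsilon> * \<sigma> ^ t)" .
  qed (use assms in auto)
qed

lemma sum_geometric_dist_le: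
  fixes \<rho> :: real assumes "0 < \<rho>" "\<rho> < 1"
  shows "(\<Sum>i\<le>N. \<rho> ^ (if i \<le> k then k - i else i - k)) \<le> 2 / (1 - \<rho>)"
proof -
  have geo: "(\<Sum>i<n. \<rho> ^ i) \<le> 1 / (1 - \<rho>)" for n
    using assms sum_le_suminf[of "\<lambda>i. \<rho> ^ i" "{..<n}"] suminf_geometric[of \<rho>]
    by (simp add: summable_geometric)
  have "(\<Sum>i\<le>N. \<rho> ^ (if i \<le> k then k - i else i - k))
      = (\<Sum>i\<in>{..N} \<inter> {..k}. \<rho> ^ (k - i)) + (\<Sum>i\<in>{..N} \<inter> {k<..}. \<rho> ^ (i - k))"
  proof -
    have N: "{..N} = ({..N} \<inter> {..k}) \<union> ({..N} \<inter> {k<..})" by auto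
    show ?thesis
      by (subst N, subst sum.union_disjoint) (auto intro!: arg_cong2[where f = "(+)"] sum.cong)
  qed
  also have "(\<Sum>i\<in>{..N} \<inter> {..k}. \<rho> ^ (k - i)) \<le> (\<Sum>i\<le>k. \<rho> ^ (k - i))"
    using assms by (intro sum_mono2) auto
  also have "(\<Sum>i\<le>k. \<rho> ^ (k - i)) = (\<Sum>i<Suc k. \<rho> ^ i)"
    using sum.nat_diff_reindex[of "\<lambda>i. \<rho> ^ i" "Suc k"] by (simp add: lessThan_Suc_atMost)
  also have "(\<Sum>i\<in>{..N} \<inter> {k<..}. \<rho> ^ (i - k)) \<le> (\<Sum>i<Suc N. \<rho> ^ i)"
  proof -
    have "(\<Sum>i\<in>{..N} \<inter> {k<..}. \<rho> ^ (i - k)) = (\<Sum>j\<in>(\<lambda>i. i - k) ` ({..N} \<inter> {k<..}). \<rho> ^ j)"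
      by (subst sum.reindex) (auto simp: inj_on_def)
    also have "\<dots> \<le> (\<Sum>i<Suc N. \<rho> ^ i)" using assms by (intro sum_mono2) auto
    finally show ?thesis .
  qed
  finally show ?thesis using geo[of "Suc k"] geo[of "Suc N"] by linarith
qed

context natural_walk
begin

section \<open>The averaging operator and its superharmonic functions\<close>

definition Qop :: "('a \<Rightarrow> real) \<Rightarrow> 'a \<Rightarrow> real" where
  "Qop f x = (\<Sum>z\<in>nbs x. Q x z * f z)"

lemma Qop_mono: "(\<And>z. z \<in> nbs x \<Longrightarrow> f z \<le> g z) \<Longrightarrow> Qop f x \<le> Qop g x"
  unfolding Qop_def by (intro sum_mono mult_left_mono Q_nonneg) auto

lemma Qop_add: "Qop (\<lambda>z. f z + g z) x = Qop f x + Qop g x"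
  by (simp add: Qop_def distrib_left sum.distrib)

lemma Qop_diff: "Qop (\<lambda>z. f z - g z) x = Qop f x - Qop g x"
  by (simp add: Qop_def right_diff_distrib sum_subtractf)

lemma Qop_cmult: "Qop (\<lambda>z. b * f z) x = b * Qop f x"
  by (simp add: Qop_def sum_distrib_left mult.left_commute)

lemma Qop_const: "x \<noteq> \<theta> \<Longrightarrow> Qop (\<lambda>_. b) x = b"
  by (simp add: Qop_def sum_Q flip: sum_distrib_right)

text \<open>A lower bound for the relative mean gain of \<open>s ^ L\<close> in one step. Off the
  root the exact gain is \<open>\<kappa> x * (1 - s) * (1 / l - s) / s\<close>.\<close>

definition \<kappa>1 :: real where "\<kappa>1 = 1 / \<Lambda>1 * (1 - s) * (1 / l - 1)"

lemma kappa1_pos: "0 < \<kappa>1"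
  using Lam1_pos s_lt_1 l_pos l_lt_1 by (simp add: \<kappa>1_def)

text \<open>\<open>A * \<kappa>1 = 1 / s + 1\<close>: the summand \<open>1 / s\<close> absorbs the
  mean change of \<open>D _ q\<close>, and the summand \<open>1\<close> leaves a drift of at least
  \<open>s ^ L x\<close> for \<open>Y\<close>.\<close>

definition A :: real where "A = (1 / s + 1) / \<kappa>1"

lemma A_pos: "0 < A" using kappa1_pos s_pos by (simp add: A_def add_pos_pos)

text \<open>The level of the \<open>h\<close>-process drifts towards the root, so that \<open>s ^ L\<close> is strictly
  subharmonic; the drift compensates the increments of \<open>D _ q\<close>.\<close>

lemma level_drift:
  assumes "x \<noteq> \<theta>" shows "(1 + \<kappa>1) * s ^ L x \<le> Qop (\<lambda>z. s ^ L z) x"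
proof -
  obtain n where n: "L x = Suc n" using L_Suc assms by auto
  have "\<kappa>1 * s \<le> \<kappa> x * ((1 - s) * (1 / l - s))"
  proof -
    have "\<kappa>1 * s \<le> \<kappa>1 * 1" using kappa1_pos s_lt_1 by (intro mult_left_mono) auto
    also have "\<dots> = 1 / \<Lambda>1 * ((1 - s) * (1 / l - 1))" by (simp add: \<kappa>1_def)
    also have "\<dots> \<le> \<kappa> x * ((1 - s) * (1 / l - s))"
      using kappa_ge[of x] kappa_pos[of x] s_lt_1 l_pos l_lt_1
      by (intro mult_mono mult_nonneg_nonneg) auto
    finally show ?thesis .
  qed
  then have "s ^ n * (\<kappa>1 * s) \<le> s ^ n * (\<kappa> x * ((1 - s) * (1 / l - s)))"
    using s_pos by (intro mult_left_mono) auto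
  then have "(1 + \<kappa>1) * s ^ L x
      \<le> \<kappa> x / l * s ^ n + \<kappa> x * s ^ Suc (Suc n) + (1 - \<kappa> x - \<kappa> x / l) * s ^ Suc n"
    by (simp add: n algebra_simps)
  then show ?thesis
    unfolding Qop_def Q_level[OF assms, of "\<lambda>n. s ^ n"] by (simp add: n)
qed

lemma D_Qop:
  assumes "x \<noteq> \<theta>"
  shows "\<bar>Qop (\<lambda>z. D z q) x - D x q\<bar> \<le> s ^ L x / s"
proof -
  have eq: "Qop (\<lambda>z. D z q) x - D x q = Qop (\<lambda>z. D z q - D x q) x"
    by (simp add: Qop_diff Qop_const[OF assms])
  have "\<bar>Qop (\<lambda>z. D z q - D x q) x\<bar> \<le> (\<Sum>z\<in>nbs x. Q x z * (s ^ L x / s))"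
    unfolding Qop_def
  proof (rule order_trans[OF sum_abs], rule sum_mono)
    fix z assume "z \<in> nbs x"
    then show "\<bar>Q x z * (D z q - D x q)\<bar> \<le> Q x z * (s ^ L x / s)"
      using D_Lipschitz[of x z q] Q_nonneg[of z x]
      by (simp add: abs_mult nbs_def mult_left_mono del: times_divide_eq_right)
  qed
  also have "\<dots> = sum (Q x) (nbs x) * (s ^ L x / s)" by (rule sum_distrib_right[symmetric])
  also have "\<dots> = s ^ L x / s" unfolding sum_Q[OF assms] by (rule mult_1)
  finally show ?thesis unfolding eq .
qed

lemma A_drift:
  assumes "x \<noteq> \<theta>" shows "A * s ^ L x + s ^ L x / s + s ^ L x \<le> Qop (\<lambda>z. A * s ^ L z) x"
proof -
  have "A * s ^ L x + s ^ L x / s + s ^ L x = A * ((1 + \<kappa>1) * s ^ L x)"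
  proof -
    have "A * \<kappa>1 = 1 / s + 1" using kappa1_pos by (simp add: A_def)
    moreover have "A * ((1 + \<kappa>1) * s ^ L x) = A * s ^ L x + (A * \<kappa>1) * s ^ L x" by (simp add: algebra_simps)
    ultimately show ?thesis by (simp add: distrib_right)
  qed
  also have "\<dots> \<le> A * Qop (\<lambda>z. s ^ L z) x" using level_drift[OF assms] A_pos by (intro mult_left_mono) auto
  finally show ?thesis by (simp add: Qop_cmult)
qed

definition Y :: "'a \<Rightarrow> 'a \<Rightarrow> real" where "Y q x = D x q + A * s ^ L x"

lemma Y_drift: "x \<noteq> \<theta> \<Longrightarrow> s ^ L x \<le> Qop (Y q) x - Y q x"
  using A_drift[of x] D_Qop[of x q] Qop_add[of "\<lambda>z. D z q" "\<lambda>z. A * s ^ L z" x] by (auto simp: Y_def[abs_def])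

text \<open>The mean change of \<open>D\<close> is bounded in absolute value, so \<open>D\<close>
  becomes subharmonic on adding \<open>A * s ^ L\<close> and superharmonic on subtracting
  it.\<close>

lemma V_super: "x \<noteq> \<theta> \<Longrightarrow> Qop (\<lambda>z. D z q - A * s ^ L z) x \<le> D x q - A * s ^ L x"
proof -
  assume "x \<noteq> \<theta>"
  then have "A * s ^ L x + s ^ L x / s + s ^ L x \<le> Qop (\<lambda>z. A * s ^ L z) x"
    "\<bar>Qop (\<lambda>z. D z q) x - D x q\<bar> \<le> s ^ L x / s" by (rule A_drift, rule D_Qop)
  moreover have "0 \<le> s ^ L x" using s_pos by simp
  ultimately show ?thesis by (simp add: Qop_diff)
qed

definition C1 :: real where "C1 = 1 / s + A / s"

lemma C1_pos: "0 < C1" using s_pos A_pos by (simp add: C1_def add_pos_pos)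

lemma Y_Lipschitz:
  assumes "z \<in> nbs x" shows "\<bar>Y q z - Y q x\<bar> \<le> C1 * s ^ L x"
proof -
  have E: "(x, z) \<in> E" using assms by (simp add: nbs_def)
  have "s ^ L z \<le> s ^ L x / s"
    using s_power_mono[of "L x" "Suc (L z)"] E_lev[OF E] s_pos by (simp add: field_simps)
  moreover have "s ^ L x \<le> s ^ L x / s" using s_pos s_lt_1 by (simp add: field_simps)
  ultimately have "\<bar>s ^ L z - s ^ L x\<bar> \<le> s ^ L x / s"
    using s_pos by (smt (verit) zero_less_power)
  then have "\<bar>A * (s ^ L z - s ^ L x)\<bar> \<le> A * (s ^ L x / s)"
    using A_pos by (simp add: abs_mult del: times_divide_eq_right)
  then show ?thesis using D_Lipschitz[OF E, of q]
    by (simp add: Y_def C1_def algebra_simps)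
qed

text \<open>A lower bound for the mass lost when steps to the parent are forbidden; at the root,
  which has no parent, the loss is the killing \<open>1 - l\<close>.\<close>

definition \<delta>' :: real where "\<delta>' = min \<delta> (1 - l)"

lemma delta'_pos: "0 < \<delta>'" and delta'_le: "\<delta>' < 1"
  using delta_pos l_pos l_lt_1 by (auto simp: \<delta>'_def)

text \<open>The three bounds serve, in this order, the quadratic estimate of the exponential, the
  domination of its second-order term by the drift of \<open>Y\<close>, and the loss on the killing
  level in \<open>psi_killed\<close>.\<close>

definition \<eta> :: real where "\<eta> = min (min (1 / C1) (1 / C1\<^sup>2)) (\<delta>' / (4 * C1))"

lemma eta_pos: "0 < \<eta>" using C1_pos delta'_pos by (simp add: \<eta>_def)

lemma eta_C1: "\<eta> * C1 \<le> 1" "\<eta> * C1\<^sup>2 \<le> 1" "\<eta> * C1 \<le> \<delta>' / 4"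
proof -
  have "\<eta> * C1 \<le> 1 / C1 * C1" "\<eta> * C1\<^sup>2 \<le> 1 / C1\<^sup>2 * C1\<^sup>2" "\<eta> * C1 \<le> \<delta>' / (4 * C1) * C1"
    using C1_pos by (intro mult_right_mono; simp add: \<eta>_def)+
  then show "\<eta> * C1 \<le> 1" "\<eta> * C1\<^sup>2 \<le> 1" "\<eta> * C1 \<le> \<delta>' / 4" using C1_pos by auto
qed

definition \<psi> :: "real \<Rightarrow> nat \<Rightarrow> 'a \<Rightarrow> 'a \<Rightarrow> real" where
  "\<psi> e i q x = exp (- (e / s ^ i) * Y q x)"

lemma psi_pos: "0 < \<psi> e i q x" by (simp add: \<psi>_def)

lemma psi_step: "\<psi> e i q z = \<psi> e i q x * exp (- (e / s ^ i * (Y q z - Y q x)))"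
  by (simp add: \<psi>_def algebra_simps flip: exp_add)

lemma psi_increment:
  assumes "z \<in> nbs x" "i \<le> L x" "0 < e" "e \<le> \<eta>"
  shows "\<bar>e / s ^ i * (Y q z - Y q x)\<bar> \<le> e * C1 * s ^ (L x - i)"
proof -
  have "\<bar>e / s ^ i * (Y q z - Y q x)\<bar> = e / s ^ i * \<bar>Y q z - Y q x\<bar>"
    using assms s_pos by (simp add: abs_mult)
  also have "\<dots> \<le> e / s ^ i * (C1 * s ^ L x)"
    using assms s_pos by (intro mult_left_mono Y_Lipschitz) auto
  also have "\<dots> = e * C1 * s ^ (L x - i)" using assms s_pos by (simp add: power_diff)
  finally show ?thesis .
qed

text \<open>With \<open>\<tau> = s ^ (L x - i)\<close>, the exponent falls in mean by at least
  \<open>e * \<tau>\<close>, while its increments are at most \<open>e * C1 * \<tau>\<close>. As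
  \<open>\<tau> \<le> 1\<close>, the second-order term is at most the mean fall, at every level
  beyond \<open>i\<close>.\<close>

lemma psi_super:
  assumes "i < L x" "0 < e" "e \<le> \<eta>"
  shows "Qop (\<psi> e i q) x \<le> \<psi> e i q x"
proof -
  have x: "x \<noteq> \<theta>" using assms by auto
  define \<tau> where "\<tau> = s ^ (L x - i)"
  have tau: "0 < \<tau>" "\<tau> \<le> 1" using s_pos s_lt_1 by (auto simp: \<tau>_def power_le_one)
  define u where "u z = e / s ^ i * (Y q z - Y q x)" for z
  have eC: "e * C1 \<le> 1" using assms C1_pos eta_C1 by (smt (verit) mult_right_mono)
  have eC2: "e * C1\<^sup>2 \<le> 1" using assms eta_C1 by (smt (verit) mult_right_mono zero_le_power2)
  have ub: "\<bar>u z\<bar> \<le> e * C1 * \<tau>" if "z \<in> nbs x" for z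
    using psi_increment[OF that, of i e q] assms by (simp add: u_def \<tau>_def)
  have step: "exp (- u z) \<le> 1 - u z + (e * C1 * \<tau>)\<^sup>2" if "z \<in> nbs x" for z
  proof -
    have "(e * C1) * \<tau> \<le> 1" using eC tau assms C1_pos by (intro mult_le_one[of "e * C1"]) auto
    then have "\<bar>u z\<bar> \<le> 1" using ub[OF that] by simp
    then have "exp (- u z) \<le> 1 + (- u z) + (- u z)\<^sup>2" by (intro exp_le_quadratic) simp
    moreover have "\<bar>u z\<bar>\<^sup>2 \<le> (e * C1 * \<tau>)\<^sup>2" using ub[OF that] by (intro power_mono) auto
    ultimately show ?thesis by simp
  qed
  have drift: "Qop u x \<ge> e * \<tau>"
  proof -
    have "Qop u x = e / s ^ i * (Qop (Y q) x - Y q x)"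
      unfolding u_def Qop_cmult Qop_diff Qop_const[OF x] ..
    moreover have "e / s ^ i * s ^ L x \<le> e / s ^ i * (Qop (Y q) x - Y q x)"
      using Y_drift[OF x, of q] assms s_pos by (intro mult_left_mono) auto
    moreover have "e / s ^ i * s ^ L x = e * \<tau>" using assms s_pos by (simp add: \<tau>_def power_diff)
    ultimately show ?thesis by simp
  qed
  have "Qop (\<lambda>z. exp (- u z)) x \<le> Qop (\<lambda>z. (1 + (e * C1 * \<tau>)\<^sup>2) - u z) x"
    using step by (intro Qop_mono) (auto simp: algebra_simps)
  also have "\<dots> = 1 + (e * C1 * \<tau>)\<^sup>2 - Qop u x" unfolding Qop_diff Qop_const[OF x] ..
  also have "\<dots> \<le> 1"
  proof -
    have "(e * C1 * \<tau>)\<^sup>2 = (e * \<tau>) * ((e * C1\<^sup>2) * \<tau>)" by (simp add: power2_eq_square)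
    also have "\<dots> \<le> (e * \<tau>) * 1" 
      using eC2 tau assms by (intro mult_left_mono mult_le_one[of "e * C1\<^sup>2"]) auto
    finally show ?thesis using drift by simp
  qed
  finally have "\<psi> e i q x * Qop (\<lambda>z. exp (- u z)) x \<le> \<psi> e i q x * 1"
    using psi_pos by (intro mult_left_mono) (auto simp: less_imp_le)
  then show ?thesis
    unfolding Qop_cmult[symmetric] u_def psi_step[symmetric] by simp
qed

lemma sum_Q_not_up: "(\<Sum>z\<in>nbs x. if L x \<le> L z then Q x z else 0) \<le> 1 - \<delta>'"
proof (cases "x = \<theta>")
  case True
  then have "(\<Sum>z\<in>nbs x. if L x \<le> L z then Q x z else 0) = l" by (simp add: sum_Q_root)
  then show ?thesis by (simp add: \<delta>'_def)
next
  case False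
  have "(\<Sum>z\<in>nbs x. if L x \<le> L z then Q x z else 0) = (\<Sum>z\<in>nbs x. Q x z * (if L x \<le> L z then 1 else 0))"
    by (intro sum.cong) auto
  also have "\<dots> = 1 - \<kappa> x / l"
    unfolding Q_level[OF False, of "\<lambda>n. if L x \<le> n then 1 else 0"] using L_Suc[OF False] by simp
  also have "\<dots> \<le> 1 - \<delta>"
    using Q_ge[of x "par x"] Q_up[OF False] False by (simp add: E_def parent_edges_def)
  finally show ?thesis by (simp add: \<delta>'_def)
qed

text \<open>On level \<open>i\<close> the drift of \<open>Y\<close> is of no help, because it relies
  on the steps to the parent, which are forbidden here. Instead the lost mass
  \<open>\<delta>'\<close> outweighs the possible growth of \<open>\<psi>\<close> by the factor
  \<open>exp (e * C1)\<close>.\<close>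

lemma psi_killed:
  assumes "0 < e" "e \<le> \<eta>"
  shows "(\<Sum>z\<in>nbs x. if L x \<le> L z then Q x z * \<psi> e (L x) q z else 0) \<le> (1 - \<delta>' / 2) * \<psi> e (L x) q x"
proof -
  have eC: "e * C1 \<le> \<eta> * C1" using assms C1_pos by (intro mult_right_mono) auto
  define t where "t = e * C1"
  have t: "0 \<le> t" "t \<le> \<delta>' / 4" "t \<le> 1"
    using eC eta_C1 assms C1_pos delta'_le unfolding t_def
    by (simp, linarith, linarith)
  have ext: "exp t \<le> 1 + 2 * t"
    using t real_exp_bound_lemma[of t] delta'_le by auto
  have "(\<Sum>z\<in>nbs x. if L x \<le> L z then Q x z * \<psi> e (L x) q z else 0)
    \<le> (\<Sum>z\<in>nbs x. (if L x \<le> L z then Q x z else 0) * (\<psi> e (L x) q x * exp t))"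
  proof (intro sum_mono)
    fix z assume z: "z \<in> nbs x"
    have "- (e / s ^ L x * (Y q z - Y q x)) \<le> t"
      using psi_increment[OF z, of "L x" e q] assms abs_ge_minus_self[of "e / s ^ L x * (Y q z - Y q x)"]
      unfolding t_def by simp
    then have "\<psi> e (L x) q z \<le> \<psi> e (L x) q x * exp t"
      unfolding psi_step[of e "L x" q z x] using psi_pos[of e "L x" q x] by (intro mult_left_mono) auto
    then show "(if L x \<le> L z then Q x z * \<psi> e (L x) q z else 0)
        \<le> (if L x \<le> L z then Q x z else 0) * (\<psi> e (L x) q x * exp t)"
      using Q_nonneg[OF z] by (auto intro: mult_left_mono)
  qed
  also have "\<dots> = (\<Sum>z\<in>nbs x. if L x \<le> L z then Q x z else 0) * (\<psi> e (L x) q x * exp t)"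
    by (simp add: sum_distrib_right)
  also have "\<dots> \<le> (1 - \<delta>') * (\<psi> e (L x) q x * exp t)"
    using sum_Q_not_up psi_pos[of e "L x" q x] by (intro mult_right_mono) auto
  also have "\<dots> \<le> (1 - \<delta>') * (\<psi> e (L x) q x * (1 + 2 * t))"
    using ext delta'_le psi_pos[of e "L x" q x] by (intro mult_left_mono) auto
  also have "\<dots> = ((1 - \<delta>') * (1 + 2 * t)) * \<psi> e (L x) q x" by simp
  also have "\<dots> \<le> (1 - \<delta>' / 2) * \<psi> e (L x) q x"
  proof (intro mult_right_mono)
    have "(1 - \<delta>') * (1 + 2 * t) \<le> (1 - \<delta>') * (1 + \<delta>' / 2)"
      using t delta'_le by (intro mult_left_mono) auto
    also have "\<dots> \<le> 1 - \<delta>' / 2" using delta'_pos by (simp add: algebra_simps)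
    finally show "(1 - \<delta>') * (1 + 2 * t) \<le> 1 - \<delta>' / 2" .
  qed (use psi_pos[of e "L x" q x] in simp)
  finally show ?thesis .
qed

section \<open>Killed Green functions and their symmetry\<close>

definition Qk :: "nat \<Rightarrow> 'a \<Rightarrow> 'a \<Rightarrow> real" where
  "Qk i x z = (if i \<le> L x \<and> i \<le> L z then Q x z else 0)"

fun qk :: "nat \<Rightarrow> nat \<Rightarrow> 'a \<Rightarrow> 'a \<Rightarrow> real" where
  "qk i 0 x y = of_bool (x = y \<and> i \<le> L x)"
| "qk i (Suc n) x y = (\<Sum>z\<in>nbs x. Qk i x z * qk i n z y)"

text \<open>The Green function of the \<open>h\<close>-process killed above level \<open>i\<close>, up to time \<open>n\<close>.\<close>

definition gk :: "nat \<Rightarrow> nat \<Rightarrow> 'a \<Rightarrow> 'a \<Rightarrow> real" where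
  "gk i n x y = (\<Sum>k<n. qk i k x y)"

lemma nbs_sym: "x \<in> nbs y \<longleftrightarrow> y \<in> nbs x" by (auto simp: nbs_def E_sym)

text \<open>The definition peels off the first step, whereas reversing time needs the last
  one.\<close>

lemma qk_Suc_right: "qk i (Suc n) x y = (\<Sum>z\<in>nbs y. qk i n x z * Qk i z y)"
proof (induction n arbitrary: x)
  case 0
  have "qk i (Suc 0) x y = (\<Sum>z\<in>nbs x. if z = y then Qk i x y else 0)"
    unfolding qk.simps by (intro sum.cong) (auto simp: Qk_def)
  also have "\<dots> = (\<Sum>z\<in>nbs y. if z = x then Qk i x y else 0)"
    using finite_nbs by (simp add: nbs_sym)
  also have "\<dots> = (\<Sum>z\<in>nbs y. qk i 0 x z * Qk i z y)"
    by (intro sum.cong) (auto simp: Qk_def)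
  finally show ?case .
next
  case (Suc n)
  have "qk i (Suc (Suc n)) x y = (\<Sum>z\<in>nbs x. Qk i x z * (\<Sum>w\<in>nbs y. qk i n z w * Qk i w y))"
    using Suc by (subst qk.simps(2)) simp
  also have "\<dots> = (\<Sum>w\<in>nbs y. (\<Sum>z\<in>nbs x. Qk i x z * qk i n z w) * Qk i w y)"
    unfolding sum_distrib_left sum_distrib_right by (subst sum.swap) (simp add: mult.assoc)
  finally show ?case by simp
qed

lemma mh_qk_sym: "mh x * qk i n x y = mh y * qk i n y x"
proof (induction n arbitrary: x)
  case (Suc n)
  have "mh x * qk i (Suc n) x y = (\<Sum>z\<in>nbs x. (mh x * Qk i x z) * qk i n z y)"
    by (simp add: sum_distrib_left mult.assoc)
  also have "\<dots> = (\<Sum>z\<in>nbs x. Qk i z x * (mh z * qk i n z y))"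
    using mh_Q_sym by (intro sum.cong) (auto simp: Qk_def)
  also have "\<dots> = mh y * (\<Sum>z\<in>nbs x. qk i n y z * Qk i z x)"
    unfolding Suc by (simp add: sum_distrib_left mult_ac)
  finally show ?case by (simp only: qk_Suc_right)
qed auto

lemma mh_gk_sym: "mh x * gk i n x y = mh y * gk i n y x"
  by (simp add: gk_def sum_distrib_left mh_qk_sym)

lemma qk_eq_0: "L x < i \<Longrightarrow> qk i n x y = 0"
  by (cases n) (auto simp: Qk_def intro!: sum.neutral)

lemma gk_0 [simp]: "gk i 0 x y = 0" by (simp add: gk_def)

lemma gk_eq_0: "L x < i \<Longrightarrow> gk i n x y = 0" by (simp add: gk_def qk_eq_0)

lemma gk_eq_0': "L y < i \<Longrightarrow> gk i n x y = 0"
  using mh_gk_sym[of x i n y] gk_eq_0[of y i n x] mh_pos[of x] by simp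

text \<open>\<open>gk i n\<close> vanishes above level \<open>i\<close>, so from level
  \<open>i\<close> on the killing may be dropped from the recursion and the full operator
  used.\<close>

lemma gk_Suc: "i \<le> L x \<Longrightarrow> gk i (Suc n) x y = of_bool (x = y) + Qop (\<lambda>z. gk i n z y) x"
proof -
  assume i: "i \<le> L x"
  have "gk i (Suc n) x y = qk i 0 x y + (\<Sum>k<n. qk i (Suc k) x y)"
    unfolding gk_def by (rule sum.lessThan_Suc_shift)
  also have "(\<Sum>k<n. qk i (Suc k) x y) = (\<Sum>z\<in>nbs x. Qk i x z * gk i n z y)"
    unfolding gk_def qk.simps sum_distrib_left by (rule sum.swap)
  also have "\<dots> = Qop (\<lambda>z. gk i n z y) x"
    unfolding Qop_def using i by (intro sum.cong) (auto simp: Qk_def gk_eq_0)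
  finally show ?thesis using i by simp
qed

lemma qk_nonneg: "0 \<le> qk i n x y"
  by (induction n arbitrary: x) (auto simp: Qk_def intro!: sum_nonneg mult_nonneg_nonneg Q_nonneg)

lemma gk_nonneg: "0 \<le> gk i n x y" by (simp add: gk_def sum_nonneg qk_nonneg)

text \<open>Large enough that \<open>CT * (\<delta>' / 2) * \<psi> \<eta> i w w \<ge> 1\<close> for
  \<open>w\<close> on level \<open>i\<close>.\<close>

definition CT :: real where "CT = 2 / \<delta>' * exp (\<eta> * (1 + A))"

lemma CT_pos: "0 < CT" using delta'_pos by (simp add: CT_def)

text \<open>\<open>CT * \<psi>\<close> satisfies the recursion \<open>gk_Suc\<close> as an
  inequality: it is superharmonic below level \<open>i\<close>, and on level \<open>i\<close> its
  loss pays for the source at \<open>w\<close>. This is why the target has to lie on the killing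
  level.\<close>

lemma gk_le_psi:
  assumes "L w = i" shows "gk i n x w \<le> CT * \<psi> \<eta> i w x"
proof (induction n arbitrary: x)
  case 0
  show ?case using CT_pos psi_pos[of \<eta> i w x] by simp
next
  case (Suc n)
  consider "L x < i" | "i < L x" | "L x = i" by linarith
  then show ?case
  proof cases
    case 1
    then show ?thesis using CT_pos psi_pos[of \<eta> i w x] by (simp add: gk_eq_0)
  next
    case 2
    then have "x \<noteq> w" using assms by auto
    then have "gk i (Suc n) x w = Qop (\<lambda>z. gk i n z w) x" using 2 by (simp add: gk_Suc)
    also have "\<dots> \<le> Qop (\<lambda>z. CT * \<psi> \<eta> i w z) x" by (intro Qop_mono Suc)
    also have "\<dots> \<le> CT * \<psi> \<eta> i w x"
      unfolding Qop_cmult using psi_super[OF 2 eta_pos, of w] CT_pos by (intro mult_left_mono) auto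
    finally show ?thesis .
  next
    case 3
    have "Qop (\<lambda>z. gk i n z w) x \<le> (\<Sum>z\<in>nbs x. CT * (if L x \<le> L z then Q x z * \<psi> \<eta> (L x) w z else 0))"
      unfolding Qop_def
    proof (intro sum_mono)
      fix z assume z: "z \<in> nbs x"
      show "Q x z * gk i n z w \<le> CT * (if L x \<le> L z then Q x z * \<psi> \<eta> (L x) w z else 0)"
        using mult_left_mono[OF Suc[of z] Q_nonneg[OF z]] 3 by (auto simp: gk_eq_0 mult_ac)
    qed
    also have "\<dots> = CT * (\<Sum>z\<in>nbs x. if L x \<le> L z then Q x z * \<psi> \<eta> (L x) w z else 0)"
      by (simp add: sum_distrib_left)
    also have "\<dots> \<le> CT * ((1 - \<delta>' / 2) * \<psi> \<eta> (L x) w x)"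
      using psi_killed[OF eta_pos, of x w] CT_pos by (intro mult_left_mono) auto
    finally have 1: "Qop (\<lambda>z. gk i n z w) x \<le> CT * \<psi> \<eta> i w x - CT * (\<delta>' / 2) * \<psi> \<eta> i w x"
      using 3 by (simp add: algebra_simps)
    have "of_bool (x = w) \<le> CT * (\<delta>' / 2) * \<psi> \<eta> i w x"
    proof (cases "x = w")
      case True
      have "Y w w \<le> (1 + A) * s ^ i" using D_self_le[of w] assms by (simp add: Y_def algebra_simps)
      then have "\<eta> / s ^ i * Y w w \<le> \<eta> / s ^ i * ((1 + A) * s ^ i)"
        using eta_pos s_pos by (intro mult_left_mono) auto
      also have "\<dots> = \<eta> * (1 + A)" using s_pos by simp
      finally have "exp (- (\<eta> * (1 + A))) \<le> \<psi> \<eta> i w x" using True by (simp add: \<psi>_def)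
      then have "CT * (\<delta>' / 2) * exp (- (\<eta> * (1 + A))) \<le> CT * (\<delta>' / 2) * \<psi> \<eta> i w x"
        using CT_pos delta'_pos by (intro mult_left_mono) auto
      moreover have "CT * (\<delta>' / 2) * exp (- (\<eta> * (1 + A))) = 1"
        using delta'_pos by (simp add: CT_def flip: exp_add)
      ultimately show ?thesis using True by simp
    next
      case False
      then show ?thesis using CT_pos delta'_pos psi_pos[of \<eta> i w x] by simp
    qed
    then show ?thesis using 1 3 by (simp add: gk_Suc)
  qed
qed

section \<open>Growth of the cell measures\<close>

lemma M_par_ge: "M x \<le> M (par x)"
proof (cases "x = \<theta>")
  case False
  then have "M x \<le> sum M (children (par x))"
    using finite_children M_pos by (intro member_le_sum) (auto simp: children_def less_imp_le)
  then show ?thesis by (simp flip: M_children)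
qed simp

lemma M_up: "M x \<le> M (up t x)" "M (up t x) \<le> \<Lambda> ^ t * M x"
proof -
  show "M x \<le> M (up t x)" by (induction t) (auto simp: up_Suc intro: order_trans M_par_ge)
  show "M (up t x) \<le> \<Lambda> ^ t * M x"
  proof (induction t)
    case (Suc t)
    have "M (up (Suc t) x) \<le> \<Lambda> * M (up t x)" by (simp add: up_Suc M_par)
    also have "\<dots> \<le> \<Lambda> * (\<Lambda> ^ t * M x)" using Suc Lam_ge by (intro mult_left_mono) auto
    finally show ?case by (simp add: mult.assoc)
  qed simp
qed

lemma M_adj: "adj x y \<Longrightarrow> M x \<le> \<Lambda> * M y"
  using M_H Lam_ge M_pos[of x] by (auto simp: adj_def)

lemma M_anc_anc:
  assumes "j \<le> k" "k \<le> L x"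
  shows "M (anc k x) \<le> M (anc j x)" "M (anc j x) \<le> \<Lambda> ^ (k - j) * M (anc k x)"
proof -
  have "anc j x = up (k - j) (anc k x)" using assms by (simp add: anc_def up_up)
  then show "M (anc k x) \<le> M (anc j x)" "M (anc j x) \<le> \<Lambda> ^ (k - j) * M (anc k x)"
    using M_up by metis+
qed

text \<open>Polynomial volume growth. Passing from \<open>y\<close> to \<open>x\<close> through the
  level \<open>k = J x y\<close> costs about \<open>\<Lambda> ^ (i - k)\<close> for
  \<open>i = L x\<close>, while \<open>D x y / s ^ i\<close> is at least a multiple of
  \<open>(1 / s) ^ (i - k)\<close>, so its exponential wins.\<close>

lemma M_growth:
  assumes "0 < e"
  shows "\<exists>C>0. \<forall>x y. L x \<le> L y \<longrightarrow> M (anc (L x) y) \<le> C * exp (e / s ^ L x * D x y) * M x"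
proof -
  obtain C where C: "C > 0" "\<And>t. \<Lambda> ^ t \<le> C * exp (e * s ^ Suc (2 * m) * (1 / s) ^ t)"
    using power_le_exp_power[of \<Lambda> "e * s ^ Suc (2 * m)" "1 / s"] Lam_ge assms s_pos s_lt_1 by auto
  show ?thesis
  proof (intro exI[of _ "\<Lambda> * C"] conjI allI impI)
    fix x y assume le: "L x \<le> L y"
    define i k where "i = L x" and "k = J x y"
    have k: "k \<le> i" "i \<le> L y" using le J_le[of x y] by (auto simp: i_def k_def)
    have a: "adj (anc k y) (anc k x)" using near_J[of x y] by (auto simp: k_def near_def adj_sym)
    have "M (anc i y) \<le> M (anc k y)" using k by (intro M_anc_anc)
    also have "\<dots> \<le> \<Lambda> * M (anc k x)" using a by (rule M_adj)
    also have "\<dots> \<le> \<Lambda> * (\<Lambda> ^ (i - k) * M (anc i x))"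
      using k Lam_ge by (intro mult_left_mono M_anc_anc) (auto simp: i_def)
    also have "anc i x = x" by (simp add: i_def)
    also have "\<Lambda> * (\<Lambda> ^ (i - k) * M x) \<le> \<Lambda> * ((C * exp (e / s ^ i * D x y)) * M x)"
    proof (intro mult_left_mono mult_right_mono)
      have "\<not> near (Suc k) x y" by (simp add: near_iff_J k_def)
      then have "s ^ (Suc k + 2 * m) \<le> D x y" by (rule D_ge_not_near)
      then have "e / s ^ i * s ^ (Suc k + 2 * m) \<le> e / s ^ i * D x y"
        using assms s_pos by (intro mult_left_mono) auto
      moreover have "e / s ^ i * s ^ (Suc k + 2 * m) = e * s ^ Suc (2 * m) * (1 / s) ^ (i - k)"
      proof -
        have "s ^ i = s ^ (i - k) * s ^ k" using k by (simp flip: power_add)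
        then show ?thesis using s_pos by (simp add: power_add power_one_over field_simps)
      qed
      ultimately have "exp (e * s ^ Suc (2 * m) * (1 / s) ^ (i - k)) \<le> exp (e / s ^ i * D x y)" by simp
      then show "\<Lambda> ^ (i - k) \<le> C * exp (e / s ^ i * D x y)"
        using C(1) C(2)[of "i - k"] by (smt (verit) mult_left_mono)
    qed (use Lam_ge M_pos[of x] in auto)
    finally show "M (anc (L x) y) \<le> \<Lambda> * C * exp (e / s ^ L x * D x y) * M x"
      by (simp add: i_def mult.assoc)
  qed (use C Lam_ge in auto)
qed

end

section \<open>Two-sided Green function estimates and a Harnack inequality\<close>

context natural_walk
begin

lemma mh_anc_le:
  assumes "i \<le> L y" "k \<le> L y"
  shows "i \<le> k \<Longrightarrow> mh (anc k y) \<le> \<Lambda>1 * l ^ (k - i) * mh (anc i y)"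
    and "k \<le> i \<Longrightarrow> mh (anc k y) \<le> \<Lambda>1 * (\<Lambda> / l) ^ (i - k) * mh (anc i y)"
proof -
  have k: "mh (anc k y) \<le> \<Lambda>1 * (l ^ k * M (anc k y))" using mh_le[of "anc k y"] assms by (simp add: L_anc)
  have i: "l ^ i * M (anc i y) \<le> mh (anc i y)" using mh_ge[of "anc i y"] assms by (simp add: L_anc)
  show "mh (anc k y) \<le> \<Lambda>1 * l ^ (k - i) * mh (anc i y)" if ik: "i \<le> k"
  proof -
    have "l ^ k * M (anc k y) \<le> l ^ k * M (anc i y)"
      using ik assms l_pos by (intro mult_left_mono M_anc_anc) auto
    also have "\<dots> = l ^ (k - i) * (l ^ i * M (anc i y))" using ik by (simp flip: power_add mult.assoc)
    also have "\<dots> \<le> l ^ (k - i) * mh (anc i y)" using i l_pos by (intro mult_left_mono) auto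
    finally have "\<Lambda>1 * (l ^ k * M (anc k y)) \<le> \<Lambda>1 * (l ^ (k - i) * mh (anc i y))"
      using Lam1_pos by (intro mult_left_mono) auto
    then show ?thesis using k by (simp add: mult.assoc)
  qed
  show "mh (anc k y) \<le> \<Lambda>1 * (\<Lambda> / l) ^ (i - k) * mh (anc i y)" if ki: "k \<le> i"
  proof -
    have "l ^ k * M (anc k y) \<le> l ^ k * (\<Lambda> ^ (i - k) * M (anc i y))"
      using ki assms l_pos by (intro mult_left_mono M_anc_anc) auto
    also have "\<dots> = (\<Lambda> / l) ^ (i - k) * (l ^ i * M (anc i y))"
    proof -
      have "l ^ i = l ^ (i - k) * l ^ k" using ki by (simp flip: power_add)
      then show ?thesis using l_pos by (simp add: power_divide)
    qed
    also have "\<dots> \<le> (\<Lambda> / l) ^ (i - k) * mh (anc i y)" using i l_pos Lam_ge by (intro mult_left_mono) auto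
    finally have "\<Lambda>1 * (l ^ k * M (anc k y)) \<le> \<Lambda>1 * ((\<Lambda> / l) ^ (i - k) * mh (anc i y))"
      using Lam1_pos by (intro mult_left_mono) auto
    then show ?thesis using k by (simp add: mult.assoc)
  qed
qed

text \<open>Each level is passed at the cost of a term \<open>\<psi>\<close>: the difference of two consecutive killed
  Green functions is harmonic below level \<open>i\<close>, and on level \<open>i\<close> it is controlled by reversibility.\<close>

lemma gk_level_bound:
  "\<exists>C>0. \<forall>i n x y. i \<le> L y \<longrightarrow>
     gk i n x y \<le> gk (Suc i) n x y + C * (mh y / mh (anc i y)) * \<psi> (\<eta> / 2) i y x"
proof -
  obtain C3 where C3: "C3 > 0"
    "\<And>x y. L x \<le> L y \<Longrightarrow> M (anc (L x) y) \<le> C3 * exp (\<eta> / 2 / s ^ L x * D x y) * M x"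
    using M_growth[of "\<eta> / 2"] eta_pos by auto
  \<comment> \<open>The factor \<open>exp (\<eta> / 2 * A)\<close> undoes the part
    \<open>A * s ^ i\<close> of \<open>Y y x\<close>.\<close>
  define C where "C = CT * \<Lambda>1 * C3 * exp (\<eta> / 2 * A)"
  have C_pos: "C > 0" using CT_pos Lam1_pos C3 by (simp add: C_def)
  \<comment> \<open>Here the source is on level \<open>i\<close>, not the target. After reversing
    time \<open>gk_le_psi\<close> applies, and half of its exponent is spent on replacing
    \<open>mh x\<close> by \<open>mh (anc i y)\<close>.\<close>
  have level: "gk i n x y \<le> C * (mh y / mh (anc i y)) * \<psi> (\<eta> / 2) i y x"
    if "L x = i" "i \<le> L y" for i n x y
  proof -
    define e where "e = exp (\<eta> / 2 / s ^ i * D x y)"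
    have e_pos: "0 < e" by (simp add: e_def)
    have "mh (anc i y) \<le> \<Lambda>1 * (l ^ i * M (anc i y))" using mh_le[of "anc i y"] that by (simp add: L_anc)
    also have "\<dots> \<le> \<Lambda>1 * (l ^ i * (C3 * e * M x))"
      using C3(2)[of x y] that Lam1_pos l_pos by (intro mult_left_mono) (auto simp: e_def)
    also have "\<dots> = \<Lambda>1 * C3 * e * (l ^ i * M x)" by simp
    also have "\<dots> \<le> \<Lambda>1 * C3 * e * mh x"
      using mh_ge[of x] that Lam1_pos C3(1) e_pos by (intro mult_left_mono) auto
    finally have "1 / mh x \<le> \<Lambda>1 * C3 * e / mh (anc i y)"
      using mh_pos[of x] mh_pos[of "anc i y"] by (simp add: field_simps)
    then have mh: "mh y / mh x \<le> mh y * (\<Lambda>1 * C3 * e / mh (anc i y))"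
      using mh_pos[of y] mult_left_mono[of "1 / mh x" "\<Lambda>1 * C3 * e / mh (anc i y)" "mh y"] by simp
    have "\<psi> \<eta> i x y \<le> exp (- (\<eta> / s ^ i * D x y))"
      using eta_pos s_pos A_pos by (simp add: \<psi>_def Y_def D_sym[of y x] field_simps)
    also have "\<eta> / s ^ i * D x y = \<eta> / 2 / s ^ i * D x y + \<eta> / 2 / s ^ i * D x y"
      using s_pos by (simp add: field_simps)
    also have "exp (- (\<eta> / 2 / s ^ i * D x y + \<eta> / 2 / s ^ i * D x y)) = inverse e * inverse e"
      by (simp only: minus_add_distrib exp_add exp_minus e_def)
    finally have psi: "\<psi> \<eta> i x y \<le> inverse e * inverse e" .
    have psi2: "\<psi> (\<eta> / 2) i y x = inverse e * exp (- (\<eta> / 2 * A))"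
      using s_pos that by (simp add: \<psi>_def Y_def e_def algebra_simps flip: exp_add exp_minus)
    have "gk i n x y = mh y / mh x * gk i n y x"
      using mh_gk_sym[of x i n y] mh_pos[of x] by (simp add: field_simps)
    also have "\<dots> \<le> mh y / mh x * (CT * \<psi> \<eta> i x y)"
      using gk_le_psi[OF that(1), of n y] mh_pos[of x] mh_pos[of y] by (intro mult_left_mono) auto
    also have "\<dots> \<le> mh y * (\<Lambda>1 * C3 * e / mh (anc i y)) * (CT * (inverse e * inverse e))"
      using mh psi CT_pos Lam1_pos C3(1) e_pos mh_pos[of y] mh_pos[of "anc i y"] psi_pos[of \<eta> i x y]
      by (intro mult_mono mult_left_mono) (auto intro!: mult_nonneg_nonneg divide_nonneg_nonneg simp: less_imp_le)
    also have "\<dots> = C * (mh y / mh (anc i y)) * \<psi> (\<eta> / 2) i y x"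
      unfolding psi2 C_def exp_minus using e_pos by (simp add: field_simps)
    finally show ?thesis .
  qed
  have "gk i n x y \<le> gk (Suc i) n x y + C * (mh y / mh (anc i y)) * \<psi> (\<eta> / 2) i y x"
    if i: "i \<le> L y" for i n x y
  proof (induction n arbitrary: x)
    case 0
    show ?case using C_pos psi_pos[of "\<eta> / 2" i y x] mh_pos[of y] mh_pos[of "anc i y"] by simp
  next
    case (Suc n)
    define K where "K = C * (mh y / mh (anc i y))"
    have K_pos: "K > 0" using C_pos mh_pos[of y] mh_pos[of "anc i y"] by (simp add: K_def)
    note IH = Suc[folded K_def]
    consider "L x < i" | "L x = i" | "i < L x" by linarith
    then show ?case unfolding K_def[symmetric]
    proof cases
      case 1
      then show "gk i (Suc n) x y \<le> gk (Suc i) (Suc n) x y + K * \<psi> (\<eta> / 2) i y x"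
        using K_pos psi_pos[of "\<eta> / 2" i y x] by (simp add: gk_eq_0)
    next
      case 2
      then show "gk i (Suc n) x y \<le> gk (Suc i) (Suc n) x y + K * \<psi> (\<eta> / 2) i y x"
        using level[OF 2 i, of "Suc n"] gk_nonneg[of "Suc i" "Suc n" x y] by (simp add: K_def)
    next
      case 3
      then have "gk i (Suc n) x y = of_bool (x = y) + Qop (\<lambda>z. gk i n z y) x" by (simp add: gk_Suc)
      also have "\<dots> \<le> of_bool (x = y) + Qop (\<lambda>z. gk (Suc i) n z y + K * \<psi> (\<eta> / 2) i y z) x"
        by (intro add_left_mono Qop_mono IH)
      also have "\<dots> = gk (Suc i) (Suc n) x y + K * Qop (\<psi> (\<eta> / 2) i y) x"
        using 3 by (simp add: gk_Suc Qop_add Qop_cmult)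
      also have "\<dots> \<le> gk (Suc i) (Suc n) x y + K * \<psi> (\<eta> / 2) i y x"
        using psi_super[OF 3, of "\<eta> / 2" y] eta_pos K_pos by (intro add_left_mono mult_left_mono) auto
      finally show "gk i (Suc n) x y \<le> gk (Suc i) (Suc n) x y + K * \<psi> (\<eta> / 2) i y x" .
    qed
  qed
  then show ?thesis using C_pos by blast
qed

text \<open>Killing above level \<open>L y + 1\<close> leaves nothing, so the bounds for single
  levels telescope. Seen from \<open>k = J x y\<close>, the terms decay like
  \<open>l ^ (k - i)\<close> for \<open>i \<le> k\<close> because of \<open>mh\<close>, and
  geometrically for \<open>i > k\<close> because there \<open>\<psi>\<close> beats the growth of
  \<open>1 / mh (anc i y)\<close>.\<close>

lemma gk_upper: "\<exists>C>0. \<forall>n x y. gk 0 n x y \<le> C * (mh y / mh (anc (J x y) y))"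
proof -
  obtain C where C: "C > 0"
    "\<And>i n x y. i \<le> L y \<Longrightarrow>
       gk i n x y \<le> gk (Suc i) n x y + C * (mh y / mh (anc i y)) * \<psi> (\<eta> / 2) i y x"
    using gk_level_bound by blast
  \<comment> \<open>The base is twice the possible growth of \<open>1 / mh (anc i y)\<close> per
    level, which leaves a factor \<open>1 / 2\<close> per level.\<close>
  obtain C' where C': "C' > 0"
    "\<And>t. (2 * \<Lambda> / l) ^ t \<le> C' * exp (\<eta> / 2 * s ^ Suc (2 * m) * (1 / s) ^ t)"
    using power_le_exp_power[of "2 * \<Lambda> / l" "\<eta> / 2 * s ^ Suc (2 * m)" "1 / s"]
      Lam_ge l_pos eta_pos s_pos s_lt_1 by auto
  define \<rho> where "\<rho> = max l (1 / 2)"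
  have rho: "0 < \<rho>" "\<rho> < 1" using l_pos l_lt_1 by (auto simp: \<rho>_def)
  define B where "B = max 1 C'"
  have B: "1 \<le> B" "C' \<le> B" by (auto simp: B_def)
  have main: "gk 0 n x y \<le> C * \<Lambda>1 * B * (2 / (1 - \<rho>)) * (mh y / mh (anc (J x y) y))" for n x y
  proof -
    define k where "k = J x y"
    have k: "k \<le> L y" using J_le[of x y] by (simp add: k_def)
    have tele: "gk 0 n x y \<le> gk N n x y + (\<Sum>i<N. C * (mh y / mh (anc i y)) * \<psi> (\<eta> / 2) i y x)"
      if "N \<le> Suc (L y)" for N
      using that
    proof (induction N)
      case (Suc N)
      then show ?case using C(2)[of N y n x] by simp
    qed simp
    have summand: "C * (mh y / mh (anc i y)) * \<psi> (\<eta> / 2) i y x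
        \<le> C * \<Lambda>1 * B * (mh y / mh (anc k y)) * \<rho> ^ (if i \<le> k then k - i else i - k)" if i: "i \<le> L y" for i
    proof -
      have "mh (anc k y) * \<psi> (\<eta> / 2) i y x
          \<le> \<Lambda>1 * B * \<rho> ^ (if i \<le> k then k - i else i - k) * mh (anc i y)"
      proof (cases "i \<le> k")
        case True
        have "\<psi> (\<eta> / 2) i y x \<le> 1"
          using eta_pos s_pos A_pos D_nonneg[of x y] by (simp add: \<psi>_def Y_def)
        then have "mh (anc k y) * \<psi> (\<eta> / 2) i y x \<le> mh (anc k y) * 1"
          using mh_pos[of "anc k y"] by (intro mult_left_mono) auto
        also have "\<dots> \<le> \<Lambda>1 * l ^ (k - i) * mh (anc i y)" using mh_anc_le(1)[OF i k True] by simp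
        also have "\<dots> \<le> (\<Lambda>1 * B) * \<rho> ^ (k - i) * mh (anc i y)"
          using B Lam1_pos l_pos mh_pos[of "anc i y"]
          by (intro mult_right_mono mult_mono power_mono) (auto simp: \<rho>_def)
        finally show ?thesis using True by simp
      next
        case False
        have "\<not> near (Suc k) x y" by (simp add: near_iff_J k_def)
        then have "s ^ (Suc k + 2 * m) \<le> D x y" by (rule D_ge_not_near)
        also have "D x y \<le> Y y x" using A_pos s_pos by (simp add: Y_def)
        finally have "\<eta> / 2 / s ^ i * s ^ (Suc k + 2 * m) \<le> \<eta> / 2 / s ^ i * Y y x"
          using eta_pos s_pos by (intro mult_left_mono) auto
        moreover have "\<eta> / 2 / s ^ i * s ^ (Suc k + 2 * m) = \<eta> / 2 * s ^ Suc (2 * m) * (1 / s) ^ (i - k)"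
        proof -
          have "s ^ i = s ^ (i - k) * s ^ k" using False by (simp flip: power_add)
          then show ?thesis using s_pos by (simp add: power_add power_one_over field_simps)
        qed
        ultimately have "\<psi> (\<eta> / 2) i y x \<le> inverse (exp (\<eta> / 2 * s ^ Suc (2 * m) * (1 / s) ^ (i - k)))"
          by (simp add: \<psi>_def flip: exp_minus)
        also have "\<dots> \<le> C' / (2 * \<Lambda> / l) ^ (i - k)"
          using C'(2)[of "i - k"] C'(1) Lam_ge l_pos by (simp add: field_simps)
        finally have psi: "\<psi> (\<eta> / 2) i y x \<le> C' / (2 * \<Lambda> / l) ^ (i - k)" .
        have "mh (anc k y) * \<psi> (\<eta> / 2) i y x
            \<le> (\<Lambda>1 * (\<Lambda> / l) ^ (i - k) * mh (anc i y)) * (C' / (2 * \<Lambda> / l) ^ (i - k))"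
          using psi mh_anc_le(2)[OF i k] False Lam1_pos Lam_ge l_pos psi_pos mh_pos
          by (intro mult_mono) (auto intro!: mult_nonneg_nonneg simp: less_imp_le)
        also have "\<dots> = \<Lambda>1 * C' * (1 / 2) ^ (i - k) * mh (anc i y)"
        proof -
          have "(2 * \<Lambda> / l) ^ (i - k) = 2 ^ (i - k) * (\<Lambda> / l) ^ (i - k)"
            by (simp add: power_mult_distrib flip: times_divide_eq_right)
          then show ?thesis using Lam_ge l_pos by (simp add: power_one_over field_simps)
        qed
        also have "\<dots> \<le> \<Lambda>1 * B * \<rho> ^ (i - k) * mh (anc i y)"
          using B C'(1) Lam1_pos mh_pos[of "anc i y"]
          by (intro mult_right_mono mult_mono power_mono) (auto simp: \<rho>_def)
        finally show ?thesis using False by simp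
      qed
      then have "\<psi> (\<eta> / 2) i y x / mh (anc i y)
          \<le> \<Lambda>1 * B * \<rho> ^ (if i \<le> k then k - i else i - k) / mh (anc k y)"
        using mh_pos[of "anc i y"] mh_pos[of "anc k y"] by (simp add: field_simps)
      then have "(C * mh y) * (\<psi> (\<eta> / 2) i y x / mh (anc i y))
          \<le> (C * mh y) * (\<Lambda>1 * B * \<rho> ^ (if i \<le> k then k - i else i - k) / mh (anc k y))"
        using C(1) mh_pos[of y] by (intro mult_left_mono) auto
      then show ?thesis by (simp add: mult_ac)
    qed
    have "gk 0 n x y \<le> (\<Sum>i<Suc (L y). C * (mh y / mh (anc i y)) * \<psi> (\<eta> / 2) i y x)"
      using tele[of "Suc (L y)"] by (simp add: gk_eq_0')
    also have "\<dots> \<le> (\<Sum>i<Suc (L y). C * \<Lambda>1 * B * (mh y / mh (anc k y)) * \<rho> ^ (if i \<le> k then k - i else i - k))"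
      by (intro sum_mono summand) auto
    also have "\<dots> = C * \<Lambda>1 * B * (mh y / mh (anc k y)) * (\<Sum>i\<le>L y. \<rho> ^ (if i \<le> k then k - i else i - k))"
      by (simp add: sum_distrib_left lessThan_Suc_atMost del: sum.lessThan_Suc)
    also have "\<dots> \<le> C * \<Lambda>1 * B * (mh y / mh (anc k y)) * (2 / (1 - \<rho>))"
      using sum_geometric_dist_le[OF rho] C(1) Lam1_pos B mh_pos[of y] mh_pos[of "anc k y"]
      by (intro mult_left_mono) auto
    finally show ?thesis by (simp add: k_def mult_ac)
  qed
  show ?thesis
    by (rule exI[of _ "C * \<Lambda>1 * B * (2 / (1 - \<rho>))"]) (use main C(1) Lam1_pos B rho in auto)
qed

section \<open>The Green function of the transformed walk and the minimum principle\<close>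

definition Gh :: "'a \<Rightarrow> 'a \<Rightarrow> real" where "Gh x y = lim (\<lambda>n. gk 0 n x y)"

lemma gk_mono: "n \<le> n' \<Longrightarrow> gk i n x y \<le> gk i n' x y"
  unfolding gk_def by (intro sum_mono2) (auto simp: qk_nonneg)

lemma gk_tendsto: "(\<lambda>n. gk 0 n x y) \<longlonglongrightarrow> Gh x y"
proof -
  obtain C where C: "\<And>n x y. gk 0 n x y \<le> C * (mh y / mh (anc (J x y) y))" using gk_upper by blast
  have "convergent (\<lambda>n. gk 0 n x y)"
    by (rule Bseq_mono_convergent, rule BseqI'[of _ "C * (mh y / mh (anc (J x y) y))"])
      (use C[of _ x y] in \<open>auto simp: gk_nonneg gk_mono\<close>)
  then show ?thesis by (simp add: Gh_def convergent_LIMSEQ_iff)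
qed

lemma gk_le_Gh: "gk 0 n x y \<le> Gh x y"
  using gk_tendsto by (rule incseq_le[rotated]) (simp add: incseq_def gk_mono)

lemma Gh_upper: "\<exists>C>0. \<forall>x y. Gh x y \<le> C * (mh y / mh (anc (J x y) y))"
  using gk_upper gk_tendsto LIMSEQ_le_const2 by meson

lemma Gh_nonneg: "0 \<le> Gh x y"
  using gk_le_Gh[of 0 x y] by simp

lemma Qop_tendsto:
  assumes "\<And>z. (\<lambda>n. f n z) \<longlonglongrightarrow> g z" shows "(\<lambda>n. Qop (f n) x) \<longlonglongrightarrow> Qop g x"
  unfolding Qop_def by (intro tendsto_sum tendsto_mult tendsto_const assms)

lemma Gh_rec: "Gh x y = of_bool (x = y) + Qop (\<lambda>z. Gh z y) x"
proof -
  have "(\<lambda>n. of_bool (x = y) + Qop (\<lambda>z. gk 0 n z y) x) \<longlonglongrightarrow> of_bool (x = y) + Qop (\<lambda>z. Gh z y) x"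
    by (intro tendsto_add tendsto_const Qop_tendsto gk_tendsto)
  moreover have "(\<lambda>n. gk 0 (Suc n) x y) \<longlonglongrightarrow> Gh x y" using gk_tendsto by (rule LIMSEQ_Suc)
  ultimately show ?thesis by (simp add: gk_Suc LIMSEQ_unique)
qed

lemma Gh_super: "Qop (\<lambda>z. Gh z y) x \<le> Gh x y"
  using Gh_rec[of x y] by (auto simp: of_bool_def split: if_splits)

lemma Gh_harmonic: "x \<noteq> y \<Longrightarrow> Qop (\<lambda>z. Gh z y) x = Gh x y"
  using Gh_rec[of x y] by simp

lemma Gh_self_ge: "1 \<le> Gh y y"
  using gk_le_Gh[of 1 y y] by (simp add: gk_Suc Qop_def)

lemma mh_Gh_sym: "mh x * Gh x y = mh y * Gh y x"
proof -
  have "(\<lambda>n. mh x * gk 0 n x y) \<longlonglongrightarrow> mh x * Gh x y" "(\<lambda>n. mh y * gk 0 n y x) \<longlonglongrightarrow> mh y * Gh y x"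
    by (intro tendsto_mult tendsto_const gk_tendsto)+
  then show ?thesis by (simp add: mh_gk_sym[of x] LIMSEQ_unique)
qed

text \<open>The drift brings the walk to level \<open>n\<close>. Analytically, the unbounded
  function \<open>b = r ^ L\<close> satisfies \<open>Qop b \<le> q * b\<close> with
  \<open>q < 1\<close>, so the lower bound \<open>- K * b\<close> improves to
  \<open>- (K * q ^ t) * b\<close> for every \<open>t\<close>.\<close>

lemma min_principle:
  assumes super: "\<And>x. n < L x \<Longrightarrow> Qop f x \<le> f x"
    and bd: "\<And>x. L x = n \<Longrightarrow> 0 \<le> f x" and lower: "\<And>x. n \<le> L x \<Longrightarrow> - K \<le> f x"
    and K: "0 \<le> K" and x: "n \<le> L x"
  shows "0 \<le> f x"
proof -
  \<comment> \<open>Halfway, geometrically, between \<open>1\<close> and \<open>1 / l\<close>: one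
    step then multiplies \<open>b\<close> in mean by exactly
    \<open>1 - \<kappa> z * (r - 1) ^ 2\<close>.\<close>
  define r where "r = 1 / sqrt l"
  have r: "1 < r" "r * r = 1 / l" using l_pos l_lt_1 by (auto simp: r_def)
  define b where "b z = r ^ L z" for z
  define q where "q = max (1 / 2) (1 - (r - 1)\<^sup>2 / \<Lambda>1)"
  have q: "0 < q" "q < 1" using r Lam1_pos by (auto simp: q_def)
  have Qb: "Qop b z \<le> q * b z" if nz: "z \<noteq> \<theta>" for z
  proof -
    obtain j where j: "L z = Suc j" using L_Suc[OF nz] by auto
    have "Qop b z = \<kappa> z / l * r ^ j + \<kappa> z * r ^ Suc (Suc j) + (1 - \<kappa> z - \<kappa> z / l) * r ^ Suc j"
      unfolding Qop_def b_def Q_level[OF nz, of "\<lambda>n. r ^ n"] by (simp add: j)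
    also have "\<kappa> z / l = \<kappa> z * (r * r)" by (simp add: r(2))
    also have "\<kappa> z * (r * r) * r ^ j + \<kappa> z * r ^ Suc (Suc j) + (1 - \<kappa> z - \<kappa> z * (r * r)) * r ^ Suc j
        = (1 - \<kappa> z * (r - 1)\<^sup>2) * r ^ Suc j"
      by (simp add: power2_eq_square algebra_simps)
    also have "\<dots> \<le> q * r ^ Suc j"
    proof (intro mult_right_mono)
      have "(r - 1)\<^sup>2 * (1 / \<Lambda>1) \<le> (r - 1)\<^sup>2 * \<kappa> z" using kappa_ge by (intro mult_left_mono) auto
      then show "1 - \<kappa> z * (r - 1)\<^sup>2 \<le> q" by (simp add: q_def mult.commute)
    qed (use r in auto)
    finally show ?thesis unfolding b_def[of z] j .
  qed
  have iter: "- (K * q ^ t) * b z \<le> f z" if "n \<le> L z" for t z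
    using that
  proof (induction t arbitrary: z)
    case 0
    have "1 \<le> b z" using r by (simp add: b_def)
    then have "K * 1 \<le> K * b z" using K by (intro mult_left_mono) auto
    then show ?case using lower[OF 0] by simp
  next
    case (Suc t)
    show ?case
    proof (cases "L z = n")
      case True
      then show ?thesis using bd[OF True] K q r
        by (smt (verit) b_def mult_minus_left mult_nonneg_nonneg zero_le_power)
    next
      case False
      then have z: "n < L z" "z \<noteq> \<theta>" using Suc.prems by auto
      have "- (K * q ^ Suc t) * b z = - (K * q ^ t) * (q * b z)" by simp
      also have "\<dots> \<le> - (K * q ^ t) * Qop b z"
        using Qb[OF z(2)] K q by (intro mult_left_mono_neg) auto
      also have "\<dots> = Qop (\<lambda>w. - (K * q ^ t) * b w) z" by (simp only: Qop_cmult)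
      also have "\<dots> \<le> Qop f z"
      proof (rule Qop_mono, rule Suc.IH)
        fix w assume "w \<in> nbs z"
        then show "n \<le> L w" using E_lev[of z w] z by (simp add: nbs_def)
      qed
      also have "\<dots> \<le> f z" using z(1) by (rule super)
      finally show ?thesis .
    qed
  qed
  have "(\<lambda>t. - (K * q ^ t) * b x) \<longlonglongrightarrow> - (K * 0) * b x"
    using q by (intro tendsto_intros LIMSEQ_power_zero) auto
  then show ?thesis using iter[OF x] by (intro LIMSEQ_le_const2[of _ _ "f x"]) auto
qed

section \<open>The Harnack inequality and the lower bound\<close>

lemma delta_le_1: "\<delta> \<le> 1"
proof -
  obtain z where z: "z \<in> children \<theta>"
    using M_children[of \<theta>] M_pos[of \<theta>] by fastforce
  then have E: "(\<theta>, z) \<in> E" by (auto simp: children_def E_def parent_edges_def)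
  have "\<delta> \<le> Q \<theta> z" using E by (rule Q_ge)
  also have "\<dots> \<le> sum (Q \<theta>) (nbs \<theta>)"
    using E finite_nbs Q_nonneg by (intro member_le_sum) (auto simp: nbs_def)
  also have "\<dots> \<le> 1" by (rule sum_Q_le)
  finally show ?thesis .
qed

lemma super_step:
  assumes "(z, z') \<in> E" "\<And>w. w \<in> nbs z \<Longrightarrow> 0 \<le> f w" "Qop f z \<le> f z"
  shows "\<delta> * f z' \<le> f z"
proof -
  have z': "z' \<in> nbs z" using assms by (simp add: nbs_def)
  have "\<delta> * f z' \<le> Q z z' * f z'" using Q_ge[OF assms(1)] assms(2)[OF z'] by (intro mult_right_mono) auto
  also have "\<dots> \<le> Qop f z"
    unfolding Qop_def using z' finite_nbs Q_nonneg assms(2) by (intro member_le_sum) auto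
  finally show ?thesis using assms(3) by simp
qed

text \<open>Vertices on level \<open>n\<close> at distance less than \<open>R * s ^ n\<close> from
  \<open>w\<close> are joined to it by boundedly many edges climbing at most \<open>a\<close>
  levels, so ellipticity bounds \<open>f\<close> from below there. Deeper vertices are reached by
  the minimum principle, applied to \<open>f\<close> and a barrier made from
  \<open>D _ w - A * s ^ L\<close>. The extra \<open>Suc\<close> includes the neighbours of all
  vertices at which \<open>f\<close> is superharmonic.\<close>

lemma harnack:
  assumes "0 < R0"
  shows "\<exists>c>0. \<exists>a. \<forall>f n w y. (\<forall>z. n \<le> Suc (L z + a) \<longrightarrow> 0 \<le> f z) \<longrightarrow> (\<forall>z. n \<le> L z + a \<longrightarrow> Qop f z \<le> f z) \<longrightarrow>
     L w = n \<longrightarrow> n \<le> L y \<longrightarrow> D y w \<le> R0 * s ^ n \<longrightarrow> c * f w \<le> f y"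
proof -
  \<comment> \<open>The factor \<open>2\<close> makes \<open>v y \<le> 1 / 2\<close> for the
    function \<open>v\<close> below.\<close>
  define R where "R = 2 * (R0 + A)"
  have R: "0 < R" using assms A_pos by (simp add: R_def)
  obtain p where p: "R < (1 / s) ^ p" using real_arch_pow[of "1 / s" R] s_pos s_lt_1 by auto
  \<comment> \<open>For \<open>a \<le> n\<close> this gives
    \<open>R * s ^ n \<le> s ^ (n - a + 2 * m)\<close>, the threshold of
    \<open>near_of_D_less\<close> at level \<open>n - a\<close>.\<close>
  define a where "a = p + 2 * m"
  \<comment> \<open>At most \<open>a\<close> edges up, one across and \<open>a\<close> down, each at
    the price \<open>\<delta>\<close>.\<close>
  define c where "c = \<delta> ^ (2 * a + 1)"
  have c_pos: "0 < c" using delta_pos by (simp add: c_def)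
  have main: "c / 2 * f w \<le> f y"
    if nonneg: "\<And>z. n \<le> Suc (L z + a) \<Longrightarrow> 0 \<le> f z"
      and super: "\<And>z. n \<le> L z + a \<Longrightarrow> Qop f z \<le> f z"
      and w: "L w = n" and y: "n \<le> L y" "D y w \<le> R0 * s ^ n" for f n w y
  proof -
    have step: "\<delta> * f z' \<le> f z" if "(z, z') \<in> E" "n \<le> L z + a" for z z'
    proof (rule super_step[OF that(1)])
      fix v assume "v \<in> nbs z"
      then have "L z \<le> Suc (L v)" using E_lev by (simp add: nbs_def)
      then show "0 \<le> f v" using nonneg that by simp
    qed (use super that in auto)
    have step_eq: "\<delta> * f z \<le> f z" if "n \<le> Suc (L z + a)" for z
      using nonneg[OF that] delta_le_1 by (simp add: mult_left_le_one_le delta_pos less_imp_le)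
    have up: "\<delta> ^ t * f (up t z) \<le> f z \<and> \<delta> ^ t * f z \<le> f (up t z)" if "L z = n" "t \<le> a" for t z
      using that(2)
    proof (induction t)
      case (Suc t)
      have lev: "n \<le> L (up (Suc t) z) + a" "n \<le> L (up t z) + a" using Suc that by auto
      have "\<delta> * f (up (Suc t) z) \<le> f (up t z) \<and> \<delta> * f (up t z) \<le> f (up (Suc t) z)"
      proof (cases "up t z = \<theta>")
        case True
        then show ?thesis using step_eq[of \<theta>] lev by (simp add: up_Suc)
      next
        case False
        then have "(up t z, up (Suc t) z) \<in> E" by (auto simp: up_Suc E_def parent_edges_def)
        then show ?thesis using step lev E_sym by blast
      qed
      then have "\<delta> ^ t * (\<delta> * f (up (Suc t) z)) \<le> \<delta> ^ t * f (up t z)"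
        "\<delta> * (\<delta> ^ t * f z) \<le> \<delta> * f (up t z)"
        using Suc delta_pos by (auto intro!: mult_left_mono)
      then show ?case using Suc \<open>_ \<and> _\<close> by (simp add: mult.assoc mult.left_commute)
    qed simp
    define K where "K = c * f w"
    have K: "0 \<le> K" using nonneg[of w] w c_pos by (simp add: K_def)
    have close: "K \<le> f z" if z: "L z = n" "D z w < R * s ^ n" for z
    proof -
      have near: "near (n - a) z w"
      proof (cases "a \<le> n")
        case True
        have "s ^ n = s ^ (n - a + 2 * m) * s ^ p" using True by (simp add: a_def flip: power_add)
        then have "R * s ^ n = s ^ (n - a + 2 * m) * (R * s ^ p)" by simp
        also have "\<dots> \<le> s ^ (n - a + 2 * m) * 1"
          using p s_pos by (intro mult_left_mono) (auto simp: power_one_over field_simps)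
        finally show ?thesis using z by (intro near_of_D_less) auto
      qed simp
      define t where "t = n - (n - a)"
      have t: "t \<le> a" by (simp add: t_def)
      have anc: "anc (n - a) z = up t z" "anc (n - a) w = up t w" using z w by (auto simp: anc_def t_def)
      have adj: "adj (up t z) (up t w)" using near by (simp add: near_def anc)
      have "\<delta> * f (up t w) \<le> f (up t z)"
      proof (cases "up t z = up t w")
        case True
        then show ?thesis using step_eq[of "up t w"] w t by simp
      next
        case False
        then have "(up t z, up t w) \<in> E" using adj by (simp add: adj_def E_def)
        then show ?thesis using step z t by simp
      qed
      then have "\<delta> ^ t * (\<delta> * f (up t w)) \<le> \<delta> ^ t * f (up t z)"
        using delta_pos by (intro mult_left_mono) auto
      also have "\<dots> \<le> f z" using up[OF z(1) t] by simp
      finally have 1: "\<delta> ^ t * \<delta> * f (up t w) \<le> f z" by (simp add: mult.assoc)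
      have "\<delta> ^ (2 * t + 1) = \<delta> ^ t * \<delta> * \<delta> ^ t" by (simp add: mult_2 power_add)
      then have "\<delta> ^ (2 * t + 1) * f w = \<delta> ^ t * \<delta> * (\<delta> ^ t * f w)" by (simp only: mult.assoc)
      also have "\<dots> \<le> \<delta> ^ t * \<delta> * f (up t w)"
        using up[OF w t] delta_pos by (intro mult_left_mono) auto
      finally have 2: "\<delta> ^ (2 * t + 1) * f w \<le> f z" using 1 by linarith
      have "c * f w \<le> \<delta> ^ (2 * t + 1) * f w"
        unfolding c_def using t delta_pos delta_le_1 nonneg[of w] w
        by (intro mult_right_mono power_decreasing) auto
      then show ?thesis using 2 by (simp add: K_def)
    qed
    \<comment> \<open>From level \<open>n\<close> on, the barrier \<open>1 - v\<close> is at most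
      \<open>1\<close>; on level \<open>n\<close> it is nonpositive at distance
      \<open>R * s ^ n\<close> or more from \<open>w\<close>. Off the root it is
      subharmonic.\<close>
    define v where "v z = (D z w + A * s ^ n - A * s ^ L z) / (R * s ^ n)" for z
    have v_nonneg: "0 \<le> v z" if "n \<le> L z" for z
      using s_power_mono[OF that] A_pos R s_pos D_nonneg[of z w]
      by (auto simp: v_def intro!: divide_nonneg_nonneg add_nonneg_nonneg)
        (smt (verit) mult_left_mono)
    have v_super: "Qop v z \<le> v z" if "z \<noteq> \<theta>" for z
    proof -
      have "Qop v z = Qop (\<lambda>z. 1 / (R * s ^ n) * ((D z w - A * s ^ L z) - (- A * s ^ n))) z"
        by (rule arg_cong[where f = "\<lambda>f. Qop f z"]) (simp add: v_def fun_eq_iff)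
      also have "\<dots> = 1 / (R * s ^ n) * (Qop (\<lambda>z. D z w - A * s ^ L z) z - (- A * s ^ n))"
        unfolding Qop_cmult Qop_diff[of "\<lambda>z. D z w - A * s ^ L z"] Qop_const[OF that] ..
      also have "\<dots> \<le> 1 / (R * s ^ n) * (D z w - A * s ^ L z - (- A * s ^ n))"
        using V_super[OF that, of w] R s_pos by (intro mult_left_mono) auto
      also have "\<dots> = v z" by (simp add: v_def)
      finally show ?thesis .
    qed
    have "0 \<le> f y - K * (1 - v y)"
    proof (rule min_principle[where n = n and K = K and f = "\<lambda>z. f z - K * (1 - v z)"])
      fix z assume z: "n < L z"
      then have nz: "z \<noteq> \<theta>" by auto
      have "K * (1 - v z) \<le> K * (1 - Qop v z)" using v_super[OF nz] K by (intro mult_left_mono) auto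
      then show "Qop (\<lambda>z. f z - K * (1 - v z)) z \<le> f z - K * (1 - v z)"
        using super[of z] z unfolding Qop_diff[of f] Qop_cmult Qop_diff[of "\<lambda>_. 1"] Qop_const[OF nz] by simp
    next
      fix z assume z: "L z = n"
      show "0 \<le> f z - K * (1 - v z)"
      proof (cases "D z w < R * s ^ n")
        case True
        have "K * (1 - v z) \<le> K * 1" using v_nonneg[of z] z K by (intro mult_left_mono) auto
        then show ?thesis using close[OF z True] by simp
      next
        case False
        then have "1 \<le> v z" using R s_pos z by (simp add: v_def field_simps)
        then have "K * (1 - v z) \<le> 0" using K by (simp add: mult_nonneg_nonpos)
        then show ?thesis using nonneg[of z] z by simp
      qed
    next
      fix z assume z: "n \<le> L z"
      have "K * (1 - v z) \<le> K * 1" using v_nonneg[OF z] K by (intro mult_left_mono) auto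
      then show "- K \<le> f z - K * (1 - v z)" using nonneg[of z] z by simp
    qed (use K y in auto)
    moreover have "v y \<le> 1 / 2"
    proof -
      have "D y w + A * s ^ n - A * s ^ L y \<le> R0 * s ^ n + A * s ^ n"
        using y A_pos s_pos by (smt (verit) mult_pos_pos zero_less_power)
      also have "\<dots> = 1 / 2 * (R * s ^ n)" by (simp add: R_def algebra_simps)
      finally show ?thesis using R s_pos by (simp add: v_def divide_le_eq)
    qed
    then have "K * (1 / 2) \<le> K * (1 - v y)" using K by (intro mult_left_mono) auto
    ultimately show ?thesis by (simp add: K_def)
  qed
  show ?thesis
    by (intro exI[of _ "c / 2"] conjI exI[of _ a] allI impI main) (use c_pos in auto)
qed

text \<open>The ancestor \<open>w\<close> of \<open>y\<close> on level \<open>J x y\<close> is near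
  both \<open>x\<close> and \<open>y\<close>. Harnack moves the source from \<open>x\<close> to
  \<open>w\<close>; reversibility turns \<open>Gh w y\<close> into \<open>Gh y w\<close>, and a
  second use of Harnack compares this with \<open>Gh w w \<ge> 1\<close>.\<close>

lemma Gh_lower: "\<exists>c>0. \<forall>x y. c * (mh y / mh (anc (J x y) y)) \<le> Gh x y"
proof -
  have "0 < 2 / (1 - s)" using s_lt_1 by simp
  from harnack[OF this] obtain c a where c: "c > 0"
    "\<And>f n w y. (\<And>z. n \<le> Suc (L z + a) \<Longrightarrow> 0 \<le> f z) \<Longrightarrow> (\<And>z. n \<le> L z + a \<Longrightarrow> Qop f z \<le> f z) \<Longrightarrow>
       L w = n \<Longrightarrow> n \<le> L y \<Longrightarrow> D y w \<le> 2 / (1 - s) * s ^ n \<Longrightarrow> c * f w \<le> f y"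
    by (metis (no_types, lifting))
  have G: "c * Gh w y \<le> Gh x y" if "near (L w) x w" for x w y
  proof (rule c(2)[where n = "L w" and f = "\<lambda>z. Gh z y"])
    show "D x w \<le> 2 / (1 - s) * s ^ L w" using D_le_near[OF that] by simp
  qed (use that Gh_nonneg Gh_super in \<open>auto simp: near_def\<close>)
  have "c * c * (mh y / mh (anc (J x y) y)) \<le> Gh x y" for x y
  proof -
    define w where "w = anc (J x y) y"
    have Lw: "L w = J x y" using J_le[of x y] by (simp add: w_def L_anc)
    have "near (L w) x w" unfolding Lw unfolding w_def using near_J[of x y] J_le[of x y] by (simp add: near_anc')
    then have 1: "c * Gh w y \<le> Gh x y" by (rule G)
    have "near (L w) y w" unfolding Lw unfolding w_def using J_le[of x y] by (simp add: near_anc' near_self)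
    then have "c * Gh w w \<le> Gh y w" by (rule G)
    moreover have "c * 1 \<le> c * Gh w w" using Gh_self_ge[of w] c(1) by (intro mult_left_mono) auto
    ultimately have "c \<le> Gh y w" by linarith
    then have "mh y / mh w * c \<le> mh y / mh w * Gh y w"
      using mh_pos[of y] mh_pos[of w] by (intro mult_left_mono) auto
    also have "\<dots> = Gh w y" using mh_Gh_sym[of w y] mh_pos[of w] by (simp add: field_simps)
    finally have "c * (mh y / mh w * c) \<le> c * Gh w y" using c(1) by (intro mult_left_mono) auto
    then show ?thesis using 1 by (simp add: w_def mult_ac)
  qed
  then show ?thesis using c(1) by (intro exI[of _ "c * c"]) auto
qed

end

section \<open>Oscillation decay and the Martin kernel\<close>

context aug_tree
begin

definition ray :: "(nat \<Rightarrow> 'x) \<Rightarrow> bool" where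
  "ray r \<longleftrightarrow> (\<forall>n. L (r n) = n \<and> par (r (Suc n)) = r n)"

lemma ray_L: "ray r \<Longrightarrow> L (r n) = n" by (simp add: ray_def)

lemma ray_anc: "ray r \<Longrightarrow> k \<le> n \<Longrightarrow> anc k (r n) = r k"
proof (induction n)
  case (Suc n)
  show ?case
  proof (cases "k = Suc n")
    case True
    then show ?thesis using anc_self[of "r k"] Suc.prems by (simp add: ray_L)
  next
    case False
    then have "anc k (r (Suc n)) = anc k (par (r (Suc n)))"
      using Suc.prems by (intro anc_par[symmetric]) (simp add: ray_L)
    then show ?thesis using Suc False by (simp add: ray_def)
  qed
qed (use anc_0[of "r 0"] anc_self[of "r 0"] in \<open>simp add: ray_L\<close>)

lemma near_ray: "ray r \<Longrightarrow> k \<le> n \<Longrightarrow> near k z (r n) \<longleftrightarrow> near k z (r k)"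
  using near_anc'[of k k "r n" z] by (simp add: ray_anc ray_L)

text \<open>Convergence to the boundary point of \<open>r\<close> in combinatorial form;
  \<open>visual_class_iff\<close> later identifies it with convergence in the visual metric.\<close>

definition tends_to_end :: "(nat \<Rightarrow> 'x) \<Rightarrow> (nat \<Rightarrow> 'x) \<Rightarrow> bool" where
  "tends_to_end t r \<longleftrightarrow> (\<forall>j. \<forall>\<^sub>F n in sequentially. near j (t n) (r j))"

lemma ray_near:
  assumes "ray r" "j \<le> n" shows "near j (r n) (r j)"
  using near_ray[OF assms, of "r j"] near_self[of j "r j"] assms by (simp add: ray_L near_sym)

lemma ray_tends_to_end: "ray r \<Longrightarrow> tends_to_end r r"
  unfolding tends_to_end_def by (blast intro: eventually_sequentiallyI ray_near)

end

context natural_walk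
begin

text \<open>The term \<open>B * \<epsilon>\<close> pays for the values of \<open>u\<close> outside
  the neighbourhood of the end, of which only \<open>0 \<le> u \<le> B\<close> is known. A larger
  \<open>N\<close> will buy a smaller \<open>\<epsilon>\<close>.\<close>

definition oscillation_reduces :: "real \<Rightarrow> real \<Rightarrow> nat \<Rightarrow> bool" where
  "oscillation_reduces \<omega> \<epsilon> N \<longleftrightarrow> (\<forall>u B r j a b.
     ray r \<longrightarrow> (\<forall>z. 0 \<le> u z \<and> u z \<le> B) \<longrightarrow> (\<forall>z. j < L z \<longrightarrow> Qop u z = u z) \<longrightarrow>
     0 \<le> a \<longrightarrow> b \<le> B \<longrightarrow> (\<forall>z. near j z (r j) \<longrightarrow> a \<le> u z \<and> u z \<le> b) \<longrightarrow>
     (\<exists>a' b'. 0 \<le> a' \<and> b' \<le> B \<and> b' - a' \<le> (1 - \<omega>) * (b - a) + B * \<epsilon> \<and>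
        (\<forall>z. near (j + N) z (r (j + N)) \<longrightarrow> a' \<le> u z \<and> u z \<le> b')))"

text \<open>One step of the oscillation decay: Harnack's inequality is applied to \<open>u - a\<close> or \<open>b - u\<close>,
  made nonnegative by adding a superharmonic function \<open>V\<close> which is at least \<open>1\<close> outside the
  neighbourhood of the end on which \<open>a \<le> u \<le> b\<close> is known.\<close>

lemma oscillation_step:
  "\<exists>c>0. c \<le> 1 / 2 \<and> (\<forall>\<epsilon>>0. \<exists>N. oscillation_reduces c \<epsilon> N)"
proof -
  have "0 < 2 / (1 - s)" using s_lt_1 by simp
  from harnack[OF this] obtain c0 m1 where c0: "c0 > 0"
    "\<And>f n w y. (\<And>z. n \<le> Suc (L z + m1) \<Longrightarrow> 0 \<le> f z) \<Longrightarrow> (\<And>z. n \<le> L z + m1 \<Longrightarrow> Qop f z \<le> f z) \<Longrightarrow>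
       L w = n \<Longrightarrow> n \<le> L y \<Longrightarrow> D y w \<le> 2 / (1 - s) * s ^ n \<Longrightarrow> c0 * f w \<le> f y"
    by (metis (no_types, lifting))
  \<comment> \<open>The \<open>2\<close> in \<open>c0 / 2\<close> arises because one of
    \<open>u - a\<close> and \<open>b - u\<close> is at least \<open>(b - a) / 2\<close> at the
    centre; the bound \<open>1 / 2\<close> keeps \<open>1 - c\<close> positive.\<close>
  define c where "c = min (c0 / 2) (1 / 2)"
  have c: "0 < c" "c \<le> 1 / 2" "c \<le> c0 / 2" using c0(1) by (auto simp: c_def)
  have "\<exists>N. oscillation_reduces c \<epsilon> N" if eps: "\<epsilon> > 0" for \<epsilon>
  proof -
    \<comment> \<open>\<open>T * s ^ N0\<close> will bound \<open>V\<close> on the inner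
      neighbourhood.\<close>
    define T where "T = (2 / (1 - s) + A) / s ^ (2 * m)"
    have T: "0 < T" using A_pos s_pos s_lt_1 by (auto simp: T_def intro!: divide_pos_pos add_pos_pos)
    obtain N0 where "s ^ N0 < \<epsilon> / T" using real_arch_pow_inv[of "\<epsilon> / T" s] eps T s_lt_1 by auto
    then have N0: "T * s ^ N0 \<le> \<epsilon>" using T by (simp add: field_simps)
    \<comment> \<open>Harnack at level \<open>n = j + N\<close> looks \<open>m1\<close> levels up
      and one more for the neighbours; it then still stays at level \<open>i = j + N0\<close> or
      deeper, where \<open>V\<close> is nonnegative.\<close>
    define N where "N = N0 + m1 + 1"
    show ?thesis
      unfolding oscillation_reduces_def
    proof (intro exI[of _ N] allI impI)
      fix u B r j a b
      assume r: "ray r" and u: "\<forall>z. 0 \<le> u z \<and> u z \<le> B" and harm: "\<forall>z. j < L z \<longrightarrow> Qop u z = u z"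
        and ab: "0 \<le> a" "b \<le> B" and uab: "\<forall>z. near j z (r j) \<longrightarrow> a \<le> u z \<and> u z \<le> b"
      define n i q where "n = j + N" and "i = j + N0" and "q = r n"
      have Lq: "L q = n" using r by (simp add: q_def ray_L)
      have jn: "j \<le> n" by (simp add: n_def)
      have near_q: "near j z q \<longleftrightarrow> near j z (r j)" for z using near_ray[OF r jn] by (simp add: q_def)
      have B: "0 \<le> B" using u order_trans by blast
      define V where "V z = (D z q + A * s ^ i - A * s ^ L z) / s ^ (j + 2 * m)" for z
      have V_nonneg: "0 \<le> V z" if "i \<le> L z" for z
      proof -
        have "A * s ^ L z \<le> A * s ^ i" using s_power_mono[OF that] A_pos by (intro mult_left_mono) auto
        then show ?thesis using D_nonneg[of z q] s_pos unfolding V_def by (intro divide_nonneg_nonneg) auto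
      qed
      have V_far: "1 \<le> V z" if "i \<le> L z" "\<not> near j z (r j)" for z
      proof -
        have "s ^ (j + 2 * m) \<le> D z q" using that near_q by (intro D_ge_not_near) auto
        moreover have "A * s ^ L z \<le> A * s ^ i" using s_power_mono[OF that(1)] A_pos by (intro mult_left_mono) auto
        ultimately show ?thesis using s_pos by (simp add: V_def field_simps)
      qed
      have V_sup: "Qop V z \<le> V z" if "z \<noteq> \<theta>" for z
      proof -
        have "Qop V z = Qop (\<lambda>z. 1 / s ^ (j + 2 * m) * ((D z q - A * s ^ L z) - (- A * s ^ i))) z"
          by (rule arg_cong[where f = "\<lambda>f. Qop f z"]) (simp add: V_def fun_eq_iff)
        also have "\<dots> = 1 / s ^ (j + 2 * m) * (Qop (\<lambda>z. D z q - A * s ^ L z) z - (- A * s ^ i))"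
          unfolding Qop_cmult Qop_diff[of "\<lambda>z. D z q - A * s ^ L z"] Qop_const[OF that] ..
        also have "\<dots> \<le> 1 / s ^ (j + 2 * m) * (D z q - A * s ^ L z - (- A * s ^ i))"
          using V_super[OF that, of q] s_pos by (intro mult_left_mono) auto
        also have "\<dots> = V z" by (simp add: V_def)
        finally show ?thesis .
      qed
      have V_near: "V z \<le> \<epsilon>" if "near n z q" for z
      proof -
        have "D z q \<le> 2 / (1 - s) * s ^ n" using D_le_near[OF that] by simp
        also have "\<dots> \<le> 2 / (1 - s) * s ^ i"
          using s_power_mono[of i n] s_lt_1 by (intro mult_left_mono) (auto simp: n_def i_def N_def)
        finally have "D z q + A * s ^ i - A * s ^ L z \<le> (2 / (1 - s) + A) * s ^ i"
          using mult_pos_pos[OF A_pos zero_less_power[OF s_pos], of "L z"] unfolding distrib_right by linarith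
        then have "V z \<le> (2 / (1 - s) + A) * s ^ i / s ^ (j + 2 * m)"
          unfolding V_def using s_pos by (intro divide_right_mono) auto
        also have "\<dots> = T * s ^ N0" using s_pos by (simp add: T_def i_def power_add)
        finally show ?thesis using N0 by simp
      qed
      have key: "c0 * f q \<le> f y + B * \<epsilon>"
        if "near n y q" and f: "\<And>z. i \<le> L z \<Longrightarrow> near j z (r j) \<Longrightarrow> 0 \<le> f z" "\<And>z. - B \<le> f z"
          "\<And>z. i < L z \<Longrightarrow> Qop f z = f z" for f y
      proof -
        have "c0 * (f q + B * V q) \<le> f y + B * V y"
        proof (rule c0(2)[where n = n and f = "\<lambda>z. f z + B * V z"])
          fix z assume "n \<le> Suc (L z + m1)"
          then have z: "i \<le> L z" by (simp add: n_def i_def N_def)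
          show "0 \<le> f z + B * V z"
          proof (cases "near j z (r j)")
            case True
            then show ?thesis using f(1)[OF z] V_nonneg[OF z] B by simp
          next
            case False
            then have "B * 1 \<le> B * V z" using V_far[OF z] B by (intro mult_left_mono) auto
            then show ?thesis using f(2)[of z] by simp
          qed
        next
          fix z assume "n \<le> L z + m1"
          then have z: "i < L z" by (simp add: n_def i_def N_def)
          then have "z \<noteq> \<theta>" by auto
          then have "B * Qop V z \<le> B * V z" using V_sup[of z] B by (intro mult_left_mono) auto
          then show "Qop (\<lambda>z. f z + B * V z) z \<le> f z + B * V z" using f(3)[OF z] by (simp add: Qop_add Qop_cmult)
        next
          show "D y q \<le> 2 / (1 - s) * s ^ n" using D_le_near[OF that(1)] by simp
        qed (use that Lq in \<open>auto simp: near_def\<close>)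
        moreover have "0 \<le> c0 * (B * V q)"
          using V_nonneg[of q] Lq c0(1) B by (simp add: n_def i_def N_def)
        moreover have "B * V y \<le> B * \<epsilon>" using V_near[OF that(1)] B by (intro mult_left_mono) auto
        ultimately show ?thesis by (simp add: distrib_left)
      qed
      have near_n: "near j z (r j)" if "near n z q" for z
        using near_mono[OF that jn] near_q by simp
      have qn: "near n q q" using Lq by (simp add: near_self)
      have uq: "a \<le> u q" "u q \<le> b" using near_n[OF qn] uab by auto
      have "(1 - c0 / 2) * (b - a) \<le> (1 - c) * (b - a)"
        using c uq by (intro mult_right_mono) auto
      then have width: "b - a - c0 * ((b - a) / 2) \<le> (1 - c) * (b - a)"
        by (simp add: left_diff_distrib)
      show "\<exists>a' b'. 0 \<le> a' \<and> b' \<le> B \<and> b' - a' \<le> (1 - c) * (b - a) + B * \<epsilon> \<and>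
        (\<forall>z. near (j + N) z (r (j + N)) \<longrightarrow> a' \<le> u z \<and> u z \<le> b')"
      proof (cases "(b - a) / 2 \<le> u q - a")
        case True
        have low: "a + c0 * ((b - a) / 2) - B * \<epsilon> \<le> u y" if y: "near n y q" for y
        proof -
          have "c0 * (u q - a) \<le> (u y - a) + B * \<epsilon>"
          proof (rule key[OF y, of "\<lambda>z. u z - a"])
            show "- B \<le> u z - a" for z using u ab uq by (smt (verit))
            show "Qop (\<lambda>z. u z - a) z = u z - a" if "i < L z" for z
            proof -
              have "z \<noteq> \<theta>" "j < L z" using that by (auto simp: i_def)
              then show ?thesis using harm by (simp add: Qop_diff Qop_const)
            qed
          qed (use uab in auto)
          moreover have "c0 * ((b - a) / 2) \<le> c0 * (u q - a)" using True c0(1) by (intro mult_left_mono) auto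
          ultimately show ?thesis by linarith
        qed
        show ?thesis
        proof (rule exI[of _ "max a (a + c0 * ((b - a) / 2) - B * \<epsilon>)"], rule exI[of _ b], intro conjI allI impI)
          show "b - max a (a + c0 * ((b - a) / 2) - B * \<epsilon>) \<le> (1 - c) * (b - a) + B * \<epsilon>"
            using width max.cobounded2[of "a + c0 * ((b - a) / 2) - B * \<epsilon>" a] by linarith
          show "max a (a + c0 * ((b - a) / 2) - B * \<epsilon>) \<le> u z" if "near (j + N) z (r (j + N))" for z
            using low[of z] near_n[of z] uab that by (auto simp: q_def n_def)
        qed (use ab uab near_n in \<open>auto simp: q_def n_def\<close>)
      next
        case False
        have high: "u y \<le> b - c0 * ((b - a) / 2) + B * \<epsilon>" if y: "near n y q" for y
        proof -
          have "c0 * (b - u q) \<le> (b - u y) + B * \<epsilon>"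
          proof (rule key[OF y, of "\<lambda>z. b - u z"])
            show "- B \<le> b - u z" for z using u ab uq by (smt (verit))
            show "Qop (\<lambda>z. b - u z) z = b - u z" if "i < L z" for z
            proof -
              have "z \<noteq> \<theta>" "j < L z" using that by (auto simp: i_def)
              then show ?thesis using harm by (simp add: Qop_diff Qop_const)
            qed
          qed (use uab in auto)
          moreover have "c0 * ((b - a) / 2) \<le> c0 * (b - u q)" using False c0(1) by (intro mult_left_mono) auto
          ultimately show ?thesis by linarith
        qed
        show ?thesis
        proof (rule exI[of _ a], rule exI[of _ "min b (b - c0 * ((b - a) / 2) + B * \<epsilon>)"], intro conjI allI impI)
          show "min b (b - c0 * ((b - a) / 2) + B * \<epsilon>) - a \<le> (1 - c) * (b - a) + B * \<epsilon>"
            using width min.cobounded2[of b "b - c0 * ((b - a) / 2) + B * \<epsilon>"] by linarith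
          show "u z \<le> min b (b - c0 * ((b - a) / 2) + B * \<epsilon>)" if "near (j + N) z (r (j + N))" for z
            using high[of z] near_n[of z] uab that by (auto simp: q_def n_def)
        qed (use ab uab near_n in \<open>auto simp: q_def n_def\<close>)
      qed
    qed
  qed
  then show ?thesis using c by blast
qed

lemma oscillation_small:
  assumes r: "ray r" and u: "\<And>z. 0 \<le> u z" "\<And>z. u z \<le> B" and harm: "\<And>z. j0 < L z \<Longrightarrow> Qop u z = u z"
    and e: "0 < e"
  shows "\<exists>j a b. b - a \<le> e \<and> (\<forall>z. near j z (r j) \<longrightarrow> a \<le> u z \<and> u z \<le> b)"
proof -
  obtain c where c: "0 < c" "c \<le> 1 / 2" and step: "\<And>\<epsilon>. \<epsilon> > 0 \<Longrightarrow> \<exists>N. oscillation_reduces c \<epsilon> N"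
    using oscillation_step by blast
  have B: "0 \<le> B" using u order_trans by blast
  \<comment> \<open>The map \<open>d \<mapsto> (1 - c) * d + B * \<epsilon>\<close> has the fixed
    point \<open>B * \<epsilon> / c\<close>, which this choice makes at most
    \<open>e / 2\<close>.\<close>
  define \<epsilon> where "\<epsilon> = e * c / (2 * (B + 1))"
  have eps: "\<epsilon> > 0" using e c B by (simp add: \<epsilon>_def)
  obtain N where N: "oscillation_reduces c \<epsilon> N" using step[OF eps] by blast
  have iter: "\<exists>a b. 0 \<le> a \<and> b \<le> B \<and> b - a \<le> (1 - c) ^ t * B + B * \<epsilon> / c \<and>
      (\<forall>z. near (j0 + t * N) z (r (j0 + t * N)) \<longrightarrow> a \<le> u z \<and> u z \<le> b)" for t
  proof (induction t)
    case 0
    show ?case using u B eps c by (intro exI[of _ 0] exI[of _ B]) auto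
  next
    case (Suc t)
    then obtain a b where ab: "0 \<le> a" "b \<le> B" "b - a \<le> (1 - c) ^ t * B + B * \<epsilon> / c"
      "\<forall>z. near (j0 + t * N) z (r (j0 + t * N)) \<longrightarrow> a \<le> u z \<and> u z \<le> b" by blast
    have harm': "Qop u z = u z" if "j0 + t * N < L z" for z using harm that by auto
    have "\<exists>a' b'. 0 \<le> a' \<and> b' \<le> B \<and> b' - a' \<le> (1 - c) * (b - a) + B * \<epsilon> \<and>
      (\<forall>z. near (j0 + t * N + N) z (r (j0 + t * N + N)) \<longrightarrow> a' \<le> u z \<and> u z \<le> b')"
      by (rule N[unfolded oscillation_reduces_def, rule_format]) (use r u harm' ab in auto)
    then obtain a' b' where ab': "0 \<le> a'" "b' \<le> B"
      "b' - a' \<le> (1 - c) * (b - a) + B * \<epsilon>"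
      "\<forall>z. near (j0 + t * N + N) z (r (j0 + t * N + N)) \<longrightarrow> a' \<le> u z \<and> u z \<le> b'" by blast
    have "(1 - c) * (b - a) \<le> (1 - c) * ((1 - c) ^ t * B + B * \<epsilon> / c)"
      using ab c by (intro mult_left_mono) auto
    also have "\<dots> + B * \<epsilon> = (1 - c) ^ Suc t * B + B * \<epsilon> / c" using c by (simp add: field_simps)
    finally have "b' - a' \<le> (1 - c) ^ Suc t * B + B * \<epsilon> / c" using ab' by linarith
    moreover have "j0 + t * N + N = j0 + Suc t * N" by simp
    ultimately show ?case using ab' by metis
  qed
  obtain t where t: "(1 - c) ^ t < e / (2 * (B + 1))"
    using real_arch_pow_inv[of "e / (2 * (B + 1))" "1 - c"] c e B by auto
  have "(1 - c) ^ t * B \<le> (1 - c) ^ t * (B + 1)" using c by (intro mult_left_mono) auto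
  also have "\<dots> \<le> e / 2" using t B by (simp add: field_simps)
  finally have 1: "(1 - c) ^ t * B \<le> e / 2" .
  have 2: "B * \<epsilon> / c \<le> e / 2"
  proof -
    have "B * \<epsilon> / c = e / 2 * (B / (B + 1))" using c B by (simp add: \<epsilon>_def)
    also have "\<dots> \<le> e / 2 * 1" using e B by (intro mult_left_mono) auto
    finally show ?thesis by simp
  qed
  have "(1 - c) ^ t * B + B * \<epsilon> / c \<le> e" using 1 2 by linarith
  then show ?thesis using iter[of t] order_trans by blast
qed

lemma convergent_at_end:
  assumes r: "ray r" and u: "\<And>z. 0 \<le> u z" "\<And>z. u z \<le> B" and harm: "\<And>z. j0 < L z \<Longrightarrow> Qop u z = u z"
  shows "\<exists>v. \<forall>t. tends_to_end t r \<longrightarrow> (\<lambda>n. u (t n)) \<longlonglongrightarrow> v"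
proof -
  have small: "\<exists>j. \<forall>z z'. near j z (r j) \<longrightarrow> near j z' (r j) \<longrightarrow> \<bar>u z - u z'\<bar> \<le> e" if "0 < e" for e
    using oscillation_small[OF r u harm that] by (smt (verit))
  have "Cauchy (\<lambda>n. u (r n))"
  proof (rule CauchyI)
    fix e :: real assume "0 < e"
    then obtain j where j: "\<And>z z'. near j z (r j) \<Longrightarrow> near j z' (r j) \<Longrightarrow> \<bar>u z - u z'\<bar> \<le> e / 2"
      using small[of "e / 2"] by auto
    have "near j (r n) (r j)" if "j \<le> n" for n
      using that by (rule ray_near[OF r])
    then show "\<exists>M. \<forall>m\<ge>M. \<forall>n\<ge>M. norm (u (r m) - u (r n)) < e"
    proof (intro exI[of _ j] allI impI)
      fix m n assume "j \<le> m" "j \<le> n"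
      then have "\<bar>u (r m) - u (r n)\<bar> \<le> e / 2" using \<open>\<And>n. j \<le> n \<Longrightarrow> near j (r n) (r j)\<close> j by blast
      then show "norm (u (r m) - u (r n)) < e" using \<open>0 < e\<close> by simp
    qed
  qed
  then obtain v where v: "(\<lambda>n. u (r n)) \<longlonglongrightarrow> v" by (auto simp: Cauchy_convergent_iff convergent_def)
  have "(\<lambda>n. u (t n)) \<longlonglongrightarrow> v" if t: "tends_to_end t r" for t
  proof -
    have "(\<lambda>n. u (t n) - u (r n)) \<longlonglongrightarrow> 0"
    proof (rule LIMSEQ_I)
      fix e :: real assume "0 < e"
      then obtain j where j: "\<And>z z'. near j z (r j) \<Longrightarrow> near j z' (r j) \<Longrightarrow> \<bar>u z - u z'\<bar> \<le> e / 2"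
        using small[of "e / 2"] by auto
      have "\<forall>\<^sub>F n in sequentially. near j (t n) (r j) \<and> near j (r n) (r j)"
        using t ray_tends_to_end[OF r] by (auto simp: tends_to_end_def eventually_conj_iff)
      then have "\<forall>\<^sub>F n in sequentially. norm (u (t n) - u (r n) - 0) < e"
      proof eventually_elim
        case (elim n)
        then have "\<bar>u (t n) - u (r n)\<bar> \<le> e / 2" by (intro j) auto
        then show ?case using \<open>0 < e\<close> by simp
      qed
      then show "\<exists>no. \<forall>n\<ge>no. norm (u (t n) - u (r n) - 0) < e" by (simp add: eventually_sequentially)
    qed
    from tendsto_add[OF this v] show ?thesis by simp
  qed
  then show ?thesis by blast
qed

lemma Gh_bounded: "\<exists>B. \<forall>x y. Gh x y \<le> B"
proof -
  obtain C where C: "C > 0" "\<And>x y. Gh x y \<le> C * (mh y / mh (anc (J x y) y))" using Gh_upper by blast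
  have "Gh x y \<le> C * \<Lambda>1" for x y
  proof -
    have "mh (anc (L y) y) \<le> \<Lambda>1 * l ^ (L y - J x y) * mh (anc (J x y) y)"
      using J_le[of x y] by (intro mh_anc_le) auto
    also have "\<dots> \<le> \<Lambda>1 * 1 * mh (anc (J x y) y)"
      using Lam1_pos l_pos l_lt_1 mh_pos by (intro mult_right_mono mult_left_mono power_le_one) (auto simp: less_imp_le)
    finally have "mh y / mh (anc (J x y) y) \<le> \<Lambda>1" using mh_pos[of "anc (J x y) y"] by (simp add: field_simps)
    then have "C * (mh y / mh (anc (J x y) y)) \<le> C * \<Lambda>1" using C(1) by (intro mult_left_mono) auto
    then show ?thesis using C(2)[of x y] by linarith
  qed
  then show ?thesis by blast
qed

text \<open>The difference is harmonic off the root and vanishes at the root, so the minimum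
  principle applies to both of its signs. For the original walk this says that the root is ever
  visited from \<open>x\<close> with probability \<open>l ^ L x\<close>.\<close>

lemma Gh_root: "Gh x \<theta> = Gh \<theta> \<theta>"
proof -
  obtain B where B: "\<And>x y. Gh x y \<le> B" using Gh_bounded by blast
  have B0: "0 \<le> B" using B Gh_nonneg order_trans by blast
  have harm: "Qop (\<lambda>z. Gh z \<theta> - Gh \<theta> \<theta>) x = Gh x \<theta> - Gh \<theta> \<theta>" if "0 < L x" for x
  proof -
    have nz: "x \<noteq> \<theta>" using that by auto
    show ?thesis unfolding Qop_diff Qop_const[OF nz] Gh_harmonic[OF nz] ..
  qed
  have "0 \<le> Gh x \<theta> - Gh \<theta> \<theta>"
    by (rule min_principle[where n = 0 and K = B and f = "\<lambda>z. Gh z \<theta> - Gh \<theta> \<theta>"])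
      (use harm B0 B[of \<theta> \<theta>] Gh_nonneg in \<open>auto simp: L_eq_0 intro: diff_mono[of 0, simplified]\<close>)
  moreover have "0 \<le> (- 1) * (Gh x \<theta> - Gh \<theta> \<theta>)"
    by (rule min_principle[where n = 0 and K = B and f = "\<lambda>z. (- 1) * (Gh z \<theta> - Gh \<theta> \<theta>)"], unfold Qop_cmult)
      (use harm B0 B Gh_nonneg[of \<theta> \<theta>] in \<open>auto simp: L_eq_0 intro: diff_mono[of 0, simplified]\<close>)
  ultimately show ?thesis by simp
qed

section \<open>Back to the original walk: Green function and Martin kernel\<close>

lemma P_off: "z \<notin> nbs x \<Longrightarrow> P x z = 0"
  using c_off[of x z] by (simp add: P_def nbs_def)

lemma infsum_nbs:
  fixes f :: "'a \<Rightarrow> real"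
  assumes "\<And>z. z \<notin> nbs x \<Longrightarrow> f z = 0"
  shows "(\<Sum>\<^sub>\<infinity>z. f z) = sum f (nbs x)"
proof -
  have "(\<Sum>\<^sub>\<infinity>z. f z) = (\<Sum>\<^sub>\<infinity>z\<in>nbs x. f z)"
    by (intro infsum_cong_neutral) (use assms in auto)
  then show ?thesis by (simp add: finite_nbs)
qed

lemma transition_eq: "transition c = P"
proof -
  have "(\<Sum>\<^sub>\<infinity>z. c x z) = tot x" for x
    unfolding tot_def using c_off by (intro infsum_nbs) (auto simp: nbs_def)
  then show ?thesis by (simp add: transition_def[abs_def] P_def[abs_def])
qed

lemma nstep_Suc: "nstep P (Suc n) x y = (\<Sum>z\<in>nbs x. P x z * nstep P n z y)"
  unfolding nstep.simps by (intro infsum_nbs) (simp add: P_off)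

lemma nstep_eq: "nstep P n x y = l ^ L x / l ^ L y * qk 0 n x y"
proof (induction n arbitrary: x)
  case 0
  then show ?case using l_pos by simp
next
  case (Suc n)
  have "nstep P (Suc n) x y = (\<Sum>z\<in>nbs x. P x z * (l ^ L z / l ^ L y * qk 0 n z y))"
    by (simp only: nstep_Suc Suc)
  also have "\<dots> = (\<Sum>z\<in>nbs x. l ^ L x / l ^ L y * (Qk 0 x z * qk 0 n z y))"
    using l_pos by (intro sum.cong) (auto simp: Qk_def Q_def)
  finally show ?case by (simp add: sum_distrib_left)
qed

lemma nstep_sums: "(\<lambda>n. nstep P n x y) sums (l ^ L x / l ^ L y * Gh x y)"
  unfolding nstep_eq using gk_tendsto[of x y]
  by (intro sums_mult) (simp add: sums_def gk_def)

lemma green_eq: "green P x y = l ^ L x / l ^ L y * Gh x y"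
  unfolding green_def using nstep_sums by (rule sums_unique[symmetric])

lemma green_rec: "green P x y = of_bool (x = y) + (\<Sum>z\<in>nbs x. P x z * green P z y)"
proof -
  have "l ^ L x / l ^ L y * Qop (\<lambda>z. Gh z y) x = (\<Sum>z\<in>nbs x. P x z * green P z y)"
    unfolding Qop_def sum_distrib_left green_eq Q_def using l_pos by (intro sum.cong) auto
  then show ?thesis
    unfolding green_eq[of x y] by (subst Gh_rec) (use l_pos in \<open>auto simp: distrib_left\<close>)
qed

text \<open>The Martin kernel estimate with \<open>J x y\<close> in place of the Gromov product and
  the cell of the ancestor of \<open>x\<close> on that level in place of
  \<open>p_mu\<close>.\<close>

definition est :: "'a \<Rightarrow> 'a \<Rightarrow> real" where
  "est x y = l ^ L x / (l ^ J x y * M (anc (J x y) x))"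

lemma est_pos: "0 < est x y" using l_pos M_pos by (simp add: est_def)

lemma mh_ratio:
  assumes "k \<le> L y"
  shows "mh y / mh (anc k y) \<le> \<Lambda>1 * (l ^ L y * M y / (l ^ k * M (anc k y)))"
    and "l ^ L y * M y / (l ^ k * M (anc k y)) \<le> \<Lambda>1 * (mh y / mh (anc k y))"
proof -
  have "mh y / mh (anc k y) \<le> (\<Lambda>1 * (l ^ L y * M y)) / (l ^ k * M (anc k y))"
    using mh_le[of y] mh_ge[of "anc k y"] mh_pos[of y] M_pos assms l_pos
    by (intro frac_le) (auto simp: L_anc)
  then show "mh y / mh (anc k y) \<le> \<Lambda>1 * (l ^ L y * M y / (l ^ k * M (anc k y)))" by simp
  have "l ^ L y * M y / (l ^ k * M (anc k y)) \<le> mh y / (mh (anc k y) / \<Lambda>1)"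
    using mh_ge[of y] mh_le[of "anc k y"] mh_pos Lam1_pos M_pos[of y] assms l_pos
    by (intro frac_le) (auto simp: L_anc field_simps less_imp_le)
  then show "l ^ L y * M y / (l ^ k * M (anc k y)) \<le> \<Lambda>1 * (mh y / mh (anc k y))"
    by (simp add: mult.commute)
qed

lemma M_anc_J: "M (anc (J x y) y) \<le> \<Lambda> * M (anc (J x y) x)" "M (anc (J x y) x) \<le> \<Lambda> * M (anc (J x y) y)"
  using near_J[of x y] by (auto simp: near_def intro!: M_adj intro: adj_sym)

lemma green_est: "\<exists>C>0. \<forall>x y. green P x y \<le> C * (est x y * M y) \<and> est x y * M y \<le> C * green P x y"
proof -
  obtain C where C: "C > 0" "\<And>x y. Gh x y \<le> C * (mh y / mh (anc (J x y) y))" using Gh_upper by blast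
  obtain c where c: "c > 0" "\<And>x y. c * (mh y / mh (anc (J x y) y)) \<le> Gh x y" using Gh_lower by blast
  define C' where "C' = max (C * \<Lambda>1 * \<Lambda>) (\<Lambda> * \<Lambda>1 / c)"
  have C': "C * \<Lambda>1 * \<Lambda> \<le> C'" "\<Lambda> * \<Lambda>1 / c \<le> C'" by (auto simp: C'_def)
  have "green P x y \<le> C' * (est x y * M y) \<and> est x y * M y \<le> C' * green P x y" for x y
  proof
    define k where "k = J x y"
    define e where "e = l ^ L x / l ^ k * M y"
    have e: "0 < e" using l_pos M_pos by (simp add: e_def)
    have k: "k \<le> L y" using J_le[of x y] by (simp add: k_def)
    have est: "est x y * M y = e / M (anc k x)" by (simp add: est_def e_def k_def)
    have scale: "l ^ L x / l ^ L y * (l ^ L y * M y / (l ^ k * M (anc k y))) = e / M (anc k y)"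
      using l_pos by (simp add: e_def)
    have M1: "e / M (anc k y) \<le> \<Lambda> * (e / M (anc k x))"
      using M_anc_J(2)[of x y] M_pos[of "anc k x"] M_pos[of "anc k y"] e by (simp add: k_def field_simps)
    have M2: "e / M (anc k x) \<le> \<Lambda> * (e / M (anc k y))"
      using M_anc_J(1)[of x y] M_pos[of "anc k x"] M_pos[of "anc k y"] e by (simp add: k_def field_simps)
    have "Gh x y \<le> C * (\<Lambda>1 * (l ^ L y * M y / (l ^ k * M (anc k y))))"
      using C(1) C(2)[of x y] mh_ratio(1)[OF k] by (fold k_def) (meson mult_left_mono less_imp_le order_trans)
    then have "green P x y \<le> l ^ L x / l ^ L y * (C * (\<Lambda>1 * (l ^ L y * M y / (l ^ k * M (anc k y)))))"
      unfolding green_eq using l_pos by (intro mult_left_mono) auto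
    also have "\<dots> = C * \<Lambda>1 * (e / M (anc k y))" unfolding scale[symmetric] by simp
    also have "\<dots> \<le> C * \<Lambda>1 * (\<Lambda> * (e / M (anc k x)))"
      using M1 C(1) Lam1_pos by (intro mult_left_mono) auto
    also have "\<dots> = (C * \<Lambda>1 * \<Lambda>) * (est x y * M y)" by (simp add: est)
    also have "\<dots> \<le> C' * (est x y * M y)" using C' est_pos[of x y] M_pos[of y] by (intro mult_right_mono) auto
    finally show "green P x y \<le> C' * (est x y * M y)" .
    have "c * (l ^ L y * M y / (l ^ k * M (anc k y))) \<le> c * (\<Lambda>1 * (mh y / mh (anc k y)))"
      using mh_ratio(2)[OF k] c(1) by (intro mult_left_mono) auto
    also have "\<dots> = \<Lambda>1 * (c * (mh y / mh (anc k y)))" by simp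
    also have "\<dots> \<le> \<Lambda>1 * Gh x y" 
      using c(2)[of y x, folded k_def] Lam1_pos by (intro mult_left_mono) auto
    finally have "l ^ L x / l ^ L y * (c * (l ^ L y * M y / (l ^ k * M (anc k y)))) \<le> l ^ L x / l ^ L y * (\<Lambda>1 * Gh x y)"
      using l_pos by (intro mult_left_mono) auto
    then have "c * (e / M (anc k y)) \<le> \<Lambda>1 * green P x y"
      unfolding green_eq scale[symmetric] mult.left_commute[of "l ^ L x / l ^ L y"] .
    then have "e / M (anc k y) \<le> \<Lambda>1 / c * green P x y" using c(1) by (simp add: field_simps)
    then have "\<Lambda> * (e / M (anc k y)) \<le> \<Lambda> * (\<Lambda>1 / c * green P x y)" using Lam_ge by (intro mult_left_mono) auto
    then have "est x y * M y \<le> (\<Lambda> * \<Lambda>1 / c) * green P x y" using M2 by (simp add: est)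
    also have "\<dots> \<le> C' * green P x y"
      using C' Gh_nonneg[of x y] l_pos by (intro mult_right_mono) (auto simp: green_eq)
    finally show "est x y * M y \<le> C' * green P x y" .
  qed
  moreover have "C' > 0" using C' C(1) Lam1_pos Lam_ge by (smt (verit) mult_pos_pos)
  ultimately show ?thesis by blast
qed

lemma green_pos: "0 < green P x y"
  using green_est est_pos M_pos by (smt (verit) mult_pos_pos zero_less_mult_pos)

text \<open>Reversibility and \<open>Gh_root\<close> make the kernel, for fixed \<open>x\<close>, a
  multiple of \<open>Gh y x\<close>. As a function of \<open>y\<close> this is harmonic away from
  \<open>x\<close>, hence within reach of the oscillation estimate.\<close>

lemma martin_kernel_eq: "martin_kernel P \<theta> x y = l ^ L x * mh \<theta> / (mh x * Gh \<theta> \<theta>) * Gh y x"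
proof -
  have "Gh x y = mh y / mh x * Gh y x" "Gh \<theta> y = mh y / mh \<theta> * Gh \<theta> \<theta>"
    using mh_Gh_sym[of x y] mh_Gh_sym[of \<theta> y] mh_pos[of x] mh_pos[of \<theta>] by (auto simp: Gh_root[of y] field_simps)
  then show ?thesis
    unfolding martin_kernel_def green_eq using l_pos mh_pos[of y] mh_pos[of \<theta>] by simp
qed

lemma martin_kernel_est:
  "\<exists>C>0. \<forall>x y. martin_kernel P \<theta> x y \<le> C * est x y \<and> est x y \<le> C * martin_kernel P \<theta> x y"
proof -
  obtain C where C: "C > 0" "\<And>x y. green P x y \<le> C * (est x y * M y)" "\<And>x y. est x y * M y \<le> C * green P x y"
    using green_est by blast
  \<comment> \<open>The denominator \<open>green P \<theta> y\<close> is thus comparable to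
    \<open>M y\<close>, and the factor \<open>M y\<close> of the numerator cancels.\<close>
  have est_root: "est \<theta> y = 1 / M \<theta>" for y
    using J_le[of \<theta> y] by (simp add: est_def)
  define a where "a = 1 / M \<theta>"
  have a: "a > 0" using M_pos by (simp add: a_def)
  have "martin_kernel P \<theta> x y \<le> C * C / a * est x y \<and> est x y \<le> C * C * a * martin_kernel P \<theta> x y" for x y
  proof
    have g: "0 < green P \<theta> y" by (rule green_pos)
    have 1: "a * M y \<le> C * green P \<theta> y" using C(3)[of \<theta> y] by (simp add: est_root a_def)
    have 2: "green P \<theta> y \<le> C * (a * M y)" using C(2)[of \<theta> y] by (simp add: est_root a_def)
    have "C * est x y * (a * M y) \<le> C * est x y * (C * green P \<theta> y)"
      using 1 C(1) est_pos[of x y] by (intro mult_left_mono) auto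
    then have "a * green P x y \<le> C * C * est x y * green P \<theta> y"
      using C(2)[of x y] a by (smt (verit) mult.assoc mult.commute mult_left_mono)
    then show "martin_kernel P \<theta> x y \<le> C * C / a * est x y"
      using g a by (simp add: martin_kernel_def field_simps)
    have "est x y * green P \<theta> y \<le> est x y * (C * (a * M y))"
      using 2 est_pos[of x y] by (intro mult_left_mono) auto
    also have "\<dots> = C * a * (est x y * M y)" by simp
    also have "\<dots> \<le> C * a * (C * green P x y)" using C(1) C(3)[of x y] a by (intro mult_left_mono) auto
    finally show "est x y \<le> C * C * a * martin_kernel P \<theta> x y"
      using g by (simp add: martin_kernel_def field_simps)
  qed
  then have "martin_kernel P \<theta> x y \<le> max (C * C / a) (C * C * a) * est x y \<and>
      est x y \<le> max (C * C / a) (C * C * a) * martin_kernel P \<theta> x y" for x y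
    using est_pos[of x y] green_pos[of x y] green_pos[of \<theta> y]
    by (smt (verit) martin_kernel_def divide_pos_pos mult_right_mono)
  moreover have "0 < max (C * C / a) (C * C * a)" using C(1) a by (simp add: less_max_iff_disj)
  ultimately show ?thesis by blast
qed

lemma martin_kernel_convergent:
  assumes "ray r" shows "\<exists>v. \<forall>t. tends_to_end t r \<longrightarrow> (\<lambda>n. martin_kernel P \<theta> x (t n)) \<longlonglongrightarrow> v"
proof -
  obtain B where B: "\<And>x y. Gh x y \<le> B" using Gh_bounded by blast
  obtain v where v: "\<And>t. tends_to_end t r \<Longrightarrow> (\<lambda>n. Gh (t n) x) \<longlonglongrightarrow> v"
  proof -
    have "Qop (\<lambda>z. Gh z x) z = Gh z x" if "L x < L z" for z
      using that by (intro Gh_harmonic) auto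
    from convergent_at_end[OF assms, of "\<lambda>z. Gh z x", OF Gh_nonneg B this] show ?thesis using that by blast
  qed
  then show ?thesis unfolding martin_kernel_eq by (metis tendsto_mult_left)
qed

end

section \<open>Visiting probabilities\<close>

context natural_walk
begin

fun paths :: "nat \<Rightarrow> 'a \<Rightarrow> 'a list set" where
  "paths 0 x = {[]}"
| "paths (Suc n) x = (\<Union>z\<in>nbs x. (#) z ` paths n z)"

fun path_prob :: "'a \<Rightarrow> 'a list \<Rightarrow> real" where
  "path_prob x [] = 1"
| "path_prob x (z # zs) = P x z * path_prob z zs"

lemma finite_paths: "finite (paths n x)"
  by (induction n arbitrary: x) (auto simp: finite_nbs)

lemma length_paths: "zs \<in> paths n x \<Longrightarrow> length zs = n"
  by (induction n arbitrary: x zs) auto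

lemma sum_paths_Suc: "(\<Sum>zs\<in>paths (Suc n) x. g zs) = (\<Sum>z\<in>nbs x. \<Sum>zs\<in>paths n z. g (z # zs))"
  for g :: "'a list \<Rightarrow> real"
proof -
  have "(\<Sum>zs\<in>paths (Suc n) x. g zs) = (\<Sum>z\<in>nbs x. sum g ((#) z ` paths n z))"
    unfolding paths.simps by (intro sum.UNION_disjoint) (auto simp: finite_nbs finite_paths)
  then show ?thesis by (simp add: sum.reindex)
qed

lemma sum_path_prob: "(\<Sum>zs\<in>paths n x. path_prob x zs) = 1"
  by (induction n arbitrary: x)
    (simp_all add: sum_paths_Suc sum_P del: paths.simps(2) flip: sum_distrib_left)

lemma path_prob_nonneg: "zs \<in> paths n x \<Longrightarrow> 0 \<le> path_prob x zs"
  by (induction n arbitrary: x zs) (auto intro!: mult_nonneg_nonneg P_nonneg)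

text \<open>The probability of a visit to \<open>y\<close> up to time \<open>n\<close>, as a finite
  sum. Paths list the vertices after the starting point, hence \<open>x # zs\<close>.\<close>

definition hit :: "nat \<Rightarrow> 'a \<Rightarrow> 'a \<Rightarrow> real" where
  "hit n x y = (\<Sum>zs\<in>paths n x. if y \<in> set (x # zs) then path_prob x zs else 0)"

lemma hit_self: "hit n y y = 1"
  by (simp add: hit_def sum_path_prob)

lemma hit_Suc:
  assumes "x \<noteq> y" shows "hit (Suc n) x y = (\<Sum>z\<in>nbs x. P x z * hit n z y)"
proof -
  have "hit (Suc n) x y = (\<Sum>z\<in>nbs x. \<Sum>zs\<in>paths n z. P x z * (if y \<in> set (z # zs) then path_prob z zs else 0))"
    unfolding hit_def sum_paths_Suc using assms by (intro sum.cong) auto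
  then show ?thesis by (simp add: hit_def sum_distrib_left)
qed

lemma hit_0: "hit 0 x y = of_bool (x = y)" by (simp add: hit_def)

lemma hit_le_green: "hit n x y \<le> green P x y"
proof (induction n arbitrary: x)
  case 0
  show ?case using green_pos[of x y] Gh_self_ge[of y] l_pos by (auto simp: hit_0 green_eq)
next
  case (Suc n)
  show ?case
  proof (cases "x = y")
    case True
    then show ?thesis using Gh_self_ge[of y] l_pos by (simp add: hit_self green_eq)
  next
    case False
    have "(\<Sum>z\<in>nbs x. P x z * hit n z y) \<le> (\<Sum>z\<in>nbs x. P x z * green P z y)"
      by (intro sum_mono mult_left_mono Suc P_nonneg)
    then show ?thesis using False by (subst green_rec) (simp add: hit_Suc)
  qed
qed

text \<open>The first-visit inequality \<open>G x y \<le> F x * G y y\<close> for truncated sums, by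
  induction on the first step: as a limit of \<open>hit\<close>, the function \<open>F\<close> is
  \<open>1\<close> at \<open>y\<close> and harmonic for \<open>P\<close> elsewhere.\<close>

lemma sum_nstep_le:
  assumes "\<And>x. (\<lambda>n. hit n x y) \<longlonglongrightarrow> F x"
  shows "(\<Sum>k<n. nstep P k x y) \<le> F x * green P y y"
proof (induction n arbitrary: x)
  case 0
  have "0 \<le> hit n x y" for n
    unfolding hit_def by (intro sum_nonneg) (auto intro: path_prob_nonneg)
  then have "0 \<le> F x" using assms by (intro LIMSEQ_le_const[of "\<lambda>n. hit n x y"]) auto
  then show ?case using green_pos[of y y] by simp
next
  case (Suc n)
  show ?case
  proof (cases "x = y")
    case True
    have "F y = 1" using assms[of y] by (simp add: hit_self LIMSEQ_const_iff)
    moreover have "(\<Sum>k<Suc n. nstep P k y y) \<le> green P y y"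
      unfolding green_def using nstep_sums qk_nonneg l_pos
      by (intro sum_le_suminf) (auto simp: nstep_eq sums_iff intro!: divide_nonneg_nonneg mult_nonneg_nonneg)
    ultimately show ?thesis using True by simp
  next
    case False
    have "(\<lambda>n. hit (Suc n) x y) \<longlonglongrightarrow> (\<Sum>z\<in>nbs x. P x z * F z)"
      using False by (auto simp: hit_Suc intro!: tendsto_sum tendsto_mult tendsto_const assms)
    then have F: "F x = (\<Sum>z\<in>nbs x. P x z * F z)"
      using LIMSEQ_Suc[OF assms[of x]] LIMSEQ_unique by blast
    have "(\<Sum>k<Suc n. nstep P k x y) = (\<Sum>k<n. \<Sum>z\<in>nbs x. P x z * nstep P k z y)"
      using False by (simp add: sum.lessThan_Suc_shift nstep_Suc del: sum.lessThan_Suc nstep.simps(2))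
    also have "\<dots> = (\<Sum>z\<in>nbs x. P x z * (\<Sum>k<n. nstep P k z y))"
      unfolding sum_distrib_left by (rule sum.swap)
    also have "\<dots> \<le> (\<Sum>z\<in>nbs x. P x z * (F z * green P y y))"
      by (intro sum_mono mult_left_mono Suc P_nonneg)
    also have "\<dots> = F x * green P y y" by (simp add: F sum_distrib_right mult.assoc)
    finally show ?thesis .
  qed
qed

lemma measure_cylinder:
  assumes "markov_chain_from P x M' Z"
  shows "measure M' {w \<in> space M'. \<forall>i\<le>length zs. Z i w = (x # zs) ! i} = path_prob x zs"
proof -
  have "(\<Prod>i<length zs. P ((x # zs) ! i) ((x # zs) ! Suc i)) = path_prob x zs"
    by (induction zs arbitrary: x) (auto simp: prod.lessThan_Suc_shift simp del: prod.lessThan_Suc)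
  moreover have "measure M' {w \<in> space M'. \<forall>i\<le>length zs. Z i w = (x # zs) ! i} =
      of_bool ((x # zs) ! 0 = x) * (\<Prod>i<length zs. P ((x # zs) ! i) ((x # zs) ! Suc i))"
    using assms unfolding markov_chain_from_def by blast
  ultimately show ?thesis by simp
qed

text \<open>The cylinders over paths of edges are disjoint and have total mass \<open>1\<close>, so
  the event can be computed inside their union.\<close>

lemma measure_hit:
  assumes mc: "markov_chain_from P x M' Z"
  shows "measure M' {w \<in> space M'. \<exists>i\<le>n. Z i w = y} = hit n x y"
proof -
  interpret prob_space M' using mc by (simp add: markov_chain_from_def)
  have meas [measurable]: "Z i \<in> measurable M' (count_space UNIV)" for i
    using mc by (simp add: markov_chain_from_def)
  define cyl where "cyl zs = {w \<in> space M'. \<forall>i\<le>length zs. Z i w = (x # zs) ! i}" for zs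
  have cyl_sets: "cyl zs \<in> events" for zs unfolding cyl_def by measurable
  have cyl_prob: "prob (cyl zs) = path_prob x zs" for zs
    unfolding cyl_def by (rule measure_cylinder[OF mc])
  have disj: "disjoint_family_on cyl S" if S: "S \<subseteq> paths n x" for S
    unfolding disjoint_family_on_def
  proof (intro ballI impI)
    fix zs zs' assume z: "zs \<in> S" "zs' \<in> S" "zs \<noteq> zs'"
    then have len: "length zs = n" "length zs' = n" using S length_paths by blast+
    then obtain i where "i < n" "zs ! i \<noteq> zs' ! i" using z by (metis nth_equalityI)
    then have "(x # zs) ! Suc i \<noteq> (x # zs') ! Suc i" "Suc i \<le> n" by auto
    then show "cyl zs \<inter> cyl zs' = {}" using len unfolding cyl_def by fastforce
  qed
  have union: "prob (\<Union>zs\<in>S. cyl zs) = (\<Sum>zs\<in>S. path_prob x zs)" if "S \<subseteq> paths n x" for S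
    using that disj[OF that] cyl_sets finite_subset[OF that finite_paths]
    by (subst finite_measure_finite_Union) (auto simp: cyl_prob)
  define B where "B = (\<Union>zs\<in>paths n x. cyl zs)"
  have B: "B \<in> events" "prob B = 1"
    using union[of "paths n x"] cyl_sets finite_paths by (auto simp: B_def sum_path_prob)
  define A where "A = {w \<in> space M'. \<exists>i\<le>n. Z i w = y}"
  have A: "A \<in> events" unfolding A_def by measurable
  define S where "S = {zs \<in> paths n x. y \<in> set (x # zs)}"
  have AB: "A \<inter> B = (\<Union>zs\<in>S. cyl zs)"
  proof -
    have "w \<in> A \<longleftrightarrow> y \<in> set (x # zs)" if "zs \<in> paths n x" "w \<in> cyl zs" for w zs
    proof -
      have len: "length zs = n" using that length_paths by blast
      have "w \<in> space M'" "\<And>i. i \<le> n \<Longrightarrow> Z i w = (x # zs) ! i" using that len by (auto simp: cyl_def)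
      then have "w \<in> A \<longleftrightarrow> (\<exists>i\<le>n. (x # zs) ! i = y)" by (auto simp: A_def)
      also have "\<dots> \<longleftrightarrow> y \<in> set (x # zs)" unfolding in_set_conv_nth using len by (auto simp: less_Suc_eq_le)
      finally show ?thesis .
    qed
    then show ?thesis by (auto simp: B_def S_def)
  qed
  have "AE w in M'. w \<in> B" using B by (simp add: prob_eq_1)
  then have "prob A = prob (A \<inter> B)"
    by (intro finite_measure_eq_AE) (use A B in auto)
  also have "\<dots> = (\<Sum>zs\<in>S. path_prob x zs)" unfolding AB by (rule union) (auto simp: S_def)
  also have "\<dots> = hit n x y"
    unfolding hit_def S_def using finite_paths by (intro sum.mono_neutral_cong_left) auto
  finally show ?thesis by (simp add: A_def)
qed

lemma hit_tendsto:
  assumes mc: "markov_chain_from P x (Pr x) Z"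
  shows "(\<lambda>n. hit n x y) \<longlonglongrightarrow> visiting_prob Pr Z x y"
proof -
  interpret prob_space "Pr x" using mc by (simp add: markov_chain_from_def)
  have [measurable]: "Z i \<in> measurable (Pr x) (count_space UNIV)" for i
    using mc by (simp add: markov_chain_from_def)
  let ?A = "\<lambda>n. {w \<in> space (Pr x). \<exists>i\<le>n. Z i w = y}"
  have "(\<lambda>n. prob (?A n)) \<longlonglongrightarrow> prob (\<Union>n. ?A n)"
    by (intro finite_Lim_measure_incseq) (auto simp: incseq_def intro: order_trans)
  moreover have "(\<Union>n. ?A n) = {w \<in> space (Pr x). \<exists>n. Z n w = y}" by auto
  ultimately show ?thesis by (simp add: visiting_prob_def measure_hit[OF mc])
qed

text \<open>\<open>F x y \<le> G x y \<le> F x y * G y y\<close> with \<open>G y y\<close> bounded,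
  so \<open>F\<close> inherits the estimates of the Green function.\<close>

lemma visiting_prob_est:
  assumes mc: "\<And>x. markov_chain_from P x (Pr x) Z"
  shows "\<exists>C>0. \<forall>x y. visiting_prob Pr Z x y \<le> C * (est x y * M y) \<and>
    est x y * M y \<le> C * visiting_prob Pr Z x y"
proof -
  obtain C where C: "C > 0" "\<And>x y. green P x y \<le> C * (est x y * M y)" "\<And>x y. est x y * M y \<le> C * green P x y"
    using green_est by blast
  obtain B where B: "\<And>x y. Gh x y \<le> B" using Gh_bounded by blast
  have B_pos: "0 < B" using B Gh_self_ge by (meson less_le_trans zero_less_one order_trans)
  have upper: "visiting_prob Pr Z x y \<le> C * (est x y * M y)" for x y
    using LIMSEQ_le_const2[OF hit_tendsto[of x Pr Z, OF mc]] hit_le_green C(2)[of x y] by (meson order_trans)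
  have nonneg: "0 \<le> visiting_prob Pr Z x y" for x y by (simp add: visiting_prob_def)
  have lower: "est x y * M y \<le> (C * B) * visiting_prob Pr Z x y" for x y
  proof -
    have "(\<lambda>n. \<Sum>k<n. nstep P k x y) \<longlonglongrightarrow> green P x y"
      using nstep_sums[of x y] by (simp add: sums_def green_eq)
    then have "green P x y \<le> visiting_prob Pr Z x y * green P y y"
      using sum_nstep_le[OF hit_tendsto[of _ Pr Z, OF mc]] by (intro LIMSEQ_le_const2) auto
    also have "\<dots> \<le> visiting_prob Pr Z x y * B"
      using nonneg B[of y y] l_pos by (intro mult_left_mono) (auto simp: green_eq)
    finally have "C * green P x y \<le> C * (visiting_prob Pr Z x y * B)" using C(1) by (intro mult_left_mono) auto
    then show ?thesis using C(3)[of x y] by (simp add: mult_ac)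
  qed
  define C' where "C' = max C (C * B)"
  have "C \<le> C'" "C * B \<le> C'" by (auto simp: C'_def)
  then have "visiting_prob Pr Z x y \<le> C' * (est x y * M y) \<and>
    est x y * M y \<le> C' * visiting_prob Pr Z x y" for x y
    using upper[of x y] lower[of x y] nonneg[of x y] est_pos[of x y] M_pos[of y]
    by (meson mult_right_mono mult_nonneg_nonneg less_imp_le order_trans)
  moreover have "C' > 0" using C(1) by (simp add: C'_def less_max_iff_disj)
  ultimately show ?thesis by blast
qed

end

section \<open>Geodesics, rays and the hyperbolic boundary\<close>

context aug_tree
begin

lemma gromov_le: "gromov E \<theta> x y \<le> L x"
  using gdist_triangle[of \<theta> y x] by (simp add: gromov_def lev_eq field_simps)

lemma J_ge_gromov:
  assumes "real j + hyp_const \<le> gromov E \<theta> x y" shows "near j x y"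
proof -
  have "real j \<le> real (J x y)" using assms gromov_J(2)[of x y] by linarith
  then show ?thesis by (simp add: near_iff_J)
qed

lemma E_down: "(x, y) \<in> E \<Longrightarrow> L y = Suc (L x) \<Longrightarrow> par y = x"
  by (erule E_cases) (auto simp: L_par dest: H_lev)

lemma E_par: "x \<noteq> \<theta> \<Longrightarrow> (par x, x) \<in> E" "x \<noteq> \<theta> \<Longrightarrow> (x, par x) \<in> E"
  by (auto simp: E_def parent_edges_def)

text \<open>Horizontal edges do not change this order: along a geodesic from the root every edge
  raises the level and is therefore vertical.\<close>

lemma precD:
  assumes "prec E \<theta> y x" shows "L x \<le> L y" "x = anc (L x) y"
proof -
  obtain n g k where g: "geodesic E (enat n) g" "g 0 = \<theta>" "g n = y" "k \<le> n" "g k = x"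
    using assms by (auto simp: prec_def)
  have lev: "L (g i) = i" if "i \<le> n" for i
    using g that by (auto simp: geodesic_def simp flip: lev_eq)
  have step: "par (g (Suc i)) = g i" if "Suc i \<le> n" for i
    using geodesic_edge[OF g(1), of i] that lev[of i] lev[of "Suc i"] by (intro E_down) auto
  have "anc k (g j) = g k" if "k \<le> j" "j \<le> n" for j
    using that
  proof (induction j)
    case 0
    then show ?case using lev[of 0] g by simp
  next
    case (Suc j)
    show ?case
    proof (cases "k = Suc j")
      case True
      then show ?thesis using lev[of "Suc j"] Suc.prems anc_self by metis
    next
      case False
      then have "anc k (g (Suc j)) = anc k (par (g (Suc j)))"
        using Suc.prems lev[of "Suc j"] by (intro anc_par[symmetric]) auto
      then show ?thesis using step[of j] Suc False by simp
    qed
  qed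
  from this[of n] show "L x \<le> L y" "x = anc (L x) y" using g lev[of k] lev[of n] by auto
qed

lemma prec_anc:
  assumes "k \<le> L y" shows "prec E \<theta> y (anc k y)"
proof -
  have "geodesic E (enat (L y)) (\<lambda>i. anc i y)"
  proof (rule geodesicI)
    fix i assume "enat (Suc i) \<le> enat (L y)"
    then have i: "Suc i \<le> L y" by simp
    then have "anc (Suc i) y \<noteq> \<theta>" using L_anc[OF i] L_root by (metis nat.distinct(1))
    then show "(anc i y, anc (Suc i) y) \<in> E" using E_par(1)[of "anc (Suc i) y"] par_anc[OF i] by simp
  next
    fix n assume "enat n \<le> enat (L y)"
    then show "\<exists>n'\<ge>n. enat n' \<le> enat (L y) \<and> n' \<le> gdist E (anc 0 y) (anc n' y)"
      by (intro exI[of _ "L y"]) (auto simp: lev_eq)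
  qed
  then show ?thesis unfolding prec_def using assms
    by (intro exI[of _ "L y"] exI[of _ "\<lambda>i. anc i y"]) auto
qed

lemma root_ray_iff: "root_ray E \<theta> g \<longleftrightarrow> ray g"
proof
  assume g: "root_ray E \<theta> g"
  then have lev: "L (g i) = i" for i
    by (auto simp: root_ray_def geodesic_def simp flip: lev_eq)
  moreover have "par (g (Suc i)) = g i" for i
    using geodesic_edge[of \<infinity> g i] g lev by (intro E_down) (auto simp: root_ray_def)
  ultimately show "ray g" by (simp add: ray_def)
next
  assume g: "ray g"
  then have g0: "g 0 = \<theta>" using L_eq_0[of "g 0"] by (simp add: ray_L)
  have "geodesic E \<infinity> g"
  proof (rule geodesicI)
    fix i
    have "L (g (Suc i)) = Suc i" using g by (rule ray_L)
    then have "g (Suc i) \<noteq> \<theta>" using L_root by (metis nat.distinct(1))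
    then show "(g i, g (Suc i)) \<in> E" using g E_par(1)[of "g (Suc i)"] by (simp add: ray_def)
  next
    fix n show "\<exists>n'\<ge>n. enat n' \<le> \<infinity> \<and> n' \<le> gdist E (g 0) (g n')"
      using g by (intro exI[of _ n]) (simp add: g0 lev_eq ray_L)
  qed
  then show "root_ray E \<theta> g" using g0 by (simp add: root_ray_def)
qed

section \<open>The visual metric and convergence to an end\<close>

lemma visual_le_near:
  assumes "near j x y" "0 < a" shows "visual E \<theta> a x y \<le> exp (- a * (j - 1 / 2))"
proof -
  have "real j - 1 / 2 \<le> gromov E \<theta> x y" using gromov_J(1)[of x y] near_le_J[OF assms(1)] by linarith
  then show ?thesis using assms(2) by (simp add: visual_def)
qed

text \<open>The hypothesis \<open>j \<le> L x\<close> takes care of \<open>x = y\<close>, where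
  \<open>visual\<close> is \<open>0\<close> by convention.\<close>

lemma visual_near:
  assumes "visual E \<theta> a x y < exp (- a * (real j + hyp_const))" "0 < a" "j \<le> L x"
  shows "near j x y"
proof (cases "x = y")
  case False
  then have "real j + hyp_const \<le> gromov E \<theta> x y" using assms by (simp add: visual_def)
  then show ?thesis by (rule J_ge_gromov)
qed (use assms in \<open>auto simp: near_self\<close>)

lemma visual_small:
  assumes "0 < a" "0 < \<epsilon>"
  obtains j :: nat where "exp (- a * (j - 1 / 2)) < \<epsilon>"
proof -
  obtain j :: nat where j: "- ln \<epsilon> / a + 1 / 2 < j" using reals_Archimedean2 by blast
  then have "- ln \<epsilon> < (real j - 1 / 2) * a" using assms by (simp add: pos_divide_less_eq[symmetric] less_diff_eq)
  then have "- a * (j - 1 / 2) < ln \<epsilon>" by (simp add: mult.commute)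
  then have "exp (- a * (j - 1 / 2)) < exp (ln \<epsilon>)" by (simp only: exp_less_cancel_iff)
  then show ?thesis using that assms by simp
qed

lemma tends_to_end_visual:
  assumes "tends_to_end t r" "tends_to_end t' r" "0 < a" "0 < \<epsilon>"
  shows "\<exists>N. \<forall>n\<ge>N. \<forall>n'\<ge>N. visual E \<theta> a (t n) (t' n') < \<epsilon>"
proof -
  obtain j :: nat where j: "exp (- a * (j - 1 / 2)) < \<epsilon>" using visual_small assms by blast
  obtain N where N: "\<And>n. n \<ge> N \<Longrightarrow> near (j + m) (t n) (r (j + m)) \<and> near (j + m) (t' n) (r (j + m))"
    using assms(1,2) unfolding tends_to_end_def eventually_sequentially by (meson le_trans nat_le_linear)
  have "visual E \<theta> a (t n) (t' n') < \<epsilon>" if "n \<ge> N" "n' \<ge> N" for n n'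
  proof -
    have "near (j + m - m) (t n) (t' n')" using N that near_sym by (meson near_trans)
    then show ?thesis using visual_le_near[of j "t n" "t' n'" a] assms(3) j by simp
  qed
  then show ?thesis by blast
qed

lemma tends_to_end_L: "tends_to_end t r \<Longrightarrow> \<forall>\<^sub>F n in sequentially. j \<le> L (t n)"
  unfolding tends_to_end_def by (rule eventually_mono[of "\<lambda>n. near j (t n) (r j)"]) (auto simp: near_def)

text \<open>Small visual distance amounts to nearness at a deep level, and chaining two such
  relations loses only \<open>m\<close> levels. So sequences equivalent to \<open>\<sigma>\<close>
  are those converging to the same end.\<close>

lemma visual_class_iff:
  assumes r: "ray r" and \<sigma>: "tends_to_end \<sigma> r" and a: "0 < a"
  shows "t \<in> visual_class E \<theta> a \<sigma> \<longleftrightarrow> tends_to_end t r"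
proof
  assume t: "t \<in> visual_class E \<theta> a \<sigma>"
  show "tends_to_end t r"
    unfolding tends_to_end_def
  proof
    fix j
    have "(\<lambda>n. visual E \<theta> a (\<sigma> n) (t n)) \<longlonglongrightarrow> 0" using t by (simp add: visual_class_def)
    then have "\<forall>\<^sub>F n in sequentially. visual E \<theta> a (\<sigma> n) (t n) < exp (- a * (real (j + m) + hyp_const))"
      by (rule order_tendstoD) simp
    moreover have "\<forall>\<^sub>F n in sequentially. j + m \<le> L (\<sigma> n)" using \<sigma> by (rule tends_to_end_L)
    moreover have "\<forall>\<^sub>F n in sequentially. near (j + m) (\<sigma> n) (r (j + m))" using \<sigma> by (simp add: tends_to_end_def)
    ultimately show "\<forall>\<^sub>F n in sequentially. near j (t n) (r j)"
    proof eventually_elim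
      case (elim n)
      then have "near (j + m) (t n) (\<sigma> n)" using visual_near[of a "\<sigma> n" "t n" "j + m"] a near_sym by blast
      from near_trans[OF this elim(3)] have "near j (t n) (r (j + m))" by simp
      then show ?case using near_ray[OF r, of j "j + m"] by simp
    qed
  qed
next
  assume t: "tends_to_end t r"
  have "visual_Cauchy E \<theta> a t"
    unfolding visual_Cauchy_def using tends_to_end_visual[OF t t a] by blast
  moreover have "(\<lambda>n. visual E \<theta> a (\<sigma> n) (t n)) \<longlonglongrightarrow> 0"
  proof (rule LIMSEQ_I)
    fix \<epsilon> :: real assume "0 < \<epsilon>"
    then obtain N where "\<forall>n\<ge>N. \<forall>n'\<ge>N. visual E \<theta> a (\<sigma> n) (t n') < \<epsilon>"
      using tends_to_end_visual[OF \<sigma> t a] by blast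
    moreover have "0 \<le> visual E \<theta> a x y" for x y by (simp add: visual_def)
    ultimately show "\<exists>no. \<forall>n\<ge>no. norm (visual E \<theta> a (\<sigma> n) (t n) - 0) < \<epsilon>" by auto
  qed
  ultimately show "t \<in> visual_class E \<theta> a \<sigma>" by (simp add: visual_class_def)
qed

lemma visual_class_ray_boundary:
  assumes "ray r" "0 < a" shows "visual_class E \<theta> a r \<in> hyperbolic_boundary E \<theta> a"
proof -
  have r: "tends_to_end r r" using assms(1) by (rule ray_tends_to_end)
  have "visual_Cauchy E \<theta> a r" unfolding visual_Cauchy_def using tends_to_end_visual[OF r r assms(2)] by blast
  moreover have "\<not> (\<lambda>n. visual E \<theta> a (r n) x) \<longlonglongrightarrow> 0" for x
  proof
    assume "(\<lambda>n. visual E \<theta> a (r n) x) \<longlonglongrightarrow> 0"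
    then have "\<forall>\<^sub>F n in sequentially. visual E \<theta> a (r n) x < exp (- a * L x)"
      by (rule order_tendstoD) simp
    moreover have "\<forall>\<^sub>F n in sequentially. Suc (L x) \<le> L (r n)" using r by (rule tends_to_end_L)
    ultimately have "\<forall>\<^sub>F n in sequentially. False"
    proof eventually_elim
      case (elim n)
      have "r n \<noteq> x" using elim by auto
      moreover have "gromov E \<theta> (r n) x \<le> L x"
        using gromov_le[of x "r n"] gdist_sym[of x "r n"] by (simp add: gromov_def add.commute)
      ultimately show ?case using elim assms(2) by (simp add: visual_def)
    qed
    then show False by simp
  qed
  ultimately show ?thesis by (auto simp: hyperbolic_boundary_def)
qed

text \<open>If all late terms agreed, the sequence would converge in \<open>X\<close>. So every late
  term has a different late partner, and the bound of the Gromov product by the level turns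
  closeness into depth.\<close>

lemma boundary_sequence_levels:
  assumes \<sigma>: "visual_Cauchy E \<theta> a \<sigma>" "\<not> (\<exists>x. (\<lambda>n. visual E \<theta> a (\<sigma> n) x) \<longlonglongrightarrow> 0)" and a: "0 < a"
  shows "\<exists>N. \<forall>n\<ge>N. j \<le> L (\<sigma> n)"
proof -
  obtain N where N: "\<And>n n'. n \<ge> N \<Longrightarrow> n' \<ge> N \<Longrightarrow> visual E \<theta> a (\<sigma> n) (\<sigma> n') < exp (- a * j)"
    using \<sigma>(1) unfolding visual_Cauchy_def by (meson exp_gt_zero)
  have "j \<le> L (\<sigma> n)" if n: "n \<ge> N" for n
  proof -
    have "\<exists>n'\<ge>N. \<sigma> n' \<noteq> \<sigma> n"
    proof (rule ccontr)
      assume "\<not> ?thesis"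
      then have "\<forall>\<^sub>F k in sequentially. visual E \<theta> a (\<sigma> k) (\<sigma> n) = 0"
        by (auto simp: eventually_sequentially visual_def)
      then have "(\<lambda>k. visual E \<theta> a (\<sigma> k) (\<sigma> n)) \<longlonglongrightarrow> 0" by (rule tendsto_eventually)
      then show False using \<sigma>(2) by blast
    qed
    then obtain n' where n': "n' \<ge> N" "\<sigma> n \<noteq> \<sigma> n'" by metis
    have "j < gromov E \<theta> (\<sigma> n) (\<sigma> n')" using N[OF n n'(1)] n'(2) a by (simp add: visual_def)
    then show ?thesis using gromov_le[of "\<sigma> n" "\<sigma> n'"] by linarith
  qed
  then show ?thesis by blast
qed

lemma boundary_sequence_near:
  assumes \<sigma>: "visual_Cauchy E \<theta> a \<sigma>" "\<not> (\<exists>x. (\<lambda>n. visual E \<theta> a (\<sigma> n) x) \<longlonglongrightarrow> 0)" and a: "0 < a"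
  shows "\<exists>N. \<forall>n\<ge>N. \<forall>n'\<ge>N. near j (\<sigma> n) (\<sigma> n')"
proof -
  obtain N where N: "\<And>n. n \<ge> N \<Longrightarrow> j \<le> L (\<sigma> n)" using boundary_sequence_levels[OF assms] by blast
  obtain N' where N': "\<And>n n'. n \<ge> N' \<Longrightarrow> n' \<ge> N' \<Longrightarrow>
      visual E \<theta> a (\<sigma> n) (\<sigma> n') < exp (- a * (real j + hyp_const))"
    using \<sigma>(1) unfolding visual_Cauchy_def by (meson exp_gt_zero)
  show ?thesis
    by (rule exI[of _ "max N N'"]) (auto intro!: visual_near[of a] N N' a)
qed

text \<open>\<open>near j x (r n)\<close> requires \<open>j \<le> L x\<close> and then depends on
  \<open>r j\<close> alone, so \<open>J x (r n)\<close> is constant from \<open>n = L x\<close> on;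
  this is its value.\<close>

definition J_end :: "'x \<Rightarrow> (nat \<Rightarrow> 'x) \<Rightarrow> nat" where "J_end x r = J x (r (L x))"

lemma J_ray: "ray r \<Longrightarrow> L x \<le> n \<Longrightarrow> J x (r n) = J_end x r"
proof -
  assume r: "ray r" "L x \<le> n"
  have "near j x (r n) \<longleftrightarrow> near j x (r (L x))" for j
  proof (cases "j \<le> L x")
    case True
    then show ?thesis using near_ray[OF r(1), of j n x] near_ray[OF r(1), of j "L x" x] r(2) by simp
  qed (simp add: near_def)
  then show ?thesis by (simp add: J_def J_end_def)
qed

lemma J_end_le: "J_end x r \<le> L x" by (simp add: J_end_def J_le)

lemma J_tends_to_end:
  assumes "ray r" "tends_to_end t r"
  shows "\<forall>\<^sub>F n in sequentially. J x (t n) \<le> J_end x r + m \<and> J_end x r \<le> J x (t n) + m"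
proof -
  \<comment> \<open>\<open>J x _\<close> is at most \<open>L x\<close>, so nearness of
    \<open>t n\<close> to the ray at level \<open>N\<close> never decides the minimum in
    \<open>J_trans\<close>.\<close>
  define N where "N = L x + m"
  have "\<forall>\<^sub>F n in sequentially. near N (t n) (r N)" using assms(2) by (simp add: tends_to_end_def)
  then show ?thesis
  proof eventually_elim
    case (elim n)
    have N: "N \<le> J (t n) (r N)" "J x (r N) = J_end x r"
      using near_le_J[OF elim] J_ray[OF assms(1), of x N] by (auto simp: N_def)
    have "min (J x (t n)) (J (t n) (r N)) - m \<le> J x (r N)" "min (J x (r N)) (J (r N) (t n)) - m \<le> J x (t n)"
      by (rule J_trans)+
    moreover have "J x (t n) \<le> N" "J_end x r \<le> N"
      using J_le(1)[of x "t n"] J_end_le[of x r] by (auto simp: N_def)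
    ultimately show ?case using N J_sym[of "r N" "t n"] by (auto simp: min_def)
  qed
qed

text \<open>Along a ray one step raises the level by one and the distance to \<open>x\<close> by at
  most one, so the Gromov product increases and the limit exists.\<close>

lemma gromov_limit:
  assumes r: "ray r" and g: "ray g" "tends_to_end g r"
  shows "real (J_end x r) - m - 1 / 2 \<le> lim (\<lambda>n. gromov E \<theta> x (g n))"
    "lim (\<lambda>n. gromov E \<theta> x (g n)) \<le> real (J_end x r) + m + hyp_const"
proof -
  have step: "gromov E \<theta> x (g n) \<le> gromov E \<theta> x (g (Suc n))" for n
  proof -
    have "L (g (Suc n)) = Suc n" using g(1) by (rule ray_L)
    then have "g (Suc n) \<noteq> \<theta>" using L_root by (metis nat.distinct(1))
    then have "(g n, g (Suc n)) \<in> E" using g(1) E_par(1)[of "g (Suc n)"] by (simp add: ray_def)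
    then have "gdist E x (g (Suc n)) \<le> Suc (gdist E x (g n))"
      using gdist_triangle[of x "g (Suc n)" "g n"] gdist_edge_le[of "g n" "g (Suc n)"] by linarith
    then show ?thesis using g(1) by (simp add: gromov_def lev_eq ray_L)
  qed
  have "convergent (\<lambda>n. gromov E \<theta> x (g n))"
  proof (rule Bseq_mono_convergent)
    have "norm (gromov E \<theta> x (g n)) \<le> L x + 1" for n
      using gromov_le[of x "g n"] gromov_J(1)[of x "g n"] by auto
    then show "Bseq (\<lambda>n. gromov E \<theta> x (g n))" by (rule BseqI')
    show "\<forall>n n'. n \<le> n' \<longrightarrow> gromov E \<theta> x (g n) \<le> gromov E \<theta> x (g n')"
      using lift_Suc_mono_le[of "\<lambda>n. gromov E \<theta> x (g n)", OF step] by blast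
  qed
  then have lim: "(\<lambda>n. gromov E \<theta> x (g n)) \<longlonglongrightarrow> lim (\<lambda>n. gromov E \<theta> x (g n))"
    by (simp add: convergent_LIMSEQ_iff)
  have ev: "\<forall>\<^sub>F n in sequentially. real (J_end x r) - m - 1 / 2 \<le> gromov E \<theta> x (g n) \<and>
      gromov E \<theta> x (g n) \<le> real (J_end x r) + m + hyp_const"
    using J_tends_to_end[OF r g(2), of x]
  proof eventually_elim
    case (elim n)
    then show ?case using gromov_J[of x "g n"] by linarith
  qed
  show "real (J_end x r) - m - 1 / 2 \<le> lim (\<lambda>n. gromov E \<theta> x (g n))"
    by (rule tendsto_lowerbound[OF lim], rule eventually_mono[OF ev]) simp_all
  show "lim (\<lambda>n. gromov E \<theta> x (g n)) \<le> real (J_end x r) + m + hyp_const"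
    by (rule tendsto_upperbound[OF lim], rule eventually_mono[OF ev]) simp_all
qed

text \<open>\<open>prec\<close> relates only the ends of the vertical parts. Comparing numbers of
  steps with differences of levels forces the first part to be vertical and fixes the length of the
  last one; the total length is then that of an up-across-down geodesic, so \<open>J_ge\<close>
  applies.\<close>

lemma vhv_geodesic_shape:
  assumes g: "geodesic E N g" and ij: "i \<le> j" "j \<le> t" "enat t \<le> N"
    and prec_i: "prec E \<theta> (g 0) (g i)" and lev: "\<And>k. i \<le> k \<Longrightarrow> k \<le> j \<Longrightarrow> L (g k) = n"
    and prec_j: "prec E \<theta> (g t) (g j)"
  shows "g i = anc n (g 0)" "n \<le> L (g 0)" "n \<le> L (g t)" "j - i \<le> 4 * m + 1"
    "n \<le> J (g 0) (g t) + hyp_const" "J (g 0) (g t) \<le> n"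
    "\<And>k. k < i \<Longrightarrow> g (Suc k) = par (g k)" "\<And>k. i \<le> k \<Longrightarrow> k < j \<Longrightarrow> (g k, g (Suc k)) \<in> H"
proof -
  have d: "gdist E (g p) (g q) = q - p" if "p \<le> q" "q \<le> t" for p q
    using g that ij(3) by (simp add: geodesic_def) (meson enat_ord_simps(1) order_trans)
  have edge: "(g k, g (Suc k)) \<in> E" if "Suc k \<le> t" for k
    using d[of k "Suc k"] that by (intro gdist_eq_1D) auto
  have Ln: "L (g i) = n" "L (g j) = n" using lev ij by auto
  show gi: "g i = anc n (g 0)" and nx: "n \<le> L (g 0)" using precD[OF prec_i] Ln by auto
  have gj: "g j = anc n (g t)" and ny: "n \<le> L (g t)" using precD[OF prec_j] Ln by auto
  show "n \<le> L (g t)" by (rule ny)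
  have Hk: "(g k, g (Suc k)) \<in> H" if "i \<le> k" "k < j" for k
  proof -
    have "(g k, g (Suc k)) \<in> E" using edge ij that by simp
    moreover have "L (g k) = n" "L (g (Suc k)) = n" using lev that by auto
    ultimately show ?thesis using L_Suc by (elim E_cases) fastforce+
  qed
  then show "\<And>k. i \<le> k \<Longrightarrow> k < j \<Longrightarrow> (g k, g (Suc k)) \<in> H" .
  have path: "(anc n (g 0), anc n (g t)) \<in> H ^^ (j - i)"
    using path_relpow[OF ij(1), of g H] Hk gi gj by simp
  have i_eq: "i = L (g 0) - n"
  proof (rule antisym)
    have "gdist E (g 0) (g i) \<le> L (g 0) - n" unfolding gi by (intro gdist_le anc_walk nx)
    then show "i \<le> L (g 0) - n" using d[of 0 i] ij by simp
    have "L (g 0) \<le> gdist E (g i) (g 0) + n"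
      using gdist_triangle[of \<theta> "g 0" "g i"] Ln by (simp add: lev_eq)
    then show "L (g 0) - n \<le> i" using d[of 0 i] ij gdist_sym[of "g i" "g 0"] by simp
  qed
  have t_eq: "t - j = L (g t) - n"
  proof (rule antisym)
    have "gdist E (g t) (g j) \<le> L (g t) - n" unfolding gj by (intro gdist_le anc_walk ny)
    then show "t - j \<le> L (g t) - n" using d[of j t] ij gdist_sym[of "g t" "g j"] by simp
    have "L (g t) \<le> n + gdist E (g j) (g t)"
      using gdist_triangle[of \<theta> "g t" "g j"] Ln by (simp add: lev_eq)
    then show "L (g t) - n \<le> t - j" using d[of j t] ij by simp
  qed
  have "L (g 0) + L (g t) + (j - i) \<le> gdist E (g 0) (g t) + 2 * n"
    using d[of 0 t] i_eq t_eq nx ny ij by simp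
  from J_ge[OF nx ny path this]
  show "j - i \<le> 4 * m + 1" "n \<le> J (g 0) (g t) + hyp_const" "J (g 0) (g t) \<le> n" by auto
  show "g (Suc k) = par (g k)" if k: "k < i" for k
  proof -
    have lev': "L (g k') = n + i - k'" if "k' \<le> i" for k'
    proof (rule antisym)
      show "L (g k') \<le> n + i - k'"
        using gdist_triangle[of \<theta> "g k'" "g i"] d[of k' i] gdist_sym[of "g i" "g k'"] Ln that ij by (simp add: lev_eq)
      have "L (g 0) \<le> L (g k') + k'"
        using gdist_triangle[of \<theta> "g 0" "g k'"] d[of 0 k'] gdist_sym[of "g k'" "g 0"] that ij by (simp add: lev_eq)
      then show "n + i - k' \<le> L (g k')" using i_eq nx by simp
    qed
    have "(g (Suc k), g k) \<in> E" using edge[of k] k ij E_sym by simp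
    then show ?thesis using lev'[of k] lev'[of "Suc k"] k by (intro E_down[symmetric]) auto
  qed
qed

text \<open>The witness goes up from \<open>x\<close> to level \<open>k\<close>, follows a horizontal path of length \<open>h\<close>, and
  then descends along \<open>d\<close>.\<close>

lemma vhv_geodesic_exists:
  assumes k: "k \<le> L x" and h: "(anc k x, d 0) \<in> H ^^ h"
    and d: "\<And>t. enat t \<le> T \<Longrightarrow> L (d t) = k + t" "\<And>t. enat (Suc t) \<le> T \<Longrightarrow> par (d (Suc t)) = d t"
    and far: "\<And>t. enat t \<le> T \<Longrightarrow> \<exists>t'\<ge>t. enat t' \<le> T \<and> L x - k + h + t' \<le> gdist E x (d t')"
  shows "\<exists>g. geodesic E (enat (L x - k + h) + T) g \<and> g 0 = x \<and> (\<forall>t. g (L x - k + h + t) = d t) \<and>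
    (\<exists>i j. i \<le> j \<and> enat j \<le> enat (L x - k + h) + T \<and> prec E \<theta> (g 0) (g i) \<and>
      (\<forall>p\<in>{i..j}. L (g p) = k) \<and>
      (\<forall>p\<ge>j. enat p \<le> enat (L x - k + h) + T \<longrightarrow> prec E \<theta> (g p) (g j)))"
proof -
  obtain f where f: "f 0 = anc k x" "f h = d 0" "\<And>i. i < h \<Longrightarrow> (f i, f (Suc i)) \<in> H"
    using h unfolding relpow_fun_conv by blast
  define i j where "i = L x - k" and "j = L x - k + h"
  define g where "g p = (if p \<le> i then anc (L x - p) x else if p \<le> j then f (p - i) else d (p - j))" for p
  \<comment> \<open>Each of the three descriptions of \<open>g\<close> is also valid at the seams,
    so every edge lies within one piece.\<close>
  have g_up: "g p = anc (L x - p) x" if "p \<le> i" for p using that by (simp add: g_def)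
  have g_mid: "g p = f (p - i)" if "i \<le> p" "p \<le> j" for p
    using that f(1) k by (cases "p = i") (auto simp: g_def i_def)
  have g_down: "g p = d (p - j)" if "j \<le> p" for p
    using that f(1,2) k by (cases "p = j"; cases "h = 0") (auto simp: g_def i_def j_def)
  have f_lev: "L (f q) = k" if "q \<le> h" for q
    using that
  proof (induction q)
    case 0
    then show ?case using f(1) k by (simp add: L_anc)
  next
    case (Suc q)
    then show ?case using H_lev[OF f(3)[of q]] by simp
  qed
  have edge: "(g p, g (Suc p)) \<in> E" if p: "enat (Suc p) \<le> enat j + T" for p
  proof -
    consider "Suc p \<le> i" | "i \<le> p" "Suc p \<le> j" | "j \<le> p" by (force simp: i_def j_def)
    then show ?thesis
    proof cases
      case 1
      then have *: "Suc (L x - Suc p) = L x - p" "Suc (L x - Suc p) \<le> L x" by (auto simp: i_def)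
      have "L (anc (L x - p) x) = L x - p" by (simp add: L_anc)
      then have "anc (L x - p) x \<noteq> \<theta>" using * L_root by (metis nat.distinct(1))
      then show ?thesis using E_par(2)[of "anc (L x - p) x"] par_anc[of "L x - Suc p" x] * 1 by (simp add: g_up)
    next
      case 2
      then have "(f (p - i), f (Suc (p - i))) \<in> H" by (intro f) (auto simp: i_def j_def)
      then show ?thesis using 2 by (simp add: g_mid Suc_diff_le E_def)
    next
      case 3
      have "enat (Suc (p - j)) \<le> T"
      proof (cases T)
        case (enat T')
        then show ?thesis using p 3 by simp
      qed simp
      then have "par (d (Suc (p - j))) = d (p - j)" "L (d (Suc (p - j))) = k + Suc (p - j)" using d by auto
      moreover from this(2) have "d (Suc (p - j)) \<noteq> \<theta>" using L_root by (metis add_Suc_right nat.distinct(1))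
      ultimately have "(d (p - j), d (Suc (p - j))) \<in> E" using E_par(1)[of "d (Suc (p - j))"] by simp
      then show ?thesis using 3 by (simp add: g_down Suc_diff_le)
    qed
  qed
  have g0: "g 0 = x" by (simp add: g_def)
  have geo: "geodesic E (enat j + T) g"
  proof (rule geodesicI)
    fix p assume "enat (Suc p) \<le> enat j + T"
    then show "(g p, g (Suc p)) \<in> E" by (rule edge)
  next
    fix n assume n: "enat n \<le> enat j + T"
    have "enat (n - j) \<le> T"
    proof (cases T)
      case (enat T')
      then show ?thesis using n by simp
    qed simp
    from far[OF this] obtain t' where t': "t' \<ge> n - j" "enat t' \<le> T" "j + t' \<le> gdist E x (d t')"
      by (auto simp: j_def)
    then show "\<exists>n'\<ge>n. enat n' \<le> enat j + T \<and> n' \<le> gdist E (g 0) (g n')"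
      by (intro exI[of _ "j + t'"]) (auto simp: g0 g_down simp flip: plus_enat_simps(1))
  qed
  have down: "\<forall>t. g (j + t) = d t" by (simp add: g_down)
  have prec_i: "prec E \<theta> (g 0) (g i)" using prec_anc[OF k] k by (simp add: g0 g_up i_def)
  have lev: "L (g p) = k" if "i \<le> p" "p \<le> j" for p
    using that f_lev[of "p - i"] by (simp add: g_mid) (simp add: i_def j_def)
  have prec_j: "prec E \<theta> (g p) (g j)" if "j \<le> p" "enat p \<le> enat j + T" for p
  proof -
    have anc: "enat t \<le> T \<Longrightarrow> anc k (d t) = d 0" for t
    proof (induction t)
      case 0
      then show ?case using d(1)[of 0] anc_self[of "d 0"] by simp
    next
      case (Suc t)
      then have t: "enat t \<le> T" by (meson enat_ord_simps(1) le_SucI order_refl order_trans)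
      have "anc k (d (Suc t)) = anc k (par (d (Suc t)))" using d(1)[OF Suc.prems] by (intro anc_par[symmetric]) simp
      then show ?case using Suc.IH[OF t] d(2)[OF Suc.prems] by simp
    qed
    have T: "enat (p - j) \<le> T"
    proof (cases T)
      case (enat T')
      then show ?thesis using that by simp
    qed simp
    have "prec E \<theta> (d (p - j)) (anc k (d (p - j)))" using d(1)[OF T] by (intro prec_anc) simp
    then show ?thesis using that anc[OF T] by (simp add: g_down)
  qed
  have "\<exists>i j'. i \<le> j' \<and> enat j' \<le> enat j + T \<and> prec E \<theta> (g 0) (g i) \<and>
      (\<forall>p\<in>{i..j'}. L (g p) = k) \<and> (\<forall>p\<ge>j'. enat p \<le> enat j + T \<longrightarrow> prec E \<theta> (g p) (g j'))"
  proof (rule exI[of _ i], rule exI[of _ j], intro conjI ballI allI impI)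
    show "i \<le> j" by (simp add: i_def j_def)
    show "enat j \<le> enat j + T" by (cases T) auto
  qed (use prec_i lev prec_j in auto)
  then show ?thesis unfolding j_def[symmetric] using geo g0 down by blast
qed

end

section \<open>Estimates for natural walks\<close>

context natural_walk
begin

lemma koenig:
  fixes t :: "nat \<Rightarrow> 'a"
  assumes lev: "\<And>j. \<exists>N. \<forall>n\<ge>N. j \<le> L (t n)"
  shows "\<exists>r. ray r \<and> (\<forall>j. infinite {n. j \<le> L (t n) \<and> anc j (t n) = r j})"
proof -
  define A where "A j x = {n. j \<le> L (t n) \<and> anc j (t n) = x}" for j x
  have "\<exists>r. \<forall>j. (L (r j) = j \<and> infinite (A j (r j))) \<and> par (r (Suc j)) = r j"
  proof (rule dependent_nat_choice)
    have "A 0 \<theta> = UNIV" by (auto simp: A_def)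
    then show "\<exists>x. L x = 0 \<and> infinite (A 0 x)"
      using infinite_UNIV_nat by (intro exI[of _ \<theta>]) simp
  next
    fix x j assume x: "L x = j \<and> infinite (A j x)"
    obtain N where N: "\<And>n. n \<ge> N \<Longrightarrow> Suc j \<le> L (t n)" using lev by blast
    define I where "I = A j x - {..<N}"
    have I: "infinite I" using x by (simp add: I_def)
    have child: "anc (Suc j) (t n) \<in> children x" if "n \<in> I" for n
    proof -
      have n: "Suc j \<le> L (t n)" "anc j (t n) = x" using that N by (auto simp: I_def A_def)
      have "L (anc (Suc j) (t n)) = Suc j" using n(1) by (rule L_anc)
      then have "anc (Suc j) (t n) \<noteq> \<theta>" using L_root by (metis nat.distinct(1))
      then show ?thesis using par_anc[OF n(1)] n(2) by (simp add: children_def)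
    qed
    then have "(\<lambda>n. anc (Suc j) (t n)) ` I \<subseteq> children x" by blast
    then have "finite ((\<lambda>n. anc (Suc j) (t n)) ` I)" using finite_children finite_subset by blast
    from pigeonhole_infinite[OF I this] obtain n0
      where n0: "n0 \<in> I" "infinite {n \<in> I. anc (Suc j) (t n) = anc (Suc j) (t n0)}" by blast
    define z where "z = anc (Suc j) (t n0)"
    have "{n \<in> I. anc (Suc j) (t n) = z} \<subseteq> A (Suc j) z" using N by (auto simp: I_def A_def)
    then have "infinite (A (Suc j) z)" using n0(2) finite_subset unfolding z_def by blast
    moreover have "z \<in> children x" using child[OF n0(1)] by (simp add: z_def)
    ultimately show "\<exists>z. (L z = Suc j \<and> infinite (A (Suc j) z)) \<and> par z = x"
      using x L_child[of z x] by (intro exI[of _ z]) (auto simp: children_def)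
  qed
  then show ?thesis by (auto simp: ray_def A_def)
qed

text \<open>The ray from \<open>koenig\<close> captures, on each level, the ancestors of infinitely
  many terms only. The Cauchy property extends this to nearness of all late terms, and
  \<open>visual_class_iff\<close> then describes the whole class.\<close>

lemma boundary_end:
  assumes p: "p \<in> hyperbolic_boundary E \<theta> a" and a: "0 < a"
  shows "\<exists>r. ray r \<and> (\<forall>t. t \<in> p \<longleftrightarrow> tends_to_end t r)"
proof -
  obtain t where t: "visual_Cauchy E \<theta> a t" "\<not> (\<exists>x. (\<lambda>n. visual E \<theta> a (t n) x) \<longlonglongrightarrow> 0)"
    "p = visual_class E \<theta> a t" using p by (auto simp: hyperbolic_boundary_def)
  obtain r where r: "ray r" "\<And>j. infinite {n. j \<le> L (t n) \<and> anc j (t n) = r j}"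
    using koenig[OF boundary_sequence_levels[OF t(1,2) a]] by blast
  have "tends_to_end t r"
    unfolding tends_to_end_def
  proof
    fix j
    obtain N where N: "\<And>n n'. n \<ge> N \<Longrightarrow> n' \<ge> N \<Longrightarrow> near (j + m) (t n) (t n')"
      using boundary_sequence_near[OF t(1,2) a] by blast
    obtain n' where n': "n' \<ge> N" "j + m \<le> L (t n')" "anc (j + m) (t n') = r (j + m)"
      using r(2)[of "j + m"] unfolding infinite_nat_iff_unbounded_le by blast
    have "near (j + m) (t n') (r (j + m))"
      using n' r(1) by (simp add: near_def ray_L ray_anc)
    then have "near j (t n) (r j)" if "n \<ge> N" for n
      using near_trans[OF N[OF that n'(1)], of "r (j + m)"] near_ray[OF r(1), of j "j + m"] by simp
    then show "\<forall>\<^sub>F n in sequentially. near j (t n) (r j)" by (auto simp: eventually_sequentially)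
  qed
  then show ?thesis using visual_class_iff[OF r(1) _ a] r(1) t(3) by blast
qed

section \<open>Cell measures and levels along canonical geodesics\<close>

lemma M_shift: "k \<le> L x \<Longrightarrow> n \<le> L x \<Longrightarrow> k \<le> n + C \<Longrightarrow> n \<le> k + C \<Longrightarrow> M (anc n x) \<le> \<Lambda> ^ C * M (anc k x)"
proof -
  assume *: "k \<le> L x" "n \<le> L x" "k \<le> n + C" "n \<le> k + C"
  have 1: "1 * M (anc k x) \<le> \<Lambda> ^ C * M (anc k x)"
    using Lam_ge M_pos[of "anc k x"] by (intro mult_right_mono) auto
  show ?thesis
  proof (cases "n \<le> k")
    case True
    have "M (anc n x) \<le> \<Lambda> ^ (k - n) * M (anc k x)" using True * by (intro M_anc_anc)
    also have "\<dots> \<le> \<Lambda> ^ C * M (anc k x)"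
      using * Lam_ge M_pos[of "anc k x"] by (intro mult_right_mono power_increasing) auto
    finally show ?thesis .
  next
    case False
    then have "M (anc n x) \<le> M (anc k x)" using * by (intro M_anc_anc) auto
    then show ?thesis using 1 by simp
  qed
qed

text \<open>Cells grow on the way up, shrink on the way down, and change by at most a factor
  \<open>\<Lambda>\<close> per horizontal step; there are at most \<open>4 * m + 1\<close> of the
  latter.\<close>

lemma vhv_M_le:
  assumes "geodesic E N g" "i \<le> j" "j \<le> t" "enat t \<le> N" "prec E \<theta> (g 0) (g i)"
    "\<And>k. i \<le> k \<Longrightarrow> k \<le> j \<Longrightarrow> L (g k) = n" "\<And>k. j \<le> k \<Longrightarrow> k \<le> t \<Longrightarrow> prec E \<theta> (g k) (g j)" "q \<le> t"
  shows "M (g q) \<le> \<Lambda> ^ (4 * m + 1) * M (anc n (g 0))"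
proof -
  note shape = vhv_geodesic_shape[OF assms(1-6) assms(7)[OF assms(3) order_refl]]
  have Lam1: "1 * M x \<le> \<Lambda> ^ p * M x" for p x
    using Lam_ge M_pos[of x] by (intro mult_right_mono) auto
  have up: "M (g (i - k)) \<le> M (g i)" if "k \<le> i" for k
    using that
  proof (induction k)
    case (Suc k)
    have "g (i - k) = par (g (i - Suc k))" using shape(7)[of "i - Suc k"] Suc.prems by (simp add: Suc_diff_Suc)
    then show ?case using Suc M_par_ge[of "g (i - Suc k)"] by simp
  qed simp
  have mid: "M (g (i + k)) \<le> \<Lambda> ^ k * M (g i)" if "i + k \<le> j" for k
    using that
  proof (induction k)
    case (Suc k)
    have "(g (i + k), g (Suc (i + k))) \<in> H" using Suc.prems by (intro shape(8)) auto
    then have "M (g (i + Suc k)) \<le> \<Lambda> * M (g (i + k))" using M_H H_sym by simp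
    also have "\<dots> \<le> \<Lambda> * (\<Lambda> ^ k * M (g i))" using Suc Lam_ge by (intro mult_left_mono) auto
    finally show ?case by (simp add: mult.assoc)
  qed simp
  have horizontal: "M (g k) \<le> \<Lambda> ^ (4 * m + 1) * M (g i)" if "i \<le> k" "k \<le> j" for k
  proof -
    have "M (g k) \<le> \<Lambda> ^ (k - i) * M (g i)" using mid[of "k - i"] that by simp
    also have "\<dots> \<le> \<Lambda> ^ (4 * m + 1) * M (g i)"
      using that shape(4) Lam_ge M_pos[of "g i"] by (intro mult_right_mono power_increasing) auto
    finally show ?thesis .
  qed
  consider "q \<le> i" | "i \<le> q" "q \<le> j" | "j \<le> q" by linarith
  then show ?thesis
  proof cases
    case 1
    then show ?thesis using up[of "i - q"] Lam1[of "g i" "4 * m + 1"] shape(1) by simp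
  next
    case 2
    then show ?thesis using horizontal[of q] shape(1) by simp
  next
    case 3
    have "L (g j) \<le> L (g q)" "g j = anc (L (g j)) (g q)" using precD assms(7)[OF 3 assms(8)] by auto
    then have "M (g q) \<le> M (g j)" using M_anc_anc(1)[of "L (g j)" "L (g q)" "g q"] by simp
    then show ?thesis using horizontal[of j] assms(2) shape(1) by simp
  qed
qed

text \<open>Treats both kinds of endpoint together: up to bounded errors, \<open>k\<close> will be
  the extended Gromov product as well as the level of the horizontal part of canonical geodesics. It
  is a relation because the ray representing a boundary point need not be unique.\<close>

definition target_level :: "('a \<Rightarrow> 'k set) \<Rightarrow> real \<Rightarrow> 'a \<Rightarrow> 'a + 'k \<Rightarrow> nat \<Rightarrow> bool" where
  "target_level \<Phi> a x e k \<longleftrightarrow> (case e of Inl y \<Rightarrow> k = J x y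
     | Inr \<xi> \<Rightarrow> \<exists>r. ray r \<and> (\<forall>t. t \<in> boundary_point E \<theta> \<Phi> a \<xi> \<longleftrightarrow> tends_to_end t r) \<and> k = J_end x r)"

lemma target_level_le: "target_level \<Phi> a x e k \<Longrightarrow> k \<le> L x"
  by (auto simp: target_level_def J_le J_end_le split: sum.splits)

lemma vhv_exists:
  assumes k: "target_level \<Phi> a x e k"
  shows "\<exists>n N g. vhv_geodesic E \<theta> \<Phi> a x e n N g"
proof (cases e)
  case (Inl y)
  obtain n h where n: "n \<le> L x" "n \<le> L y" "(anc n x, anc n y) \<in> H ^^ h"
    "L x + L y + h \<le> gdist E x y + 2 * n"
    using walk_canonical[OF gdist_walk[of x y]] by blast
  define d where "d t = anc (n + t) y" for t
  have "\<exists>g. geodesic E (enat (L x - n + h) + enat (L y - n)) g \<and> g 0 = x \<and> (\<forall>t. g (L x - n + h + t) = d t) \<and>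
    (\<exists>i j. i \<le> j \<and> enat j \<le> enat (L x - n + h) + enat (L y - n) \<and> prec E \<theta> (g 0) (g i) \<and>
      (\<forall>p\<in>{i..j}. L (g p) = n) \<and>
      (\<forall>p\<ge>j. enat p \<le> enat (L x - n + h) + enat (L y - n) \<longrightarrow> prec E \<theta> (g p) (g j)))"
  proof (rule vhv_geodesic_exists)
    fix t assume "enat t \<le> enat (L y - n)"
    then show "\<exists>t'\<ge>t. enat t' \<le> enat (L y - n) \<and> L x - n + h + t' \<le> gdist E x (d t')"
      using n by (intro exI[of _ "L y - n"]) (auto simp: d_def)
  next
    fix t assume "enat (Suc t) \<le> enat (L y - n)"
    then show "par (d (Suc t)) = d t" using par_anc[of "n + t" y] n by (simp add: d_def)
  qed (use n in \<open>auto simp: d_def L_anc\<close>)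
  then obtain g where g: "geodesic E (enat (L x - n + h + (L y - n))) g" "g 0 = x"
      "\<And>t. g (L x - n + h + t) = d t"
      "\<exists>i j. i \<le> j \<and> enat j \<le> enat (L x - n + h + (L y - n)) \<and> prec E \<theta> (g 0) (g i) \<and>
      (\<forall>p\<in>{i..j}. L (g p) = n) \<and>
      (\<forall>p\<ge>j. enat p \<le> enat (L x - n + h + (L y - n)) \<longrightarrow> prec E \<theta> (g p) (g j))"
    by (auto simp only: plus_enat_simps)
  have "g (L x - n + h + (L y - n)) = y" using g(3)[of "L y - n"] n by (simp add: d_def)
  then have "vhv_geodesic E \<theta> \<Phi> a x e n (enat (L x - n + h + (L y - n))) g"
    unfolding vhv_geodesic_def joins_def using g by (auto simp: Inl lev_eq)
  then show ?thesis by blast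
next
  case (Inr \<xi>)
  then obtain r where r: "ray r" "\<And>t. t \<in> boundary_point E \<theta> \<Phi> a \<xi> \<longleftrightarrow> tends_to_end t r"
    using k by (auto simp: target_level_def)
  have Lr: "L (r i) = i" for i using r(1) by (rule ray_L)
  obtain n h where n: "n \<le> L x" "(anc n x, anc n (r (L x))) \<in> H ^^ h"
    "L x + L (r (L x)) + h \<le> gdist E x (r (L x)) + 2 * n"
    using walk_canonical[OF gdist_walk[of x "r (L x)"]] by blast
  define d where "d t = r (n + t)" for t
  have "\<exists>g. geodesic E (enat (L x - n + h) + \<infinity>) g \<and> g 0 = x \<and> (\<forall>t. g (L x - n + h + t) = d t) \<and>
    (\<exists>i j. i \<le> j \<and> enat j \<le> enat (L x - n + h) + \<infinity> \<and> prec E \<theta> (g 0) (g i) \<and>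
      (\<forall>p\<in>{i..j}. L (g p) = n) \<and>
      (\<forall>p\<ge>j. enat p \<le> enat (L x - n + h) + \<infinity> \<longrightarrow> prec E \<theta> (g p) (g j)))"
  proof (rule vhv_geodesic_exists)
    show "(anc n x, d 0) \<in> H ^^ h" using n(2) ray_anc[OF r(1) n(1)] by (simp add: d_def)
  next
    fix t
    define q where "q = L x + t"
    obtain n' h' where n': "n' \<le> L x" "n' \<le> L (r q)" "(anc n' x, anc n' (r q)) \<in> H ^^ h'"
      "L x + L (r q) + h' \<le> gdist E x (r q) + 2 * n'"
      using walk_canonical[OF gdist_walk[of x "r q"]] by blast
    \<comment> \<open>A shorter way to a later point of the ray would turn at a level
      \<open>n' \<le> L x\<close>. There \<open>r q\<close> and \<open>r (L x)\<close> have the same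
      ancestor, so it would shorten the geodesic to \<open>r (L x)\<close> as well.\<close>
    have "anc n' (r q) = anc n' (r (L x))" using ray_anc[OF r(1)] n' by (simp add: q_def)
    then have "gdist E x (r (L x)) + 2 * n' \<le> L x + L (r (L x)) + h'"
      using n' by (intro gdist_le_horizontal) (auto simp: Lr)
    then have "L x - n + h + (q - n) \<le> gdist E x (r q)" using n' n by (simp add: Lr q_def)
    then show "\<exists>t'\<ge>t. enat t' \<le> \<infinity> \<and> L x - n + h + t' \<le> gdist E x (d t')"
      using n(1) by (intro exI[of _ "q - n"]) (auto simp: d_def q_def)
  qed (use n r in \<open>auto simp: d_def Lr ray_def\<close>)
  then obtain g where g: "geodesic E \<infinity> g" "g 0 = x"
      "\<And>t. g (L x - n + h + t) = d t"
      "\<exists>i j. i \<le> j \<and> enat j \<le> \<infinity> \<and> prec E \<theta> (g 0) (g i) \<and>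
      (\<forall>p\<in>{i..j}. L (g p) = n) \<and> (\<forall>p\<ge>j. enat p \<le> \<infinity> \<longrightarrow> prec E \<theta> (g p) (g j))"
    by (auto simp only: plus_enat_simps)
  have "tends_to_end g r"
    unfolding tends_to_end_def
  proof
    fix j
    show "\<forall>\<^sub>F p in sequentially. near j (g p) (r j)"
    proof (rule eventually_sequentiallyI)
      fix p assume p: "L x - n + h + j \<le> p"
      have "g p = d (p - (L x - n + h))" using g(3)[of "p - (L x - n + h)"] p by simp
      then show "near j (g p) (r j)" using p by (auto simp: d_def intro!: ray_near r(1))
    qed
  qed
  then have "vhv_geodesic E \<theta> \<Phi> a x e n \<infinity> g"
    unfolding vhv_geodesic_def joins_def using g r by (auto simp: Inr lev_eq)
  then show ?thesis by blast
qed

lemma vhv_bounds: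
  assumes k: "target_level \<Phi> a x e k" and g: "vhv_geodesic E \<theta> \<Phi> a x e n N g"
  shows "n \<le> L x" "n \<le> k + (m + hyp_const)" "k \<le> n + (m + hyp_const)"
    "\<exists>i. enat i \<le> N \<and> g i = anc n x"
    "\<And>q. enat q \<le> N \<Longrightarrow> M (g q) \<le> \<Lambda> ^ (4 * m + 1) * M (anc n x)"
proof -
  obtain i j where ij: "i \<le> j" "enat j \<le> N" "prec E \<theta> (g 0) (g i)" "\<And>k. i \<le> k \<Longrightarrow> k \<le> j \<Longrightarrow> L (g k) = n"
    "\<And>k. j \<le> k \<Longrightarrow> enat k \<le> N \<Longrightarrow> prec E \<theta> (g k) (g j)"
    using g by (auto simp: vhv_geodesic_def lev_eq)
  have geo: "geodesic E N g" and g0: "g 0 = x" using g by (auto simp: vhv_geodesic_def joins_def)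
  have shape: "g i = anc n x \<and> n \<le> L x \<and> n \<le> J x (g t) + hyp_const \<and> J x (g t) \<le> n"
    if t: "j \<le> t" "enat t \<le> N" for t
    using vhv_geodesic_shape[OF geo ij(1) t ij(3,4) ij(5)[OF t]] unfolding g0 by auto
  show "n \<le> L x" using shape[of j] ij by auto
  show "\<exists>i. enat i \<le> N \<and> g i = anc n x"
    using shape[of j] ij by (intro exI[of _ i]) (auto intro: order_trans[of "enat i" "enat j"])
  show "M (g q) \<le> \<Lambda> ^ (4 * m + 1) * M (anc n x)" if q: "enat q \<le> N" for q
  proof -
    have "enat (max j q) \<le> N" using q ij(2) by (simp add: max_def)
    then have "\<And>k. k \<le> max j q \<Longrightarrow> enat k \<le> N" by (meson enat_ord_simps(1) order_trans)
    then show ?thesis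
      unfolding g0[symmetric] by (intro vhv_M_le[OF geo ij(1) _ _ ij(3,4) ij(5), where t = "max j q"]) auto
  qed
  \<comment> \<open>When the endpoint is a boundary point, any late vertex of the geodesic stands in
    for it.\<close>
  have "\<exists>t. j \<le> t \<and> enat t \<le> N \<and> J x (g t) \<le> k + m \<and> k \<le> J x (g t) + m"
  proof (cases e)
    case (Inl y)
    then obtain t where t: "N = enat t" "g t = y" using g by (auto simp: vhv_geodesic_def joins_def)
    then show ?thesis using k ij by (intro exI[of _ t]) (auto simp: Inl target_level_def)
  next
    case (Inr \<xi>)
    then obtain r where r: "ray r" "\<And>t. t \<in> boundary_point E \<theta> \<Phi> a \<xi> \<longleftrightarrow> tends_to_end t r" "k = J_end x r"
      using k by (auto simp: target_level_def)
    have N: "N = \<infinity>" "tends_to_end g r" using g r by (auto simp: vhv_geodesic_def joins_def Inr)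
    have "\<forall>\<^sub>F t in sequentially. j \<le> t \<and> J x (g t) \<le> k + m \<and> k \<le> J x (g t) + m"
      using J_tends_to_end[OF r(1) N(2), of x, folded r(3)] eventually_ge_at_top[of j]
      by eventually_elim simp
    then have "\<exists>t. j \<le> t \<and> J x (g t) \<le> k + m \<and> k \<le> J x (g t) + m"
      using eventually_happens'[OF sequentially_bot] by blast
    then show ?thesis using N by auto
  qed
  then show "n \<le> k + (m + hyp_const)" "k \<le> n + (m + hyp_const)" using shape by fastforce+
qed

text \<open>The first factor covers the horizontal part of a canonical geodesic, the second the
  distance of its level from \<open>k\<close>.\<close>

definition PC :: real where "PC = \<Lambda> ^ (4 * m + 1) * \<Lambda> ^ (m + hyp_const)"

lemma PC_ge: "1 \<le> PC" "\<Lambda> ^ (m + hyp_const) \<le> PC"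
proof -
  have *: "1 \<le> \<Lambda> ^ (4 * m + 1)" "1 \<le> \<Lambda> ^ (m + hyp_const)" using Lam_ge by (rule one_le_power)+
  show "1 \<le> PC" unfolding PC_def
    using mult_mono[OF *] order_trans[OF zero_le_one *(1)] by (metis mult_1 zero_le_one)
  show "\<Lambda> ^ (m + hyp_const) \<le> PC" unfolding PC_def
    using mult_right_mono[OF *(1), of "\<Lambda> ^ (m + hyp_const)"] * by simp
qed

lemma p_mu_est:
  assumes k: "target_level \<Phi> a x e k" and \<Phi>: "\<And>z. measure \<mu> (\<Phi> z) = M z"
  shows "p_mu E \<theta> \<Phi> \<mu> a x e \<le> PC * M (anc k x)" "M (anc k x) \<le> PC * p_mu E \<theta> \<Phi> \<mu> a x e"
proof -
  have "p_mu E \<theta> \<Phi> \<mu> a x e \<le> PC * M (anc k x) \<and> M (anc k x) \<le> PC * p_mu E \<theta> \<Phi> \<mu> a x e"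
  proof (cases "e = Inl x")
    case True
    have "J x x = L x" using J_le(1)[of x x] near_le_J[OF near_self[of "L x" x]] by simp
    then have "anc k x = x" using k True by (simp add: target_level_def)
    then show ?thesis using True PC_ge M_pos[of x] \<Phi> by (simp add: p_mu_def)
  next
    case False
    define S where "S = {g k | N g k. canonical_geodesic E \<theta> \<Phi> a x e N g \<and> enat k \<le> N}"
    have p: "p_mu E \<theta> \<Phi> \<mu> a x e = (SUP z\<in>S. M z)" using False by (simp add: p_mu_def S_def \<Phi>)
    define n where "n = (LEAST n. \<exists>N g. vhv_geodesic E \<theta> \<Phi> a x e n N g)"
    obtain N g where g: "vhv_geodesic E \<theta> \<Phi> a x e n N g"
      using LeastI_ex[OF vhv_exists[OF k]] unfolding n_def by blast
    have "n \<le> n'" if "vhv_geodesic E \<theta> \<Phi> a x e n' N' g'" for n' N' g'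
      unfolding n_def by (rule Least_le) (use that in blast)
    then have can: "canonical_geodesic E \<theta> \<Phi> a x e N g" using g by (auto simp: canonical_geodesic_def)
    note b = vhv_bounds[OF k g]
    obtain i where i: "enat i \<le> N" "g i = anc n x" using b(4) by blast
    have inS: "anc n x \<in> S" using can i by (auto simp: S_def intro!: exI[of _ N] exI[of _ g] exI[of _ i])
    have upper: "M z \<le> PC * M (anc k x)" if "z \<in> S" for z
    proof -
      obtain N' g' q where z: "z = g' q" "canonical_geodesic E \<theta> \<Phi> a x e N' g'" "enat q \<le> N'"
        using \<open>z \<in> S\<close> by (auto simp: S_def)
      then obtain n' where n': "vhv_geodesic E \<theta> \<Phi> a x e n' N' g'" by (auto simp: canonical_geodesic_def)
      note b' = vhv_bounds[OF k n']
      have "M z \<le> \<Lambda> ^ (4 * m + 1) * M (anc n' x)" using b'(5) z by simp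
      also have "\<dots> \<le> \<Lambda> ^ (4 * m + 1) * (\<Lambda> ^ (m + hyp_const) * M (anc k x))"
        using b' target_level_le[OF k] Lam_ge by (intro mult_left_mono M_shift) auto
      finally show ?thesis by (simp add: PC_def)
    qed
    have "(SUP z\<in>S. M z) \<le> PC * M (anc k x)" using inS upper by (intro cSUP_least) auto
    moreover have "M (anc n x) \<le> (SUP z\<in>S. M z)"
      using inS upper by (intro cSUP_upper bdd_aboveI2) auto
    moreover have "M (anc k x) \<le> PC * M (anc n x)"
    proof -
      have "M (anc k x) \<le> \<Lambda> ^ (m + hyp_const) * M (anc n x)"
        using b target_level_le[OF k] by (intro M_shift) auto
      also have "\<dots> \<le> PC * M (anc n x)" using PC_ge M_pos[of "anc n x"] by (intro mult_right_mono) auto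
      finally show ?thesis .
    qed
    moreover have "PC * M (anc n x) \<le> PC * (SUP z\<in>S. M z)"
      using \<open>M (anc n x) \<le> _\<close> PC_ge(1) by (intro mult_left_mono) auto
    ultimately show ?thesis unfolding p by linarith
  qed
  then show "p_mu E \<theta> \<Phi> \<mu> a x e \<le> PC * M (anc k x)" "M (anc k x) \<le> PC * p_mu E \<theta> \<Phi> \<mu> a x e" by auto
qed

lemma gromov_ext_est:
  assumes k: "target_level \<Phi> a x e k"
  shows "real k - real (m + hyp_const + 1) \<le> gromov_ext E \<theta> \<Phi> a x e"
    "gromov_ext E \<theta> \<Phi> a x e \<le> real k + real (m + hyp_const + 1)"
proof -
  have "real k - real (m + hyp_const + 1) \<le> gromov_ext E \<theta> \<Phi> a x e \<and>
    gromov_ext E \<theta> \<Phi> a x e \<le> real k + real (m + hyp_const + 1)"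
  proof (cases e)
    case (Inl y)
    then show ?thesis using gromov_J[of x y] k by (simp add: target_level_def)
  next
    case (Inr \<xi>)
    then obtain r where r: "ray r" "\<And>t. t \<in> boundary_point E \<theta> \<Phi> a \<xi> \<longleftrightarrow> tends_to_end t r" "k = J_end x r"
      using k by (auto simp: target_level_def)
    define S where "S = {g. root_ray E \<theta> g \<and> g \<in> boundary_point E \<theta> \<Phi> a \<xi>}"
    have rS: "r \<in> S" using r ray_tends_to_end by (simp add: S_def root_ray_iff)
    have b: "real k - m - 1 / 2 \<le> lim (\<lambda>n. gromov E \<theta> x (g n)) \<and>
        lim (\<lambda>n. gromov E \<theta> x (g n)) \<le> real k + m + hyp_const" if "g \<in> S" for g
      using gromov_limit[OF r(1), of g x] that r by (simp add: S_def root_ray_iff)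
    have "(SUP g\<in>S. lim (\<lambda>n. gromov E \<theta> x (g n))) \<le> real k + m + hyp_const"
      using rS b by (intro cSUP_least) auto
    moreover have "lim (\<lambda>n. gromov E \<theta> x (r n)) \<le> (SUP g\<in>S. lim (\<lambda>n. gromov E \<theta> x (g n)))"
      using rS b by (intro cSUP_upper bdd_aboveI2) auto
    ultimately show ?thesis using b[OF rS] by (simp add: Inr S_def)
  qed
  then show "real k - real (m + hyp_const + 1) \<le> gromov_ext E \<theta> \<Phi> a x e"
    "gromov_ext E \<theta> \<Phi> a x e \<le> real k + real (m + hyp_const + 1)" by auto
qed

definition level_est :: "'a \<Rightarrow> nat \<Rightarrow> real" where
  "level_est x k = l ^ L x / (l ^ k * M (anc k x))"

lemma level_est_target:
  assumes k: "target_level \<Phi> a x e k" and \<Phi>: "\<And>z. measure \<mu> (\<Phi> z) = M z"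
  defines "T \<equiv> l powr (real (gdist E \<theta> x) - gromov_ext E \<theta> \<Phi> a x e) * inverse (p_mu E \<theta> \<Phi> \<mu> a x e)"
    and "W \<equiv> PC * (1 / l) ^ (m + hyp_const + 1)"
  shows "level_est x k \<le> W * T" "T \<le> W * level_est x k"
proof -
  define g q b where "g = gromov_ext E \<theta> \<Phi> a x e" and "q = p_mu E \<theta> \<Phi> \<mu> a x e" and "b = m + hyp_const + 1"
  have g: "real k - b \<le> g" "g \<le> real k + b" using gromov_ext_est[OF k] by (auto simp: g_def b_def)
  have q: "q \<le> PC * M (anc k x)" "M (anc k x) \<le> PC * q" using p_mu_est[OF k \<Phi>] by (auto simp: q_def)
  have PC_pos: "0 < PC" using PC_ge by simp
  have M: "0 < M (anc k x)" by (rule M_pos)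
  have q_pos: "0 < q" using M q(2) PC_pos by (smt (verit) zero_less_mult_pos)
  have T: "T = l powr (real (L x) - g) * inverse q" by (simp add: T_def g_def q_def lev_eq)
  have kx: "k \<le> L x" using k by (rule target_level_le)
  have l_pow: "l powr (real (L x) - real k) = l ^ L x / l ^ k"
    using l_pos kx by (simp add: powr_diff powr_realpow)
  have lb: "l powr (- real b) = (1 / l) ^ b"
    using l_pos by (simp add: powr_minus powr_realpow power_one_over inverse_eq_divide)
  have 1: "l powr (real (L x) - g) \<le> (1 / l) ^ b * (l ^ L x / l ^ k)"
  proof -
    have "l powr (real (L x) - g) \<le> l powr (- real b + (real (L x) - real k))"
      using g l_pos l_lt_1 by (intro powr_mono') auto
    then show ?thesis by (simp only: powr_add l_pow lb)
  qed
  have 2: "l ^ L x / l ^ k \<le> (1 / l) ^ b * l powr (real (L x) - g)"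
  proof -
    have "l powr (real (L x) - real k) \<le> l powr (- real b + (real (L x) - g))"
      using g l_pos l_lt_1 by (intro powr_mono') auto
    then show ?thesis by (simp only: powr_add l_pow lb)
  qed
  have est: "level_est x k = l ^ L x / l ^ k * inverse (M (anc k x))"
    by (simp add: level_est_def field_simps)
  have q1: "inverse q \<le> PC * inverse (M (anc k x))" using q(2) q_pos M PC_pos by (simp add: field_simps)
  have q2: "inverse (M (anc k x)) \<le> PC * inverse q" using q(1) q_pos M PC_pos by (simp add: field_simps)
  have "T \<le> ((1 / l) ^ b * (l ^ L x / l ^ k)) * (PC * inverse (M (anc k x)))"
    unfolding T using 1 q1 q_pos l_pos by (intro mult_mono) auto
  then show "T \<le> W * level_est x k" by (simp add: W_def b_def est mult_ac)
  have "level_est x k \<le> ((1 / l) ^ b * l powr (real (L x) - g)) * (PC * inverse q)"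
    unfolding est using 2 q2 q_pos l_pos M by (intro mult_mono) auto
  then show "level_est x k \<le> W * T" by (simp add: W_def b_def T mult_ac)
qed

text \<open>All sequences in \<open>p\<close> yield the same limit kernel, so the definite
  description denotes it. Evaluated along the ray itself, \<open>est x (r n)\<close> is eventually
  constant and the estimate passes to the limit.\<close>

lemma martin_point_est:
  assumes r: "ray r" and p: "\<And>t. t \<in> p \<longleftrightarrow> tends_to_end t r"
    and C: "\<And>x y. martin_kernel P \<theta> x y \<le> C * est x y" "\<And>x y. est x y \<le> C * martin_kernel P \<theta> x y"
  shows "martin_point P \<theta> p x \<le> C * level_est x (J_end x r)"
    "level_est x (J_end x r) \<le> C * martin_point P \<theta> p x"
proof -
  have rp: "r \<in> p" using r p by (simp add: ray_tends_to_end)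
  obtain v where v: "\<And>x t. tends_to_end t r \<Longrightarrow> (\<lambda>n. martin_kernel P \<theta> x (t n)) \<longlonglongrightarrow> v x"
    using martin_kernel_convergent[OF r] by metis
  have conv: "martin_converges P \<theta> t v" if t: "t \<in> p" for t
    unfolding martin_converges_def
  proof (intro conjI allI impI)
    fix A :: "'a set" assume A: "finite A"
    have "\<forall>\<^sub>F n in sequentially. Suc (Max (L ` A)) \<le> L (t n)"
      using t p by (intro tends_to_end_L) simp
    then show "\<forall>\<^sub>F n in sequentially. t n \<notin> A"
    proof eventually_elim
      case (elim n)
      then show ?case using A Max_ge[of "L ` A" "L (t n)"] by fastforce
    qed
  qed (use v t p in auto)
  have mp: "martin_point P \<theta> p = v"
    unfolding martin_point_def
  proof (rule the_equality)
    show "v \<in> martin_boundary P \<theta> \<and> (\<forall>t\<in>p. martin_converges P \<theta> t v)"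
      using conv rp by (auto simp: martin_boundary_def)
  next
    fix k assume "k \<in> martin_boundary P \<theta> \<and> (\<forall>t\<in>p. martin_converges P \<theta> t k)"
    then have "martin_converges P \<theta> r k" using rp by blast
    then show "k = v" using conv[OF rp] unfolding martin_converges_def by (meson LIMSEQ_unique ext)
  qed
  have lim: "(\<lambda>n. martin_kernel P \<theta> x (r n)) \<longlonglongrightarrow> v x" using v r ray_tends_to_end by blast
  have est: "est x (r n) = level_est x (J_end x r)" if "L x \<le> n" for n
    by (simp add: est_def level_est_def J_ray[OF r that])
  have "\<forall>n\<ge>L x. martin_kernel P \<theta> x (r n) \<le> C * level_est x (J_end x r)" using C(1) est by metis
  then show "martin_point P \<theta> p x \<le> C * level_est x (J_end x r)"
    unfolding mp using lim by (intro LIMSEQ_le_const2) auto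
  have "(\<lambda>n. C * martin_kernel P \<theta> x (r n)) \<longlonglongrightarrow> C * v x" using lim by (intro tendsto_intros)
  moreover have "\<forall>n\<ge>L x. level_est x (J_end x r) \<le> C * martin_kernel P \<theta> x (r n)" using C(2) est by metis
  ultimately show "level_est x (J_end x r) \<le> C * martin_point P \<theta> p x"
    unfolding mp by (intro LIMSEQ_le_const) auto
qed

theorem walk_estimates:
  assumes a: "0 < a" and \<Phi>: "\<And>z. measure \<mu> (\<Phi> z) = M z"
    and bp: "\<And>\<xi>. boundary_point E \<theta> \<Phi> a \<xi> \<in> hyperbolic_boundary E \<theta> a"
    and mc: "\<And>x. markov_chain_from P x (Pr x) Z"
  shows "\<exists>C>0. \<forall>x y. visiting_prob Pr Z x y \<le>
        C * (l powr (real (gdist E \<theta> x) - gromov E \<theta> x y) * M y * inverse (p_mu E \<theta> \<Phi> \<mu> a x (Inl y))) \<and>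
      l powr (real (gdist E \<theta> x) - gromov E \<theta> x y) * M y * inverse (p_mu E \<theta> \<Phi> \<mu> a x (Inl y))
        \<le> C * visiting_prob Pr Z x y"
    and "\<exists>C>0. \<forall>x e. martin_ext E \<theta> \<Phi> a P x e \<le>
        C * (l powr (real (gdist E \<theta> x) - gromov_ext E \<theta> \<Phi> a x e) * inverse (p_mu E \<theta> \<Phi> \<mu> a x e)) \<and>
      l powr (real (gdist E \<theta> x) - gromov_ext E \<theta> \<Phi> a x e) * inverse (p_mu E \<theta> \<Phi> \<mu> a x e)
        \<le> C * martin_ext E \<theta> \<Phi> a P x e"
proof -
  define W where "W = PC * (1 / l) ^ (m + hyp_const + 1)"
  have W: "0 < W" using PC_ge(1) l_pos by (simp add: W_def)
  define T where "T x e = l powr (real (gdist E \<theta> x) - gromov_ext E \<theta> \<Phi> a x e) * inverse (p_mu E \<theta> \<Phi> \<mu> a x e)" for x e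
  have T: "level_est x k \<le> W * T x e" "T x e \<le> W * level_est x k" if "target_level \<Phi> a x e k" for x e k
    using level_est_target[OF that \<Phi>] by (auto simp: T_def W_def)
  have est: "est x y = level_est x (J x y)" "target_level \<Phi> a x (Inl y) (J x y)" for x y
    by (auto simp: est_def level_est_def target_level_def)
  obtain C where C: "C > 0" "\<And>x y. visiting_prob Pr Z x y \<le> C * (est x y * M y)"
    "\<And>x y. est x y * M y \<le> C * visiting_prob Pr Z x y"
    using visiting_prob_est[of Pr Z, OF mc] by blast
  have "visiting_prob Pr Z x y \<le> C * W * (T x (Inl y) * M y) \<and> T x (Inl y) * M y \<le> C * W * visiting_prob Pr Z x y" for x y
  proof
    have "C * (est x y * M y) \<le> C * (W * T x (Inl y) * M y)"
      using T(1)[OF est(2)[of x y]] C(1) M_pos[of y] by (intro mult_left_mono mult_right_mono) (auto simp: est)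
    then show "visiting_prob Pr Z x y \<le> C * W * (T x (Inl y) * M y)" using C(2)[of x y] by (simp add: mult_ac)
    have "T x (Inl y) * M y \<le> W * est x y * M y"
      using T(2)[OF est(2)[of x y]] M_pos[of y] by (intro mult_right_mono) (auto simp: est)
    also have "\<dots> \<le> W * (C * visiting_prob Pr Z x y)"
      using C(3)[of x y] W by (simp add: mult.assoc)
    finally show "T x (Inl y) * M y \<le> C * W * visiting_prob Pr Z x y" by (simp add: mult_ac)
  qed
  moreover have "C * W > 0" using C(1) W by simp
  ultimately show "\<exists>C>0. \<forall>x y. visiting_prob Pr Z x y \<le>
        C * (l powr (real (gdist E \<theta> x) - gromov E \<theta> x y) * M y * inverse (p_mu E \<theta> \<Phi> \<mu> a x (Inl y))) \<and>
      l powr (real (gdist E \<theta> x) - gromov E \<theta> x y) * M y * inverse (p_mu E \<theta> \<Phi> \<mu> a x (Inl y))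
        \<le> C * visiting_prob Pr Z x y"
    by (intro exI[of _ "C * W"]) (auto simp: T_def mult_ac)
  obtain C' where C': "C' > 0" "\<And>x y. martin_kernel P \<theta> x y \<le> C' * est x y"
    "\<And>x y. est x y \<le> C' * martin_kernel P \<theta> x y"
    using martin_kernel_est by blast
  have "\<exists>k. target_level \<Phi> a x e k \<and> martin_ext E \<theta> \<Phi> a P x e \<le> C' * level_est x k \<and>
      level_est x k \<le> C' * martin_ext E \<theta> \<Phi> a P x e" for x e
  proof (cases e)
    case (Inl y)
    then show ?thesis using C'(2,3)[of x y] est[of x y] by (intro exI[of _ "J x y"]) auto
  next
    case (Inr \<xi>)
    obtain r where r: "ray r" "\<And>t. t \<in> boundary_point E \<theta> \<Phi> a \<xi> \<longleftrightarrow> tends_to_end t r"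
      using boundary_end[OF bp a] by blast
    then have "target_level \<Phi> a x e (J_end x r)" by (auto simp: Inr target_level_def)
    then show ?thesis using martin_point_est[OF r C'(2,3), of x] by (intro exI[of _ "J_end x r"]) (simp add: Inr)
  qed
  then obtain k where k: "\<And>x e. target_level \<Phi> a x e (k x e)"
    "\<And>x e. martin_ext E \<theta> \<Phi> a P x e \<le> C' * level_est x (k x e)"
    "\<And>x e. level_est x (k x e) \<le> C' * martin_ext E \<theta> \<Phi> a P x e" by metis
  have "martin_ext E \<theta> \<Phi> a P x e \<le> C' * W * T x e \<and> T x e \<le> C' * W * martin_ext E \<theta> \<Phi> a P x e" for x e
  proof
    have "C' * level_est x (k x e) \<le> C' * (W * T x e)" using T(1)[OF k(1)[of x e]] C'(1) by (intro mult_left_mono) auto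
    then show "martin_ext E \<theta> \<Phi> a P x e \<le> C' * W * T x e" using k(2)[of x e] by (simp add: mult.assoc)
    have "W * level_est x (k x e) \<le> W * (C' * martin_ext E \<theta> \<Phi> a P x e)"
      using k(3)[of x e] W by (intro mult_left_mono) auto
    then show "T x e \<le> C' * W * martin_ext E \<theta> \<Phi> a P x e" using T(2)[OF k(1)[of x e]] by (simp add: mult_ac)
  qed
  moreover have "C' * W > 0" using C'(1) W by simp
  ultimately show "\<exists>C>0. \<forall>x e. martin_ext E \<theta> \<Phi> a P x e \<le>
        C * (l powr (real (gdist E \<theta> x) - gromov_ext E \<theta> \<Phi> a x e) * inverse (p_mu E \<theta> \<Phi> \<mu> a x e)) \<and>
      l powr (real (gdist E \<theta> x) - gromov_ext E \<theta> \<Phi> a x e) * inverse (p_mu E \<theta> \<Phi> \<mu> a x e)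
        \<le> C * martin_ext E \<theta> \<Phi> a P x e"
    unfolding T_def by blast
qed

end

section \<open>Index trees\<close>

lemma (in finite_measure) measure_UNION_null_overlap:
  assumes "finite S" "\<And>y. y \<in> S \<Longrightarrow> A y \<in> sets M"
    and "\<And>y z. y \<in> S \<Longrightarrow> z \<in> S \<Longrightarrow> y \<noteq> z \<Longrightarrow> measure M (A y \<inter> A z) = 0"
  shows "measure M (\<Union>y\<in>S. A y) = (\<Sum>y\<in>S. measure M (A y))"
  using assms
proof (induction S rule: finite_induct)
  case (insert y S)
  have U: "(\<Union>z\<in>S. A z) \<in> sets M" using insert by auto
  have "measure M (A y \<inter> (\<Union>z\<in>S. A z)) = measure M (\<Union>z\<in>S. A y \<inter> A z)"
    by (rule arg_cong[of _ _ "measure M"]) blast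
  also have "\<dots> \<le> (\<Sum>z\<in>S. measure M (A y \<inter> A z))"
    using insert by (intro finite_measure_subadditive_finite) auto
  also have "\<dots> = 0" using insert by (intro sum.neutral) auto
  finally have null: "measure M (A y \<inter> (\<Union>z\<in>S. A z)) = 0" by (simp add: measure_le_0_iff)
  have "measure M (A y \<union> (\<Union>z\<in>S. A z)) = measure M (A y) + measure M ((\<Union>z\<in>S. A z) - A y)"
    using U insert by (simp add: finite_measure_Union')
  also have "measure M ((\<Union>z\<in>S. A z) - A y) = measure M (\<Union>z\<in>S. A z)"
    using U insert null by (simp add: finite_measure_Diff' Int_commute)
  finally show ?case using insert by simp
qed simp

locale index_space =
  fixes \<rho> :: "'k \<Rightarrow> 'k \<Rightarrow> real" and \<mu> :: "'k measure" and Ev :: "('x \<times> 'x) set" and \<theta> :: 'x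
    and \<Phi> :: "'x \<Rightarrow> 'k set" and r0 \<gamma> :: real
  assumes homogeneous: "compact_homogeneous_space \<rho> \<mu>" and normalized: "normalized_space \<rho> \<mu>"
    and index: "index_tree \<rho> \<mu> Ev \<theta> \<Phi> r0" and gamma_pos: "0 < \<gamma>"
begin

definition Lv :: "'x \<Rightarrow> nat" where "Lv x = gdist Ev \<theta> x"

definition pr :: "'x \<Rightarrow> 'x" where "pr x = (if x = \<theta> then \<theta> else parent Ev \<theta> x)"

definition Eh :: "('x \<times> 'x) set" where "Eh = horizontal_edges \<rho> Ev \<theta> \<Phi> r0 \<gamma>"

lemma tree: "rooted_tree Ev \<theta>"
  and Phi_nonempty: "\<Phi> x \<noteq> {}"
  and Phi_compact: "compactin (qtopology \<rho>) (\<Phi> x)"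
  and Phi_root: "\<Phi> \<theta> = UNIV"
  and Phi_descendants: "\<Phi> x = (\<Union>y\<in>descendants Ev \<theta> 1 x. \<Phi> y)"
  and r0: "0 < r0" "r0 < 1"
  and balls: "\<exists>b>0. \<exists>C>0. \<forall>x. \<exists>\<xi>. qball \<rho> \<xi> (b * r0 ^ Lv x) \<subseteq> \<Phi> x \<and> \<Phi> x \<subseteq> qball \<rho> \<xi> (C * r0 ^ Lv x)"
  and null_overlap': "x \<noteq> y \<Longrightarrow> Lv x = Lv y \<Longrightarrow> emeasure \<mu> (\<Phi> x \<inter> \<Phi> y) = 0"
proof -
  note idx = index[unfolded index_tree_def]
  have 1: "\<forall>x. \<Phi> x \<noteq> {} \<and> compactin (qtopology \<rho>) (\<Phi> x)" using idx by (elim conjE)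
  show "\<Phi> x \<noteq> {}" "compactin (qtopology \<rho>) (\<Phi> x)" using 1 by blast+
  have 2: "\<forall>x. \<Phi> x = (\<Union>y\<in>descendants Ev \<theta> 1 x. \<Phi> y)" using idx by (elim conjE)
  show "\<Phi> x = (\<Union>y\<in>descendants Ev \<theta> 1 x. \<Phi> y)" by (rule 2[rule_format])
  have 3: "\<forall>x y. x \<noteq> y \<and> gdist Ev \<theta> x = gdist Ev \<theta> y \<longrightarrow> emeasure \<mu> (\<Phi> x \<inter> \<Phi> y) = 0"
    using idx by (elim conjE)
  show "x \<noteq> y \<Longrightarrow> Lv x = Lv y \<Longrightarrow> emeasure \<mu> (\<Phi> x \<inter> \<Phi> y) = 0" using 3 by (simp add: Lv_def)
  show "rooted_tree Ev \<theta>" using idx by (elim conjE)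
  show "\<Phi> \<theta> = UNIV" using idx by (elim conjE)
  show "0 < r0" using idx by (elim conjE)
  show "r0 < 1" using idx by (elim conjE)
  show "\<exists>b>0. \<exists>C>0. \<forall>x. \<exists>\<xi>. qball \<rho> \<xi> (b * r0 ^ Lv x) \<subseteq> \<Phi> x \<and> \<Phi> x \<subseteq> qball \<rho> \<xi> (C * r0 ^ Lv x)"
    using idx unfolding Lv_def by (elim conjE)
qed

lemma Ev_sym: "(x, y) \<in> Ev \<Longrightarrow> (y, x) \<in> Ev"
  using tree by (auto simp: rooted_tree_def rooted_graph_def symD)

sublocale tree: connected_graph Ev
  by unfold_locales (use tree in \<open>auto simp: rooted_tree_def rooted_graph_def\<close>)

lemma descendants_1_iff: "x \<in> descendants Ev \<theta> 1 y \<longleftrightarrow> (y, x) \<in> Ev \<and> Lv x = Suc (Lv y)"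
proof
  assume x: "x \<in> descendants Ev \<theta> 1 y"
  then obtain n g k where g: "geodesic Ev (enat n) g" "g 0 = \<theta>" "g n = x" "k \<le> n" "g k = y"
    by (auto simp: descendants_def prec_def)
  have "Lv (g i) = i" if "i \<le> n" for i using g that by (auto simp: geodesic_def Lv_def)
  then have "Lv x = n" "Lv y = k" using g by auto
  moreover have lev: "Lv x = Suc (Lv y)" using x by (simp add: descendants_def Lv_def)
  moreover have "gdist Ev (g k) (g n) = n - k" using g(1,4) by (simp add: geodesic_def)
  ultimately have "gdist Ev y x = 1" using g by simp
  then show "(y, x) \<in> Ev \<and> Lv x = Suc (Lv y)" using lev tree.gdist_eq_1D by blast
next
  assume x: "(y, x) \<in> Ev \<and> Lv x = Suc (Lv y)"
  obtain f where f: "f 0 = \<theta>" "f (Lv y) = y" "\<And>i. i < Lv y \<Longrightarrow> (f i, f (Suc i)) \<in> Ev"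
    using tree.gdist_walk[of \<theta> y] unfolding relpow_fun_conv Lv_def by blast
  define g where "g i = (if i \<le> Lv y then f i else x)" for i
  have "geodesic Ev (enat (Lv x)) g"
  proof (rule tree.geodesicI)
    fix i assume "enat (Suc i) \<le> enat (Lv x)"
    then show "(g i, g (Suc i)) \<in> Ev" using x f by (cases "i = Lv y") (auto simp: g_def)
  next
    fix n assume "enat n \<le> enat (Lv x)"
    then show "\<exists>n'\<ge>n. enat n' \<le> enat (Lv x) \<and> n' \<le> gdist Ev (g 0) (g n')"
      using f x by (intro exI[of _ "Lv x"]) (auto simp: g_def Lv_def)
  qed
  then have "prec Ev \<theta> x y"
    unfolding prec_def using f x by (intro exI[of _ "Lv x"] exI[of _ g]) (auto simp: g_def intro!: exI[of _ "Lv y"])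
  then show "x \<in> descendants Ev \<theta> 1 y" using x by (simp add: descendants_def Lv_def)
qed

lemma pr_unique:
  assumes "x \<noteq> \<theta>"
  shows "(pr x, x) \<in> Ev" "Lv x = Suc (Lv (pr x))" "(y, x) \<in> Ev \<Longrightarrow> Lv x = Suc (Lv y) \<Longrightarrow> pr x = y"
proof -
  have ex: "\<exists>!y. x \<in> descendants Ev \<theta> 1 y" using tree assms by (simp add: rooted_tree_def)
  have "x \<in> descendants Ev \<theta> 1 (pr x)" using theI'[OF ex] assms by (simp add: pr_def parent_def)
  then show "(pr x, x) \<in> Ev" "Lv x = Suc (Lv (pr x))" unfolding descendants_1_iff by auto
  show "pr x = y" if "(y, x) \<in> Ev" "Lv x = Suc (Lv y)"
    using ex \<open>x \<in> descendants Ev \<theta> 1 (pr x)\<close> descendants_1_iff[of x y] that by blast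
qed

lemma Lv_root: "Lv \<theta> = 0" by (simp add: Lv_def)

lemma Lv_eq_0: "Lv x = 0 \<longleftrightarrow> x = \<theta>"
  using tree.gdist_eq_0D[of \<theta> x] by (auto simp: Lv_def)

lemma Ev_eq: "Ev = parent_edges \<theta> pr"
proof -
  have up: "x \<noteq> \<theta> \<and> y = pr x" if "(x, y) \<in> Ev" "Lv x = Suc (Lv y)" for x y
    using that pr_unique(3)[of x y] Ev_sym Lv_eq_0[of x] by auto
  have "(x, y) \<in> parent_edges \<theta> pr" if "(x, y) \<in> Ev" for x y
  proof -
    have "Lv x = Suc (Lv y) \<or> Lv y = Suc (Lv x)"
      using tree that by (auto simp: rooted_tree_def Lv_def)
    then show ?thesis using up[of x y] up[of y x] that Ev_sym by (auto simp: parent_edges_def)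
  qed
  then show ?thesis using pr_unique(1) Ev_sym by (auto simp: parent_edges_def)
qed

lemma descendants_1: "descendants Ev \<theta> 1 x = {y. y \<noteq> \<theta> \<and> pr y = x}"
proof -
  have "y \<in> descendants Ev \<theta> 1 x \<longleftrightarrow> y \<noteq> \<theta> \<and> pr y = x" for y
    unfolding descendants_1_iff using pr_unique[of y] Lv_eq_0[of y] by auto
  then show ?thesis by blast
qed

lemma Phi_sub_pr: "\<Phi> x \<subseteq> \<Phi> (pr x)"
proof (cases "x = \<theta>")
  case False
  then show ?thesis using Phi_descendants[of "pr x"] unfolding descendants_1 by blast
qed (simp add: pr_def)

lemma Phi_children: "\<Phi> x = (\<Union>y\<in>{y. y \<noteq> \<theta> \<and> pr y = x}. \<Phi> y)"
  unfolding descendants_1[symmetric] by (rule Phi_descendants)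

lemma Phi_sub_up: "\<Phi> x \<subseteq> \<Phi> ((pr ^^ t) x)"
  by (induction t) (use Phi_sub_pr in auto)

section \<open>Quasi-metric geometry of the cells\<close>

lemma rho: "0 \<le> \<rho> \<xi> \<eta>" "\<rho> \<xi> \<eta> = 0 \<longleftrightarrow> \<xi> = \<eta>" "\<rho> \<xi> \<eta> = \<rho> \<eta> \<xi>"
  using homogeneous by (auto simp: compact_homogeneous_space_def quasi_metric_def)

lemma rho_self: "\<rho> \<xi> \<xi> = 0" using rho(2) by blast

definition Crho :: real where
  "Crho = (SOME C. 1 \<le> C \<and> (\<forall>\<xi> \<eta> \<zeta>. \<rho> \<xi> \<eta> \<le> C * (\<rho> \<xi> \<zeta> + \<rho> \<zeta> \<eta>)))"

lemma Crho: "1 \<le> Crho" "\<rho> \<xi> \<eta> \<le> Crho * (\<rho> \<xi> \<zeta> + \<rho> \<zeta> \<eta>)"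
proof -
  have "\<exists>C. 1 \<le> C \<and> (\<forall>\<xi> \<eta> \<zeta>. \<rho> \<xi> \<eta> \<le> C * (\<rho> \<xi> \<zeta> + \<rho> \<zeta> \<eta>))"
    using homogeneous unfolding compact_homogeneous_space_def quasi_metric_def by (elim conjE)
  from someI_ex[OF this] show "1 \<le> Crho" "\<rho> \<xi> \<eta> \<le> Crho * (\<rho> \<xi> \<zeta> + \<rho> \<zeta> \<eta>)"
    unfolding Crho_def by auto
qed

lemma diameter: "\<exists>C>0. \<forall>x. \<forall>\<xi>\<in>\<Phi> x. \<forall>\<eta>\<in>\<Phi> x. \<rho> \<xi> \<eta> \<le> C * r0 ^ Lv x"
proof -
  obtain C where C: "C > 0" "\<And>x. \<exists>\<xi>. \<Phi> x \<subseteq> qball \<rho> \<xi> (C * r0 ^ Lv x)" using balls by blast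
  have "\<rho> \<xi> \<eta> \<le> Crho * (2 * C) * r0 ^ Lv x" if xy: "\<xi> \<in> \<Phi> x" "\<eta> \<in> \<Phi> x" for x \<xi> \<eta>
  proof -
    obtain \<zeta> where "\<Phi> x \<subseteq> qball \<rho> \<zeta> (C * r0 ^ Lv x)" using C(2) by blast
    then have "\<rho> \<xi> \<zeta> \<le> C * r0 ^ Lv x" "\<rho> \<zeta> \<eta> \<le> C * r0 ^ Lv x" using xy rho(3)[of \<xi> \<zeta>] by (auto simp: qball_def)
    then have "Crho * (\<rho> \<xi> \<zeta> + \<rho> \<zeta> \<eta>) \<le> Crho * (C * r0 ^ Lv x + C * r0 ^ Lv x)"
      using Crho(1) by (intro mult_left_mono) auto
    then show ?thesis using Crho(2)[of \<xi> \<eta> \<zeta>] by (simp add: algebra_simps)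
  qed
  then show ?thesis using C(1) Crho(1) by (intro exI[of _ "Crho * (2 * C)"]) auto
qed

lemma set_qdist_le: "\<xi> \<in> \<Phi> x \<Longrightarrow> \<eta> \<in> \<Phi> y \<Longrightarrow> set_qdist \<rho> (\<Phi> x) (\<Phi> y) \<le> \<rho> \<xi> \<eta>"
  unfolding set_qdist_def
  by (rule cINF_lower2[where x = "(\<xi>, \<eta>)"]) (auto intro!: bdd_belowI[of _ 0] simp: rho(1))

lemma set_qdist_less:
  assumes "set_qdist \<rho> (\<Phi> x) (\<Phi> y) < d"
  obtains \<xi> \<eta> where "\<xi> \<in> \<Phi> x" "\<eta> \<in> \<Phi> y" "\<rho> \<xi> \<eta> < d"
proof -
  have "(\<lambda>(\<xi>, \<eta>). \<rho> \<xi> \<eta>) ` (\<Phi> x \<times> \<Phi> y) \<noteq> {}" using Phi_nonempty by auto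
  from cInf_lessD[OF this] assms show ?thesis using that unfolding set_qdist_def by fastforce
qed

lemma Eh_iff: "(x, y) \<in> Eh \<longleftrightarrow> 1 \<le> Lv x \<and> Lv x = Lv y \<and> x \<noteq> y \<and> set_qdist \<rho> (\<Phi> x) (\<Phi> y) \<le> \<gamma> * r0 ^ Lv x"
  by (auto simp: Eh_def horizontal_edges_def Lv_def)

text \<open>\<open>set_qdist\<close> is an infimum; the factor \<open>2\<close> makes room for
  points that nearly attain it.\<close>

lemma Eh_close:
  assumes "x = y \<or> (x, y) \<in> Eh"
  obtains \<xi> \<eta> where "\<xi> \<in> \<Phi> x" "\<eta> \<in> \<Phi> y" "\<rho> \<xi> \<eta> \<le> 2 * \<gamma> * r0 ^ Lv x"
proof (cases "x = y")
  case True
  obtain \<xi> where "\<xi> \<in> \<Phi> x" using Phi_nonempty by blast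
  moreover have "\<rho> \<xi> \<xi> = 0" using rho(2) by blast
  ultimately show ?thesis using that[of \<xi> \<xi>] True gamma_pos r0 by auto
next
  case False
  then have "set_qdist \<rho> (\<Phi> x) (\<Phi> y) \<le> \<gamma> * r0 ^ Lv x" using assms by (auto simp: Eh_iff)
  also have "\<dots> < 2 * \<gamma> * r0 ^ Lv x" using gamma_pos r0 by simp
  finally show ?thesis using set_qdist_less that by (metis less_imp_le)
qed

lemma set_qdist_sym: "set_qdist \<rho> (\<Phi> x) (\<Phi> y) \<le> set_qdist \<rho> (\<Phi> y) (\<Phi> x)"
proof -
  have "set_qdist \<rho> (\<Phi> x) (\<Phi> y) \<le> \<rho> \<xi> \<eta>" if "\<xi> \<in> \<Phi> y" "\<eta> \<in> \<Phi> x" for \<xi> \<eta>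
    using set_qdist_le[OF that(2,1)] rho(3)[of \<eta> \<xi>] by simp
  then show ?thesis using Phi_nonempty unfolding set_qdist_def[of \<rho> "\<Phi> y"] by (intro cINF_greatest) auto
qed

lemma set_qdist_pr: "set_qdist \<rho> (\<Phi> (pr x)) (\<Phi> (pr y)) \<le> set_qdist \<rho> (\<Phi> x) (\<Phi> y)"
proof -
  have "set_qdist \<rho> (\<Phi> (pr x)) (\<Phi> (pr y)) \<le> \<rho> \<xi> \<eta>" if "\<xi> \<in> \<Phi> x" "\<eta> \<in> \<Phi> y" for \<xi> \<eta>
    using Phi_sub_pr that by (intro set_qdist_le) auto
  then show ?thesis using Phi_nonempty unfolding set_qdist_def[of \<rho> "\<Phi> x"] by (intro cINF_greatest) auto
qed

lemma Lv_pr: "Lv (pr x) = Lv x - 1"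
  using pr_unique(2)[of x] by (cases "x = \<theta>") (auto simp: pr_def Lv_root)

lemma Lv_up: "Lv ((pr ^^ t) x) = Lv x - t"
  by (induction t) (auto simp: Lv_pr)

lemma Eh_up:
  assumes "Lv x = Lv y" "set_qdist \<rho> (\<Phi> x) (\<Phi> y) \<le> \<gamma> * r0 ^ Lv x"
  shows "x = y \<or> (x, y) \<in> Eh"
proof (cases "Lv x = 0")
  case True
  then show ?thesis using assms Lv_eq_0 by metis
qed (use assms Eh_iff in auto)

lemma two_step_exists:
  "\<exists>m. \<forall>x y z. (x = y \<or> (x, y) \<in> Eh) \<longrightarrow> (y = z \<or> (y, z) \<in> Eh) \<longrightarrow>
     (pr ^^ m) x = (pr ^^ m) z \<or> ((pr ^^ m) x, (pr ^^ m) z) \<in> Eh"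
proof -
  obtain C where C: "C > 0" "\<And>x \<xi> \<eta>. \<xi> \<in> \<Phi> x \<Longrightarrow> \<eta> \<in> \<Phi> x \<Longrightarrow> \<rho> \<xi> \<eta> \<le> C * r0 ^ Lv x"
    using diameter by blast
  define K where "K = Crho * (2 * \<gamma> + Crho * (C + 2 * \<gamma>))"
  have K: "0 < K" using C(1) Crho(1) gamma_pos by (simp add: K_def add_pos_pos)
  obtain m where "r0 ^ m < \<gamma> / K" using real_arch_pow_inv[of "\<gamma> / K" r0] K gamma_pos r0 by auto
  then have m: "K * r0 ^ m \<le> \<gamma>" using K by (simp add: field_simps)
  have "(pr ^^ m) x = (pr ^^ m) z \<or> ((pr ^^ m) x, (pr ^^ m) z) \<in> Eh"
    if xy: "x = y \<or> (x, y) \<in> Eh" and yz: "y = z \<or> (y, z) \<in> Eh" for x y z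
  proof -
    define n where "n = Lv x"
    have lev: "Lv y = n" "Lv z = n" using xy yz by (auto simp: n_def Eh_iff)
    show ?thesis
    proof (cases "m \<le> n")
      case False
      then have "Lv ((pr ^^ m) x) = 0" "Lv ((pr ^^ m) z) = 0" using lev by (auto simp: Lv_up n_def)
      then show ?thesis unfolding Lv_eq_0 by simp
    next
      case True
      obtain \<alpha> \<beta> where 1: "\<alpha> \<in> \<Phi> x" "\<beta> \<in> \<Phi> y" "\<rho> \<alpha> \<beta> \<le> 2 * \<gamma> * r0 ^ n"
        using Eh_close[OF xy] by (auto simp: n_def)
      obtain \<beta>' \<zeta> where 2: "\<beta>' \<in> \<Phi> y" "\<zeta> \<in> \<Phi> z" "\<rho> \<beta>' \<zeta> \<le> 2 * \<gamma> * r0 ^ n"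
        using Eh_close[OF yz] by (auto simp: lev)
      have 3: "\<rho> \<beta> \<beta>' \<le> C * r0 ^ n" using C(2)[OF 1(2) 2(1)] by (simp add: lev)
      have "\<rho> \<beta> \<zeta> \<le> Crho * (\<rho> \<beta> \<beta>' + \<rho> \<beta>' \<zeta>)" by (rule Crho)
      also have "\<dots> \<le> Crho * (C * r0 ^ n + 2 * \<gamma> * r0 ^ n)" using 2 3 Crho(1) by (intro mult_left_mono) auto
      finally have 4: "\<rho> \<beta> \<zeta> \<le> Crho * (C * r0 ^ n + 2 * \<gamma> * r0 ^ n)" .
      have "\<rho> \<alpha> \<zeta> \<le> Crho * (\<rho> \<alpha> \<beta> + \<rho> \<beta> \<zeta>)" by (rule Crho)
      also have "\<dots> \<le> Crho * (2 * \<gamma> * r0 ^ n + Crho * (C * r0 ^ n + 2 * \<gamma> * r0 ^ n))"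
        using 1 4 Crho(1) by (intro mult_left_mono) auto
      also have "\<dots> = K * r0 ^ m * r0 ^ (n - m)"
        using True by (simp add: K_def algebra_simps flip: power_add)
      also have "\<dots> \<le> \<gamma> * r0 ^ (n - m)" using m r0 by (intro mult_right_mono) auto
      finally have "set_qdist \<rho> (\<Phi> ((pr ^^ m) x)) (\<Phi> ((pr ^^ m) z)) \<le> \<gamma> * r0 ^ (n - m)"
        using set_qdist_le[of \<alpha> "(pr ^^ m) x" \<zeta> "(pr ^^ m) z"] 1 2 Phi_sub_up by (meson order_trans subsetD)
      then show ?thesis using lev by (intro Eh_up) (auto simp: Lv_up n_def)
    qed
  qed
  then show ?thesis by blast
qed

lemma aug_tree_exists: "\<exists>m. aug_tree \<theta> pr Lv Eh m"
proof -
  obtain m where m: "\<And>x y z. (x = y \<or> (x, y) \<in> Eh) \<Longrightarrow> (y = z \<or> (y, z) \<in> Eh) \<Longrightarrow>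
     (pr ^^ m) x = (pr ^^ m) z \<or> ((pr ^^ m) x, (pr ^^ m) z) \<in> Eh"
    using two_step_exists by blast
  have "aug_tree \<theta> pr Lv Eh m"
  proof
    show "pr x = pr y \<or> (pr x, pr y) \<in> Eh" if "(x, y) \<in> Eh" for x y
    proof (rule Eh_up)
      show "Lv (pr x) = Lv (pr y)" using that by (simp add: Lv_pr Eh_iff)
      have "set_qdist \<rho> (\<Phi> (pr x)) (\<Phi> (pr y)) \<le> \<gamma> * r0 ^ Lv x"
        using set_qdist_pr[of x y] that by (auto simp: Eh_iff)
      also have "\<dots> \<le> \<gamma> * r0 ^ Lv (pr x)"
        using gamma_pos r0 by (intro mult_left_mono power_decreasing) (auto simp: Lv_pr)
      finally show "set_qdist \<rho> (\<Phi> (pr x)) (\<Phi> (pr y)) \<le> \<gamma> * r0 ^ Lv (pr x)" .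
    qed
    show "(y, x) \<in> Eh" if "(x, y) \<in> Eh" for x y
      using that set_qdist_sym[of y x] by (auto simp: Eh_iff)
  qed (use m pr_unique(2) in \<open>auto simp: Lv_root pr_def Eh_iff\<close>)
  then show ?thesis ..
qed

section \<open>Measures of cells: doubling and bounded degree\<close>

lemma emeasure_UNIV: "emeasure \<mu> UNIV = 1" using normalized by (simp add: normalized_space_def)

lemma sets_mu: "sets \<mu> = sigma_sets UNIV {U. openin (qtopology \<rho>) U}"
  using homogeneous by (simp add: compact_homogeneous_space_def regular_borel_measure_def topspace_qtopology)

lemma space_mu: "space \<mu> = UNIV"
proof -
  have "UNIV \<in> sets \<mu>" unfolding sets_mu by (rule sigma_sets_top)
  then show ?thesis using sets.sets_into_space by blast
qed

sublocale \<mu>: finite_measure \<mu>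
  by (rule finite_measureI) (simp add: space_mu emeasure_UNIV)

lemma qball_open: "openin (qtopology \<rho>) (qball \<rho> \<xi> r)"
  using homogeneous by (simp add: compact_homogeneous_space_def)

lemma qball_sets: "qball \<rho> \<xi> r \<in> sets \<mu>"
  unfolding sets_mu by (rule sigma_sets.Basic) (simp add: qball_open)

text \<open>Balls are open, and those of radius \<open>\<rho> \<xi> \<eta> / (2 * Crho)\<close>
  about two points are disjoint. So the topology is Hausdorff and compact cells are closed.\<close>

lemma Phi_closed: "closedin (qtopology \<rho>) (\<Phi> x)"
proof -
  have "Hausdorff_space (qtopology \<rho>)"
    unfolding Hausdorff_space_def
  proof (intro allI impI)
    fix \<xi> \<eta> assume "\<xi> \<in> topspace (qtopology \<rho>) \<and> \<eta> \<in> topspace (qtopology \<rho>) \<and> \<xi> \<noteq> \<eta>"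
    then have pos: "0 < \<rho> \<xi> \<eta>" using rho(1,2)[of \<xi> \<eta>] by auto
    define r where "r = \<rho> \<xi> \<eta> / (2 * Crho)"
    have r: "0 < r" using pos Crho(1) by (simp add: r_def)
    have "disjnt (qball \<rho> \<xi> r) (qball \<rho> \<eta> r)"
    proof (rule ccontr)
      assume "\<not> ?thesis"
      then obtain \<zeta> where "\<rho> \<xi> \<zeta> < r" "\<rho> \<zeta> \<eta> < r" using rho(3) by (auto simp: disjnt_def qball_def)
      then have "Crho * (\<rho> \<xi> \<zeta> + \<rho> \<zeta> \<eta>) < Crho * (r + r)" using Crho(1) by (intro mult_strict_left_mono) auto
      also have "\<dots> = \<rho> \<xi> \<eta>" using Crho(1) by (simp add: r_def)
      finally show False using Crho(2)[of \<xi> \<eta> \<zeta>] by simp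
    qed
    moreover have "\<xi> \<in> qball \<rho> \<xi> r" "\<eta> \<in> qball \<rho> \<eta> r" using r by (auto simp: qball_def rho_self)
    ultimately show "\<exists>U V. openin (qtopology \<rho>) U \<and> openin (qtopology \<rho>) V \<and> \<xi> \<in> U \<and> \<eta> \<in> V \<and> disjnt U V"
      using qball_open by blast
  qed
  then show ?thesis using Phi_compact by (rule compactin_imp_closedin)
qed

lemma Phi_sets: "\<Phi> x \<in> sets \<mu>"
proof -
  have "openin (qtopology \<rho>) (UNIV - \<Phi> x)" using Phi_closed[of x] by (simp add: closedin_def topspace_qtopology)
  then have "UNIV - \<Phi> x \<in> sets \<mu>" unfolding sets_mu by (intro sigma_sets.Basic) simp
  then have "space \<mu> - (UNIV - \<Phi> x) \<in> sets \<mu>" by (rule sets.compl_sets)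
  then show ?thesis by (simp add: space_mu Diff_Diff_Int)
qed

definition Mu :: "'x \<Rightarrow> real" where "Mu x = measure \<mu> (\<Phi> x)"

lemma doubling: "\<exists>C\<ge>1. \<forall>\<xi> r. 0 < r \<longrightarrow> 0 < measure \<mu> (qball \<rho> \<xi> r) \<and>
   measure \<mu> (qball \<rho> \<xi> (2 * r)) \<le> C * measure \<mu> (qball \<rho> \<xi> r)"
proof -
  obtain C where C: "C > 0" "\<And>\<xi> r. r > 0 \<Longrightarrow> 0 < emeasure \<mu> (qball \<rho> \<xi> (2 * r)) \<and>
        emeasure \<mu> (qball \<rho> \<xi> (2 * r)) \<le> ennreal C * emeasure \<mu> (qball \<rho> \<xi> r)"
    using homogeneous unfolding compact_homogeneous_space_def doubling_measure_def by blast
  have "0 < measure \<mu> (qball \<rho> \<xi> r) \<and> measure \<mu> (qball \<rho> \<xi> (2 * r)) \<le> max C 1 * measure \<mu> (qball \<rho> \<xi> r)"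
    if r: "0 < r" for \<xi> r
  proof
    have "0 < emeasure \<mu> (qball \<rho> \<xi> (2 * (r / 2)))" using C(2)[of "r / 2" \<xi>] r by simp
    then show "0 < measure \<mu> (qball \<rho> \<xi> r)"
      by (simp add: \<mu>.emeasure_eq_measure)
    have "ennreal (measure \<mu> (qball \<rho> \<xi> (2 * r))) \<le> ennreal (C * measure \<mu> (qball \<rho> \<xi> r))"
      using C(2)[OF r, of \<xi>] C(1) by (simp add: \<mu>.emeasure_eq_measure ennreal_mult)
    then have "measure \<mu> (qball \<rho> \<xi> (2 * r)) \<le> C * measure \<mu> (qball \<rho> \<xi> r)"
      using C(1) by (subst (asm) ennreal_le_iff) auto
    also have "\<dots> \<le> max C 1 * measure \<mu> (qball \<rho> \<xi> r)" by (intro mult_right_mono) auto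
    finally show "measure \<mu> (qball \<rho> \<xi> (2 * r)) \<le> max C 1 * measure \<mu> (qball \<rho> \<xi> r)" .
  qed
  then show ?thesis by (intro exI[of _ "max C 1"]) auto
qed

lemma Mu_pos: "0 < Mu x"
proof -
  obtain b where b: "b > 0" "\<And>x. \<exists>\<xi>. qball \<rho> \<xi> (b * r0 ^ Lv x) \<subseteq> \<Phi> x" using balls by blast
  then obtain \<xi> where \<xi>: "qball \<rho> \<xi> (b * r0 ^ Lv x) \<subseteq> \<Phi> x" by blast
  have "0 < measure \<mu> (qball \<rho> \<xi> (b * r0 ^ Lv x))" using doubling b(1) r0 by (metis mult_pos_pos zero_less_power)
  also have "\<dots> \<le> Mu x" unfolding Mu_def using \<xi> Phi_sets by (rule \<mu>.finite_measure_mono)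
  finally show ?thesis .
qed

text \<open>The condition \<open>Lv x \<le> Suc (Lv y)\<close> lets one ball serve the horizontal
  neighbours and the parent of \<open>x\<close> alike. \<open>K\<close> is the radius needed in
  units of \<open>r0 ^ Lv x\<close>, and \<open>k\<close> doublings of the ball inside the cell
  reach it.\<close>

lemma cell_ball: "\<exists>\<Lambda>\<ge>1. \<forall>x. \<exists>B\<in>sets \<mu>. measure \<mu> B \<le> \<Lambda> * Mu x \<and>
  (\<forall>y. Lv x \<le> Suc (Lv y) \<longrightarrow> (\<exists>\<xi>\<in>\<Phi> x. \<exists>\<eta>\<in>\<Phi> y. \<rho> \<xi> \<eta> \<le> 2 * \<gamma> * r0 ^ Lv x) \<longrightarrow> \<Phi> y \<subseteq> B)"
proof -
  obtain b C where bC: "b > 0" "C > 0"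
    "\<And>x. \<exists>\<xi>. qball \<rho> \<xi> (b * r0 ^ Lv x) \<subseteq> \<Phi> x \<and> \<Phi> x \<subseteq> qball \<rho> \<xi> (C * r0 ^ Lv x)" using balls by blast
  obtain d where d: "d > 0" "\<And>x \<xi> \<eta>. \<xi> \<in> \<Phi> x \<Longrightarrow> \<eta> \<in> \<Phi> x \<Longrightarrow> \<rho> \<xi> \<eta> \<le> d * r0 ^ Lv x"
    using diameter by blast
  obtain A where A: "A \<ge> 1" "\<And>\<xi> r. 0 < r \<Longrightarrow> measure \<mu> (qball \<rho> \<xi> (2 * r)) \<le> A * measure \<mu> (qball \<rho> \<xi> r)"
    using doubling by blast
  define K where "K = Crho * (C + Crho * (2 * \<gamma> + d / r0))"
  obtain k :: nat where "K / b < 2 ^ k" using real_arch_pow[of 2 "K / b"] by auto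
  then have k: "K < 2 ^ k * b" using bC(1) by (simp add: pos_divide_less_eq)
  have "\<exists>B\<in>sets \<mu>. measure \<mu> B \<le> A ^ k * Mu x \<and>
    (\<forall>y. Lv x \<le> Suc (Lv y) \<longrightarrow> (\<exists>\<xi>\<in>\<Phi> x. \<exists>\<eta>\<in>\<Phi> y. \<rho> \<xi> \<eta> \<le> 2 * \<gamma> * r0 ^ Lv x) \<longrightarrow> \<Phi> y \<subseteq> B)" for x
  proof -
    define n where "n = Lv x"
    obtain \<omega> where \<omega>: "qball \<rho> \<omega> (b * r0 ^ n) \<subseteq> \<Phi> x" "\<Phi> x \<subseteq> qball \<rho> \<omega> (C * r0 ^ n)" 
      using bC(3)[of x] unfolding n_def by blast
    define B where "B = qball \<rho> \<omega> (2 ^ k * (b * r0 ^ n))"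
    have dbl: "measure \<mu> (qball \<rho> \<omega> (2 ^ j * r)) \<le> A ^ j * measure \<mu> (qball \<rho> \<omega> r)" if "0 < r" for j r
    proof (induction j)
      case (Suc j)
      have "measure \<mu> (qball \<rho> \<omega> (2 ^ Suc j * r)) \<le> A * measure \<mu> (qball \<rho> \<omega> (2 ^ j * r))"
        using A(2)[of "2 ^ j * r" \<omega>] that by (simp add: mult.assoc)
      also have "\<dots> \<le> A * (A ^ j * measure \<mu> (qball \<rho> \<omega> r))" using Suc A(1) by (intro mult_left_mono) auto
      finally show ?case by (simp add: mult.assoc)
    qed simp
    have "measure \<mu> B \<le> A ^ k * measure \<mu> (qball \<rho> \<omega> (b * r0 ^ n))"
      unfolding B_def using bC(1) r0 by (intro dbl) auto
    also have "\<dots> \<le> A ^ k * Mu x"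
      unfolding Mu_def using \<omega>(1) Phi_sets A(1) by (intro mult_left_mono \<mu>.finite_measure_mono) auto
    finally have "measure \<mu> B \<le> A ^ k * Mu x" .
    moreover have "\<Phi> y \<subseteq> B" if y: "n \<le> Suc (Lv y)" "\<xi> \<in> \<Phi> x" "\<eta> \<in> \<Phi> y" "\<rho> \<xi> \<eta> \<le> 2 * \<gamma> * r0 ^ n" for y \<xi> \<eta>
    proof
      fix \<zeta> assume "\<zeta> \<in> \<Phi> y"
      then have "\<rho> \<eta> \<zeta> \<le> d * r0 ^ Lv y" using d(2) y by blast
      also have "\<dots> \<le> d / r0 * r0 ^ n"
      proof -
        have "r0 ^ Suc (Lv y) \<le> r0 ^ n" using y(1) r0 by (intro power_decreasing) auto
        then have "r0 ^ Lv y \<le> r0 ^ n / r0" using r0 by (simp add: field_simps)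
        then show ?thesis using d(1) mult_left_mono[of "r0 ^ Lv y" "r0 ^ n / r0" d] by simp
      qed
      finally have 1: "\<rho> \<xi> \<eta> + \<rho> \<eta> \<zeta> \<le> 2 * \<gamma> * r0 ^ n + d / r0 * r0 ^ n" using y(4) by linarith
      have "\<rho> \<xi> \<zeta> \<le> Crho * (\<rho> \<xi> \<eta> + \<rho> \<eta> \<zeta>)" by (rule Crho)
      also have "\<dots> \<le> Crho * (2 * \<gamma> * r0 ^ n + d / r0 * r0 ^ n)" using 1 Crho(1) by (intro mult_left_mono) auto
      finally have 2: "\<rho> \<xi> \<zeta> \<le> Crho * (2 * \<gamma> * r0 ^ n + d / r0 * r0 ^ n)" .
      have 3: "\<rho> \<omega> \<xi> \<le> C * r0 ^ n" using \<omega>(2) y(2) by (auto simp: qball_def)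
      have "\<rho> \<omega> \<zeta> \<le> Crho * (\<rho> \<omega> \<xi> + \<rho> \<xi> \<zeta>)" by (rule Crho)
      also have "\<dots> \<le> Crho * (C * r0 ^ n + Crho * (2 * \<gamma> * r0 ^ n + d / r0 * r0 ^ n))"
        using 2 3 Crho(1) by (intro mult_left_mono) auto
      also have "\<dots> = K * r0 ^ n" by (simp add: K_def algebra_simps)
      also have "\<dots> < 2 ^ k * b * r0 ^ n" using k r0 by (intro mult_strict_right_mono) auto
      finally show "\<zeta> \<in> B" by (simp add: B_def qball_def mult.assoc)
    qed
    ultimately show ?thesis using qball_sets unfolding n_def B_def by blast
  qed
  then show ?thesis using A(1) by (intro exI[of _ "A ^ k"]) auto
qed

lemma null_overlap: "x \<noteq> y \<Longrightarrow> Lv x = Lv y \<Longrightarrow> measure \<mu> (\<Phi> x \<inter> \<Phi> y) = 0"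
  using null_overlap' by (simp add: measure_def)

lemma Mu_sum: "finite S \<Longrightarrow> (\<And>y. y \<in> S \<Longrightarrow> Lv y = n) \<Longrightarrow> measure \<mu> (\<Union>y\<in>S. \<Phi> y) = sum Mu S"
  unfolding Mu_def by (rule \<mu>.measure_UNION_null_overlap) (auto simp: Phi_sets null_overlap)

lemma card_cells:
  assumes S: "finite S" "\<And>y. y \<in> S \<Longrightarrow> Lv y = n" and B: "B \<in> sets \<mu>" "\<And>y. y \<in> S \<Longrightarrow> \<Phi> y \<subseteq> B"
    and a: "0 < a" "\<And>y. y \<in> S \<Longrightarrow> a \<le> Mu y"
  shows "real (card S) \<le> measure \<mu> B / a"
proof -
  have "real (card S) * a \<le> sum Mu S" using a(2) by (intro sum_bounded_below) auto
  also have "\<dots> = measure \<mu> (\<Union>y\<in>S. \<Phi> y)" using Mu_sum[OF S] by simp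
  also have "\<dots> \<le> measure \<mu> B" using B by (intro \<mu>.finite_measure_mono) auto
  finally show ?thesis using a(1) by (simp add: field_simps)
qed

text \<open>Children and horizontal neighbours of \<open>x\<close> overlap in null sets, have
  measure at least \<open>Mu x / \<Lambda>\<close>, and lie in a set of measure at most
  \<open>\<Lambda> * Mu x\<close>. Hence there are at most \<open>\<Lambda> * \<Lambda>\<close> of
  either kind.\<close>

lemma geometry: "\<exists>\<Lambda>\<ge>1. \<forall>x. Mu (pr x) \<le> \<Lambda> * Mu x \<and> (\<forall>y. (x, y) \<in> Eh \<longrightarrow> Mu x \<le> \<Lambda> * Mu y) \<and>
   finite {y. y \<noteq> \<theta> \<and> pr y = x} \<and> finite {y. (x, y) \<in> Eh} \<and> real (card {y. (x, y) \<in> Eh}) \<le> \<Lambda>"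
proof -
  obtain \<Lambda> where L1: "\<Lambda> \<ge> 1" and L: "\<And>x. \<exists>B\<in>sets \<mu>. measure \<mu> B \<le> \<Lambda> * Mu x \<and>
    (\<forall>y. Lv x \<le> Suc (Lv y) \<longrightarrow> (\<exists>\<xi>\<in>\<Phi> x. \<exists>\<eta>\<in>\<Phi> y. \<rho> \<xi> \<eta> \<le> 2 * \<gamma> * r0 ^ Lv x) \<longrightarrow> \<Phi> y \<subseteq> B)"
    using cell_ball by blast
  have cmp: "Mu y \<le> \<Lambda> * Mu x"
    if y: "Lv x \<le> Suc (Lv y)" "\<exists>\<xi>\<in>\<Phi> x. \<exists>\<eta>\<in>\<Phi> y. \<rho> \<xi> \<eta> \<le> 2 * \<gamma> * r0 ^ Lv x" for x y
  proof -
    obtain B where B: "B \<in> sets \<mu>" "measure \<mu> B \<le> \<Lambda> * Mu x" "\<Phi> y \<subseteq> B" using L[of x] y by blast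
    then have "Mu y \<le> measure \<mu> B" unfolding Mu_def by (intro \<mu>.finite_measure_mono)
    then show ?thesis using B(2) by simp
  qed
  have pr: "Mu (pr x) \<le> \<Lambda> * Mu x" for x
  proof (rule cmp)
    obtain \<xi> where "\<xi> \<in> \<Phi> x" using Phi_nonempty by blast
    moreover have "\<rho> \<xi> \<xi> = 0" using rho(2) by blast
    ultimately show "\<exists>\<xi>\<in>\<Phi> x. \<exists>\<eta>\<in>\<Phi> (pr x). \<rho> \<xi> \<eta> \<le> 2 * \<gamma> * r0 ^ Lv x"
      using Phi_sub_pr gamma_pos r0 by (intro bexI[of _ \<xi>]) auto
  qed (simp add: Lv_pr)
  have near: "Lv x \<le> Suc (Lv y) \<and> (\<exists>\<xi>\<in>\<Phi> x. \<exists>\<eta>\<in>\<Phi> y. \<rho> \<xi> \<eta> \<le> 2 * \<gamma> * r0 ^ Lv x)" if "(x, y) \<in> Eh" for x y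
  proof -
    have "x = y \<or> (x, y) \<in> Eh" using that ..
    then obtain \<xi> \<eta> where "\<xi> \<in> \<Phi> x" "\<eta> \<in> \<Phi> y" "\<rho> \<xi> \<eta> \<le> 2 * \<gamma> * r0 ^ Lv x" by (rule Eh_close)
    moreover have "Lv x = Lv y" using that by (simp add: Eh_iff)
    ultimately show ?thesis by auto
  qed
  have Eh_sym: "(y, x) \<in> Eh" if "(x, y) \<in> Eh" for x y
    using that set_qdist_sym[of y x] by (auto simp: Eh_iff)
  have H: "Mu x \<le> \<Lambda> * Mu y" if "(x, y) \<in> Eh" for x y
    using near[OF Eh_sym[OF that]] by (intro cmp) auto
  have children: "finite {y. y \<noteq> \<theta> \<and> pr y = x}" for x
  proof -
    have "card S \<le> nat \<lceil>\<Lambda>\<rceil>" if S: "S \<subseteq> {y. y \<noteq> \<theta> \<and> pr y = x}" "finite S" for S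
    proof -
      have "real (card S) \<le> measure \<mu> (\<Phi> x) / (Mu x / \<Lambda>)"
      proof (rule card_cells[OF S(2) _ Phi_sets])
        fix y assume y: "y \<in> S"
        then have "y \<noteq> \<theta>" "pr y = x" using S by auto
        then show "Lv y = Suc (Lv x)" "\<Phi> y \<subseteq> \<Phi> x" "Mu x / \<Lambda> \<le> Mu y"
          using pr_unique(2)[of y] Phi_sub_pr[of y] pr[of y] L1 by (auto simp: field_simps)
      qed (use Mu_pos[of x] L1 in auto)
      also have "\<dots> = \<Lambda>" using Mu_pos[of x] by (simp add: Mu_def)
      finally show ?thesis by linarith
    qed
    then show ?thesis
      using finite_if_finite_subsets_card_bdd[of "{y. y \<noteq> \<theta> \<and> pr y = x}" "nat \<lceil>\<Lambda>\<rceil>"] by simp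
  qed
  have horizontal: "finite {y. (x, y) \<in> Eh} \<and> card {y. (x, y) \<in> Eh} \<le> nat \<lfloor>\<Lambda> * \<Lambda>\<rfloor>" for x
  proof (rule finite_if_finite_subsets_card_bdd)
    fix S assume S: "S \<subseteq> {y. (x, y) \<in> Eh}" "finite S"
    obtain B where B: "B \<in> sets \<mu>" "measure \<mu> B \<le> \<Lambda> * Mu x"
      "\<And>y. (x, y) \<in> Eh \<Longrightarrow> \<Phi> y \<subseteq> B" using L[of x] near by blast
    have "real (card S) \<le> measure \<mu> B / (Mu x / \<Lambda>)"
    proof (rule card_cells[OF S(2) _ B(1)])
      fix y assume y: "y \<in> S"
      then have "(x, y) \<in> Eh" using S by auto
      then show "Lv y = Lv x" "\<Phi> y \<subseteq> B" "Mu x / \<Lambda> \<le> Mu y"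
        using B(3)[of y] H[of x y] L1 by (auto simp: Eh_iff field_simps)
    qed (use Mu_pos[of x] L1 in auto)
    also have "\<dots> \<le> \<Lambda> * Mu x / (Mu x / \<Lambda>)" using B(2) Mu_pos[of x] L1 by (intro divide_right_mono) auto
    also have "\<dots> = \<Lambda> * \<Lambda>" using Mu_pos[of x] by simp
    finally show "card S \<le> nat \<lfloor>\<Lambda> * \<Lambda>\<rfloor>" by (simp add: le_nat_floor)
  qed
  have LL: "\<Lambda> \<le> \<Lambda> * \<Lambda>" using L1 by simp
  have mono: "\<Lambda> * Mu x \<le> \<Lambda> * \<Lambda> * Mu x" for x using LL Mu_pos[of x] by (intro mult_right_mono) auto
  have card: "real (card {y. (x, y) \<in> Eh}) \<le> \<Lambda> * \<Lambda>" for x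
    using horizontal[of x] L1 by (simp add: le_floor_iff nat_le_iff zero_le_mult_iff le_nat_iff)
  show ?thesis
  proof (intro exI[of _ "\<Lambda> * \<Lambda>"] conjI allI impI)
    show "1 \<le> \<Lambda> * \<Lambda>" using LL L1 by linarith
    show "Mu (pr x) \<le> \<Lambda> * \<Lambda> * Mu x" for x using pr[of x] mono[of x] by linarith
    show "Mu x \<le> \<Lambda> * \<Lambda> * Mu y" if "(x, y) \<in> Eh" for x y using H[OF that] mono[of y] by linarith
  qed (use children horizontal card in auto)
qed

section \<open>Points of the space as boundary points\<close>

lemma ray_of_point:
  "\<exists>r. (\<forall>n. Lv (r n) = n \<and> pr (r (Suc n)) = r n) \<and> (\<forall>n. \<eta> \<in> \<Phi> (r n))"
proof -
  have "\<exists>r. \<forall>n. (Lv (r n) = n \<and> \<eta> \<in> \<Phi> (r n)) \<and> pr (r (Suc n)) = r n"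
  proof (rule dependent_nat_choice)
    show "\<exists>x. Lv x = 0 \<and> \<eta> \<in> \<Phi> x" by (intro exI[of _ \<theta>]) (simp add: Phi_root Lv_root)
  next
    fix x n assume x: "Lv x = n \<and> \<eta> \<in> \<Phi> x"
    then obtain y where "y \<noteq> \<theta>" "pr y = x" "\<eta> \<in> \<Phi> y" using Phi_children[of x] by blast
    then show "\<exists>y. (Lv y = Suc n \<and> \<eta> \<in> \<Phi> y) \<and> pr y = x" using x pr_unique(2)[of y] by auto
  qed
  then show ?thesis by auto
qed

text \<open>\<open>inv_into\<close> is meaningful only on the image, so the point is that
  \<open>kappa\<close> attains every \<open>\<eta>\<close>. It does so at the class of a ray whose
  cells contain \<open>\<eta>\<close>: any other ray of this class runs through equal or adjacent
  cells, which shrink to the same point.\<close>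

lemma boundary_point_in:
  assumes aug: "aug_tree \<theta> pr Lv Eh m" and a: "0 < a"
  shows "boundary_point (aug_tree.E \<theta> pr Eh) \<theta> \<Phi> a \<eta> \<in> hyperbolic_boundary (aug_tree.E \<theta> pr Eh) \<theta> a"
proof -
  interpret aug_tree \<theta> pr Lv Eh m by (rule aug)
  obtain C where C: "C > 0" "\<And>x \<xi> \<eta>. \<xi> \<in> \<Phi> x \<Longrightarrow> \<eta> \<in> \<Phi> x \<Longrightarrow> \<rho> \<xi> \<eta> \<le> C * r0 ^ Lv x"
    using diameter by blast
  obtain r where r: "ray r" "\<And>n. \<eta> \<in> \<Phi> (r n)" using ray_of_point[of \<eta>] by (auto simp: ray_def)
  define p where "p = visual_class E \<theta> a r"
  have p: "p \<in> hyperbolic_boundary E \<theta> a" unfolding p_def by (rule visual_class_ray_boundary[OF r(1) a])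
  have tp: "t \<in> p \<longleftrightarrow> tends_to_end t r" for t
    unfolding p_def by (rule visual_class_iff[OF r(1) ray_tends_to_end[OF r(1)] a])
  have inter: "(\<Inter>n. \<Phi> (g n)) = {\<eta>}" if g: "root_ray E \<theta> g" "g \<in> p" for g
  proof -
    have ray_g: "ray g" using g(1) by (simp add: root_ray_iff)
    have adj: "g n = r n \<or> (g n, r n) \<in> Eh" for n
    proof -
      have "\<forall>\<^sub>F k in sequentially. near n (g k) (r n) \<and> n \<le> k"
        using g(2) unfolding tp tends_to_end_def by (intro eventually_conj eventually_ge_at_top) auto
      then obtain k where "near n (g k) (r n)" "n \<le> k"
        using eventually_happens'[OF sequentially_bot] by blast
      then show ?thesis
        using ray_anc[OF ray_g, of n k] anc_self[of "r n"] ray_L[OF r(1), of n] by (auto simp: near_def adj_def)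
    qed
    have sub: "\<Phi> (g N) \<subseteq> \<Phi> (g n)" if "n \<le> N" for n N
      using that
    proof (induction N rule: dec_induct)
      case (step N)
      have "pr (g (Suc N)) = g N" using ray_g by (simp add: ray_def)
      then show ?case using step Phi_sub_pr[of "g (Suc N)"] by auto
    qed simp
    have r0_lim: "\<exists>N\<ge>n. K * r0 ^ N < e" if eK: "0 < e" "0 < K" for e K :: real and n
    proof -
      obtain N where "r0 ^ N < e / K" using real_arch_pow_inv[of "e / K" r0] eK r0 by auto
      moreover have "r0 ^ max n N \<le> r0 ^ N" using r0 by (intro power_decreasing) auto
      ultimately have "r0 ^ max n N < e / K" by linarith
      then have "K * r0 ^ max n N < e" using eK by (simp add: field_simps)
      then show ?thesis by (intro exI[of _ "max n N"]) auto
    qed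
    have eta: "\<eta> \<in> \<Phi> (g n)" for n
    proof (rule ccontr)
      assume "\<eta> \<notin> \<Phi> (g n)"
      moreover have "openin (qtopology \<rho>) (UNIV - \<Phi> (g n))"
        using Phi_closed[of "g n"] by (simp add: closedin_def topspace_qtopology)
      ultimately obtain e where e: "e > 0" "qball \<rho> \<eta> e \<subseteq> UNIV - \<Phi> (g n)"
        unfolding openin_qtopology by blast
      define K where "K = Crho * (C + 2 * \<gamma>)"
      have "0 < K" using C(1) Crho(1) gamma_pos by (simp add: K_def add_pos_pos)
      then obtain N where N: "N \<ge> n" "K * r0 ^ N < e" using r0_lim e(1) by blast
      have LN: "Lv (g N) = N" "Lv (r N) = N" using ray_g r(1) ray_L by auto
      obtain \<xi> \<zeta> where \<xi>: "\<xi> \<in> \<Phi> (g N)" "\<zeta> \<in> \<Phi> (r N)" "\<rho> \<xi> \<zeta> \<le> 2 * \<gamma> * r0 ^ N"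
        using Eh_close[OF adj[of N]] by (auto simp: LN)
      have "\<rho> \<eta> \<zeta> \<le> C * r0 ^ N" using C(2)[OF r(2) \<xi>(2)] by (simp add: LN)
      then have "Crho * (\<rho> \<eta> \<zeta> + \<rho> \<zeta> \<xi>) \<le> Crho * (C * r0 ^ N + 2 * \<gamma> * r0 ^ N)"
        using \<xi>(3) rho(3)[of \<xi> \<zeta>] Crho(1) by (intro mult_left_mono) auto
      also have "\<dots> = K * r0 ^ N" by (simp add: K_def algebra_simps)
      finally have "\<rho> \<eta> \<xi> < e" using Crho(2)[of \<eta> \<xi> \<zeta>] N(2) by linarith
      then have "\<xi> \<in> qball \<rho> \<eta> e" by (simp add: qball_def)
      then show False using e(2) sub[OF N(1)] \<xi>(1) by blast
    qed
    have "\<xi> = \<eta>" if \<xi>: "\<And>n. \<xi> \<in> \<Phi> (g n)" for \<xi>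
    proof (rule ccontr)
      assume "\<xi> \<noteq> \<eta>"
      then have "0 < \<rho> \<xi> \<eta>" using rho(1,2)[of \<xi> \<eta>] by auto
      then obtain N where "C * r0 ^ N < \<rho> \<xi> \<eta>" using r0_lim C(1) by blast
      then show False using C(2)[OF \<xi> eta, of N] ray_L[OF ray_g, of N] by simp
    qed
    then show ?thesis using eta by blast
  qed
  have rp: "root_ray E \<theta> r" "r \<in> p" using r(1) by (auto simp: root_ray_iff tp ray_tends_to_end)
  have "kappa E \<theta> \<Phi> p = \<eta>"
    unfolding kappa_def
  proof (rule the_equality)
    show "\<forall>g. root_ray E \<theta> g \<and> g \<in> p \<longrightarrow> (\<Inter>n. \<Phi> (g n)) = {\<eta>}" using inter by blast
  next
    fix \<eta>' assume "\<forall>g. root_ray E \<theta> g \<and> g \<in> p \<longrightarrow> (\<Inter>n. \<Phi> (g n)) = {\<eta>'}"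
    then have "{\<eta>} = {\<eta>'}" using rp inter by metis
    then show "\<eta>' = \<eta>" by simp
  qed
  then have "\<eta> \<in> kappa E \<theta> \<Phi> ` hyperbolic_boundary E \<theta> a" using p by blast
  then show ?thesis unfolding boundary_point_def by (rule inv_into_into)
qed

lemma natural_walk_exists:
  assumes nat: "natural_conductance \<mu> Ev Eh \<theta> \<Phi> l c" and l: "0 < l" "l < 1"
  shows "\<exists>m \<Lambda>. natural_walk \<theta> pr Lv Eh m Mu c l \<Lambda>"
proof -
  obtain m where m: "aug_tree \<theta> pr Lv Eh m" using aug_tree_exists by blast
  interpret aug_tree \<theta> pr Lv Eh m by (rule m)
  obtain G where G: "G \<ge> 1" "\<And>x. Mu (pr x) \<le> G * Mu x" "\<And>x y. (x, y) \<in> Eh \<Longrightarrow> Mu x \<le> G * Mu y"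
   "\<And>x. finite {y. y \<noteq> \<theta> \<and> pr y = x}" "\<And>x. finite {y. (x, y) \<in> Eh}" "\<And>x. real (card {y. (x, y) \<in> Eh}) \<le> G"
    using geometry by blast
  have c_par: "c x (pr x) = Mu x / l ^ Lv x" if "x \<noteq> \<theta>" for x
    using nat that l by (simp add: natural_conductance_def pr_def Lv_def Mu_def powr_minus powr_realpow field_simps)
  obtain C where C: "C > 0" "\<And>x y. (x, y) \<in> Eh \<Longrightarrow> inverse C * c x (parent Ev \<theta> x) \<le> c x y \<and> c x y \<le> C * c x (parent Ev \<theta> x)"
    using nat unfolding natural_conductance_def comparable_on_def by fastforce
  have cH: "inverse C * (Mu x / l ^ Lv x) \<le> c x y \<and> c x y \<le> C * (Mu x / l ^ Lv x)" if "(x, y) \<in> Eh" for x y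
  proof -
    have "x \<noteq> \<theta>" using that by (auto simp: Eh_iff Lv_root)
    then show ?thesis using C(2)[OF that] c_par[of x] by (simp add: pr_def)
  qed
  define \<Lambda> where "\<Lambda> = max G C"
  have L: "G \<le> \<Lambda>" "C \<le> \<Lambda>" "1 \<le> \<Lambda>" using G(1) by (auto simp: \<Lambda>_def)
  have mono: "G * Mu x \<le> \<Lambda> * Mu x" for x using L Mu_pos[of x] by (intro mult_right_mono) auto
  have E_eq: "E = Ev \<union> Eh" by (simp add: E_def Ev_eq[symmetric])
  have q: "0 < Mu x / l ^ Lv x" for x using Mu_pos l by simp
  have "natural_walk \<theta> pr Lv Eh m Mu c l \<Lambda>"
  proof
    show "Mu x = (\<Sum>y | y \<noteq> \<theta> \<and> pr y = x. Mu y)" for x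
    proof -
      have "measure \<mu> (\<Union>y\<in>{y. y \<noteq> \<theta> \<and> pr y = x}. \<Phi> y) = (\<Sum>y | y \<noteq> \<theta> \<and> pr y = x. Mu y)"
        using G(4) pr_unique(2) by (intro Mu_sum[of _ "Suc (Lv x)"]) auto
      then show ?thesis using Phi_children[of x] by (simp add: Mu_def)
    qed
    show "c x y = c y x" for x y using nat by (simp add: natural_conductance_def conductance_def)
    show "c x y = 0" if "(x, y) \<notin> E" for x y
      using nat that by (simp add: natural_conductance_def conductance_def E_eq) (metis order_le_less UnCI)
    show "Mu x / (\<Lambda> * l ^ Lv x) \<le> c x y" if "(x, y) \<in> Eh" for x y
    proof -
      have "inverse \<Lambda> * (Mu x / l ^ Lv x) \<le> inverse C * (Mu x / l ^ Lv x)"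
        using L C(1) q[of x] by (intro mult_right_mono le_imp_inverse_le) auto
      then show ?thesis using cH[OF that] by (simp add: field_simps)
    qed
    show "c x y \<le> \<Lambda> * Mu x / l ^ Lv x" if "(x, y) \<in> Eh" for x y
    proof -
      have "C * (Mu x / l ^ Lv x) \<le> \<Lambda> * (Mu x / l ^ Lv x)" using L q[of x] by (intro mult_right_mono) auto
      then show ?thesis using cH[OF that] by simp
    qed
    show "Mu (pr x) \<le> \<Lambda> * Mu x" for x using G(2)[of x] mono[of x] by linarith
    show "Mu x \<le> \<Lambda> * Mu y" if "(x, y) \<in> Eh" for x y using G(3)[OF that] mono[of y] by linarith
    show "real (card {y. (x, y) \<in> Eh}) \<le> \<Lambda>" for x using G(6)[of x] L by linarith
  qed (use l L G Mu_pos c_par in auto)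
  then show ?thesis by blast
qed

end

lemma comparable_onI:
  assumes "C > 0" "\<And>v. v \<in> S \<Longrightarrow> f v \<le> C * g v \<and> g v \<le> C * f v"
  shows "comparable_on S f g"
  unfolding comparable_on_def
proof (intro exI[of _ C] conjI ballI)
  fix v assume "v \<in> S"
  then show "inverse C * g v \<le> f v" "f v \<le> C * g v"
    using assms by (auto simp: field_simps)
qed (rule assms)

theorem theorem4p5:
  fixes \<rho> :: "'k \<Rightarrow> 'k \<Rightarrow> real" and \<mu> :: "'k measure"
    and Ev Eh E :: "('x \<times> 'x) set" and \<theta> :: 'x and \<Phi> :: "'x \<Rightarrow> 'k set"
    and r0 \<gamma> l a :: real and c :: "'x \<Rightarrow> 'x \<Rightarrow> real"
    and Pr :: "'x \<Rightarrow> 'w measure" and Z :: "nat \<Rightarrow> 'w \<Rightarrow> 'x"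
  assumes "compact_homogeneous_space \<rho> \<mu>" and "normalized_space \<rho> \<mu>"
    and "index_tree \<rho> \<mu> Ev \<theta> \<Phi> r0"
    and "\<gamma> > 0" and "Eh = horizontal_edges \<rho> Ev \<theta> \<Phi> r0 \<gamma>" and "E = Ev \<union> Eh"
    and "0 < l" and "l < 1"
    and "natural_conductance \<mu> Ev Eh \<theta> \<Phi> l c"
    and "\<And>x. markov_chain_from (transition c) x (Pr x) Z"
    and "a > 0"
  shows "comparable_on UNIV
           (\<lambda>(x, y). visiting_prob Pr Z x y)
           (\<lambda>(x, y). l powr (real (lev E \<theta> x) - gromov E \<theta> x y)
              * measure \<mu> (\<Phi> y) * inverse (p_mu E \<theta> \<Phi> \<mu> a x (Inl y))) \<and>
         comparable_on UNIV
           (\<lambda>(x, \<eta>). martin_ext E \<theta> \<Phi> a (transition c) x \<eta>)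
           (\<lambda>(x, \<eta>). l powr (real (lev E \<theta> x) - gromov_ext E \<theta> \<Phi> a x \<eta>)
              * inverse (p_mu E \<theta> \<Phi> \<mu> a x \<eta>))"
proof -
  interpret X: index_space \<rho> \<mu> Ev \<theta> \<Phi> r0 \<gamma>
    using assms(1-4) by unfold_locales
  have Eh: "X.Eh = Eh" using assms(5) by (simp add: X.Eh_def)
  obtain m \<Lambda> where "natural_walk \<theta> X.pr X.Lv X.Eh m X.Mu c l \<Lambda>"
    using X.natural_walk_exists[OF assms(9)[folded Eh] assms(7,8)] by blast
  then interpret W: natural_walk \<theta> X.pr X.Lv X.Eh m X.Mu c l \<Lambda> .
  have E: "W.E = E" using assms(6) 
    unfolding W.E_def unfolding X.Ev_eq[symmetric] Eh by simp
  have bp: "boundary_point W.E \<theta> \<Phi> a \<xi> \<in> hyperbolic_boundary W.E \<theta> a" for \<xi>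
    by (rule X.boundary_point_in[OF W.aug_tree_axioms assms(11)])
  have mc: "markov_chain_from W.P x (Pr x) Z" for x
    using assms(10) by (simp add: W.transition_eq)
  have Phi: "measure \<mu> (\<Phi> z) = X.Mu z" for z by (simp add: X.Mu_def)
  note est = W.walk_estimates[where \<Phi> = \<Phi> and \<mu> = \<mu> and Pr = Pr and Z = Z, OF assms(11) Phi bp mc, unfolded E]
  obtain C where C: "C > 0" "\<And>x y. visiting_prob Pr Z x y \<le>
        C * (l powr (real (lev E \<theta> x) - gromov E \<theta> x y) * X.Mu y * inverse (p_mu E \<theta> \<Phi> \<mu> a x (Inl y))) \<and>
      l powr (real (lev E \<theta> x) - gromov E \<theta> x y) * X.Mu y * inverse (p_mu E \<theta> \<Phi> \<mu> a x (Inl y))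
        \<le> C * visiting_prob Pr Z x y"
    using est(1) by blast
  obtain C' where C': "C' > 0" "\<And>x e. martin_ext E \<theta> \<Phi> a W.P x e \<le>
        C' * (l powr (real (lev E \<theta> x) - gromov_ext E \<theta> \<Phi> a x e) * inverse (p_mu E \<theta> \<Phi> \<mu> a x e)) \<and>
      l powr (real (lev E \<theta> x) - gromov_ext E \<theta> \<Phi> a x e) * inverse (p_mu E \<theta> \<Phi> \<mu> a x e)
        \<le> C' * martin_ext E \<theta> \<Phi> a W.P x e"
    using est(2) by blast
  show ?thesis
    by (intro conjI comparable_onI[OF C(1)] comparable_onI[OF C'(1)])
      (auto simp: W.transition_eq Phi split: prod.splits intro: C(2)[THEN conjunct1] C(2)[THEN conjunct2]
        C'(2)[THEN conjunct1] C'(2)[THEN conjunct2])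
qed

end
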